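(* Let $\Omega\subset\mathbb{R}^N$ be a domain with $0\in\Omega$, let $p\in(2,2^* )$, and suppose that $V$, $V_n=V+K_n$ and $Q_n$ ($n\in\mathbb{N}$) satisfy conditions (A1) and (A2) stated in the context. For each (sufficiently large) $n$ let $u_n$ be a nontrivial solution of $$-\Delta u+V_n(x)u=Q_n(x)|u|^{p-2}u \ \text{ in }\Omega,\qquad u\in H^1_0(\Omega),\qquad (\mathrm{P}_n)$$ and let $w_n=u_n/\|u_n\|_n$. Then for every $\varepsilon>0$ $$\lim_{n\to\infty}\int_{\Omega\setminus B_\varepsilon(0)}(|\nabla w_n|^2+V_nw_n^2)\,dx=0 \quad\text{and}\quad \lim_{n\to\infty}\|u_n\|_n^{p-2}\int_{\Omega\setminus B_\varepsilon(0)}|w_n|^p\,dx=0.$$ Moreover, for every $\varepsilon>0$, $$\lim_{n\to\infty}\frac{\int_{\Omega\setminus B_\varepsilon(0)}(|\nabla u_n|^2+V_nu_n^2)\,dx}{\int_\Omega(|\nabla u_n|^2+V_nu_n^2)\,dx}=0 \quad\text{and}\quad \lim_{n\to\infty}\frac{\int_{\Omega\setminus B_\varepsilon(0)}|u_n|^p\,dx}{\int_\Omega|u_n|^p\,dx}=0.$$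
   Context: $\Omega$ may be bounded or unbounded (including $\Omega=\mathbb{R}^N$). $2^*:=2N/(N-2)$ if $N\ge3$, $2^*:=\infty$ if $N=1,2$. $B_r(a)$ is the open ball of radius $r$ centred at $a$. Functions are real-valued. (A1) $V\in L^\infty(\Omega)$, $V\ge0$, and $\sigma(-\Delta+V)\subset(0,\infty)$, where the spectrum is that of $-\Delta+V$ with zero Dirichlet boundary conditions (realized in $H^1_0(\Omega)$). $V_n=V+K_n$ with $K_n\in L^\infty(\Omega)$, and there is a constant $B$ with $\|K_n\|_\infty\le B$ for all $n$. Moreover, for each $\varepsilon>0$ there is $N_\varepsilon$ such that $\operatorname{supp}K_n\subset B_\varepsilon(0)$ whenever $n\ge N_\varepsilon$. (A2) $Q_n\in L^\infty(\Omega)$, $Q_n>0$ on a set of positive measure, and there is a constant $C$ with $\|Q_n\|_\infty\le C$ for all $n$. Moreover, for each $\varepsilon>0$ there exist $\delta_\varepsilon>0$ and $N_\varepsilon$ such that $Q_n(x)\le-\delta_\varepsilon$ whenever $x\in\Omega\setminus B_\varepsilon(0)$ and $n\ge N_\varepsilon$. $\|u\|_n:=\left(\int_\Omega(|\nabla u|^2+V_nu^2)\,dx\right)^{1/2}$; for all large $n$ this is a norm on $H^1_0(\Omega)$ equivalent to the usual one, and only such $n$ are considered. Solutions of $(\mathrm{P}_n)$ are weak solutions in $H^1_0(\Omega)$, i.e. $\int_\Omega(\nabla u\cdot\nabla\varphi+V_nu\varphi)\,dx=\int_\Omega Q_n|u|^{p-2}u\varphi\,dx$ for all $\varphi\in H^1_0(\Omega)$;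 the conditions $u=0$ on $\partial\Omega$ and $u(x)\to0$ as $|x|\to\infty$ are encoded in $u\in H^1_0(\Omega)$. *)

theory Defs
  imports "HOL-Analysis.Analysis" "HOL-Probability.Essential_Supremum"
begin

section \<open>Lebesgue spaces\<close>

text \<open>Functions on \<open>\<Omega>\<close> are represented by total functions; only their values almost everywhere
  on \<open>\<Omega>\<close> matter, and elements of the function spaces are representatives of the usual classes.\<close>

definition Ltwo :: "'a::euclidean_space set \<Rightarrow> ('a \<Rightarrow> 'b::euclidean_space) \<Rightarrow> bool" where
  "Ltwo \<Omega> f \<longleftrightarrow> f \<in> borel_measurable (lebesgue_on \<Omega>) \<and>
     integrable (lebesgue_on \<Omega>) (\<lambda>x. (norm (f x))\<^sup>2)"

definition Ltwo_norm :: "'a::euclidean_space set \<Rightarrow> ('a \<Rightarrow> 'b::euclidean_space) \<Rightarrow> real" where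
  "Ltwo_norm \<Omega> f = sqrt (\<integral>x. (norm (f x))\<^sup>2 \<partial>lebesgue_on \<Omega>)"

definition Linf_norm :: "'a::euclidean_space set \<Rightarrow> ('a \<Rightarrow> real) \<Rightarrow> ereal" where
  "Linf_norm \<Omega> f = esssup (lebesgue_on \<Omega>) (\<lambda>x. ereal \<bar>f x\<bar>)"

definition Linf :: "'a::euclidean_space set \<Rightarrow> ('a \<Rightarrow> real) \<Rightarrow> bool" where
  "Linf \<Omega> f \<longleftrightarrow> f \<in> borel_measurable (lebesgue_on \<Omega>) \<and> Linf_norm \<Omega> f < \<infinity>"

text \<open>The support of an a.e. class: the complement of the largest open set on which the
  function vanishes almost everywhere.\<close>

definition ess_support :: "'a::euclidean_space set \<Rightarrow> ('a \<Rightarrow> real) \<Rightarrow> 'a set" where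
  "ess_support \<Omega> f = {x. \<forall>r>0. \<not> (AE y in lebesgue_on \<Omega>. y \<in> ball x r \<longrightarrow> f y = 0)}"


section \<open>Sobolev spaces\<close>

text \<open>\<open>C\<^sup>k\<close> functions on the whole space, via continuity of the iterated partial derivatives.\<close>

primrec Ck :: "nat \<Rightarrow> ('a::euclidean_space \<Rightarrow> real) \<Rightarrow> bool" where
  "Ck 0 f = continuous_on UNIV f"
| "Ck (Suc k) f = ((\<forall>x. f differentiable at x) \<and>
     (\<forall>b\<in>Basis. Ck k (\<lambda>x. frechet_derivative f (at x) b)))"

text \<open>\<open>C\<^sub>c\<^sup>\<infinity>(\<Omega>)\<close>, with its elements extended by zero to the whole space.\<close>

definition test_fun :: "'a::euclidean_space set \<Rightarrow> ('a \<Rightarrow> real) \<Rightarrow> bool" where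
  "test_fun \<Omega> \<phi> \<longleftrightarrow> (\<forall>k. Ck k \<phi>) \<and>
     compact (closure {x. \<phi> x \<noteq> 0}) \<and> closure {x. \<phi> x \<noteq> 0} \<subseteq> \<Omega>"

definition loc_integrable ::
    "'a::euclidean_space set \<Rightarrow> ('a \<Rightarrow> 'b::euclidean_space) \<Rightarrow> bool" where
  "loc_integrable \<Omega> f \<longleftrightarrow> (\<forall>K. compact K \<and> K \<subseteq> \<Omega> \<longrightarrow> integrable (lebesgue_on K) f)"

definition has_weak_gradient ::
    "'a::euclidean_space set \<Rightarrow> ('a \<Rightarrow> real) \<Rightarrow> ('a \<Rightarrow> 'a) \<Rightarrow> bool" where
  "has_weak_gradient \<Omega> u g \<longleftrightarrow> loc_integrable \<Omega> u \<and> loc_integrable \<Omega> g \<and>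
     (\<forall>\<phi>. test_fun \<Omega> \<phi> \<longrightarrow> (\<forall>b\<in>Basis.
        (\<integral>x. u x * frechet_derivative \<phi> (at x) b \<partial>lebesgue_on \<Omega>) =
        - (\<integral>x. (g x \<bullet> b) * \<phi> x \<partial>lebesgue_on \<Omega>)))"

text \<open>For open \<open>\<Omega>\<close> the weak gradient is unique up to null sets, so the choice is immaterial
  under the integral sign.\<close>

definition wgrad :: "'a::euclidean_space set \<Rightarrow> ('a \<Rightarrow> real) \<Rightarrow> 'a \<Rightarrow> 'a" where
  "wgrad \<Omega> u = (SOME g. has_weak_gradient \<Omega> u g)"

definition H1 :: "'a::euclidean_space set \<Rightarrow> ('a \<Rightarrow> real) set" where
  "H1 \<Omega> = {u. Ltwo \<Omega> u \<and> (\<exists>g. has_weak_gradient \<Omega> u g \<and> Ltwo \<Omega> g)}"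

definition H1_norm :: "'a::euclidean_space set \<Rightarrow> ('a \<Rightarrow> real) \<Rightarrow> real" where
  "H1_norm \<Omega> u = sqrt ((Ltwo_norm \<Omega> u)\<^sup>2 + (Ltwo_norm \<Omega> (wgrad \<Omega> u))\<^sup>2)"

text \<open>The closure of \<open>C\<^sub>c\<^sup>\<infinity>(\<Omega>)\<close> in \<open>H\<^sup>1(\<Omega>)\<close>.\<close>

definition H10 :: "'a::euclidean_space set \<Rightarrow> ('a \<Rightarrow> real) set" where
  "H10 \<Omega> = {u \<in> H1 \<Omega>. \<forall>e>0. \<exists>\<phi>. test_fun \<Omega> \<phi> \<and> H1_norm \<Omega> (\<lambda>x. u x - \<phi> x) < e}"

definition critical_exponent :: "nat \<Rightarrow> ereal" where
  "critical_exponent N = (if N \<ge> 3 then ereal (2 * real N / (real N - 2)) else \<infinity>)"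


section \<open>The Dirichlet Schroedinger operator and its spectrum\<close>

definition schroedinger_form ::
    "'a::euclidean_space set \<Rightarrow> ('a \<Rightarrow> real) \<Rightarrow> ('a \<Rightarrow> real) \<Rightarrow> ('a \<Rightarrow> real) \<Rightarrow> real" where
  "schroedinger_form \<Omega> W u \<phi> =
     (\<integral>x. wgrad \<Omega> u x \<bullet> wgrad \<Omega> \<phi> x + W x * u x * \<phi> x \<partial>lebesgue_on \<Omega>)"

text \<open>The graph of \<open>-\<Delta> + W\<close> in real \<open>L\<^sup>2(\<Omega>)\<close>: \<open>u\<close> is in the domain and is mapped to \<open>f\<close>.\<close>

definition schroedinger_op ::
    "'a::euclidean_space set \<Rightarrow> ('a \<Rightarrow> real) \<Rightarrow> ('a \<Rightarrow> real) \<Rightarrow> ('a \<Rightarrow> real) \<Rightarrow> bool" where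
  "schroedinger_op \<Omega> W u f \<longleftrightarrow> u \<in> H10 \<Omega> \<and> Ltwo \<Omega> f \<and>
     (\<forall>\<phi>\<in>H10 \<Omega>. schroedinger_form \<Omega> W u \<phi> = (\<integral>x. f x * \<phi> x \<partial>lebesgue_on \<Omega>))"

text \<open>Its complexification in complex \<open>L\<^sup>2(\<Omega>)\<close>; as \<open>W\<close> is real, it acts separately on the real
  and imaginary parts.\<close>

definition schroedinger_op_complex ::
    "'a::euclidean_space set \<Rightarrow> ('a \<Rightarrow> real) \<Rightarrow> ('a \<Rightarrow> complex) \<Rightarrow> ('a \<Rightarrow> complex) \<Rightarrow> bool" where
  "schroedinger_op_complex \<Omega> W u f \<longleftrightarrow>
     schroedinger_op \<Omega> W (\<lambda>x. Re (u x)) (\<lambda>x. Re (f x)) \<and>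
     schroedinger_op \<Omega> W (\<lambda>x. Im (u x)) (\<lambda>x. Im (f x))"

text \<open>Those \<open>\<mu>\<close> for which \<open>A - \<mu>\<close>, where \<open>A = -\<Delta> + W\<close>, maps its domain bijectively onto
  \<open>L\<^sup>2(\<Omega>)\<close> with bounded inverse. The first conjunct is surjectivity (\<open>A u = f + \<mu> u\<close>); the
  second is \<open>\<parallel>u\<parallel> \<le> C \<parallel>(A - \<mu>) u\<parallel>\<close>, i.e. injectivity together with boundedness of the inverse.\<close>

definition schroedinger_resolvent_set ::
    "'a::euclidean_space set \<Rightarrow> ('a \<Rightarrow> real) \<Rightarrow> complex set" where
  "schroedinger_resolvent_set \<Omega> W = {\<mu>.
     (\<forall>f. Ltwo \<Omega> f \<longrightarrow> (\<exists>u. schroedinger_op_complex \<Omega> W u (\<lambda>x. f x + \<mu> * u x))) \<and>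
     (\<exists>C. \<forall>u g. schroedinger_op_complex \<Omega> W u g \<longrightarrow>
        Ltwo_norm \<Omega> u \<le> C * Ltwo_norm \<Omega> (\<lambda>x. g x - \<mu> * u x))}"

definition schroedinger_spectrum ::
    "'a::euclidean_space set \<Rightarrow> ('a \<Rightarrow> real) \<Rightarrow> complex set" where
  "schroedinger_spectrum \<Omega> W = - schroedinger_resolvent_set \<Omega> W"


section \<open>The assumptions and the boundary value problem\<close>

definition cond_A1 ::
    "'a::euclidean_space set \<Rightarrow> ('a \<Rightarrow> real) \<Rightarrow> (nat \<Rightarrow> 'a \<Rightarrow> real) \<Rightarrow> bool" where
  "cond_A1 \<Omega> V K \<longleftrightarrow>
     Linf \<Omega> V \<and> (AE x in lebesgue_on \<Omega>. V x \<ge> 0) \<and>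
     schroedinger_spectrum \<Omega> V \<subseteq> complex_of_real ` {0<..} \<and>
     (\<forall>n. Linf \<Omega> (K n)) \<and>
     (\<exists>B::real. \<forall>n. Linf_norm \<Omega> (K n) \<le> ereal B) \<and>
     (\<forall>\<epsilon>>0. \<exists>N. \<forall>n\<ge>N. ess_support \<Omega> (K n) \<subseteq> ball 0 \<epsilon>)"

definition cond_A2 ::
    "'a::euclidean_space set \<Rightarrow> (nat \<Rightarrow> 'a \<Rightarrow> real) \<Rightarrow> bool" where
  "cond_A2 \<Omega> Q \<longleftrightarrow>
     (\<forall>n. Linf \<Omega> (Q n)) \<and>
     (\<forall>n. emeasure (lebesgue_on \<Omega>) {x \<in> \<Omega>. Q n x > 0} > 0) \<and>
     (\<exists>C::real. \<forall>n. Linf_norm \<Omega> (Q n) \<le> ereal C) \<and>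
     (\<forall>\<epsilon>>0. \<exists>\<delta>>0. \<exists>N. \<forall>n\<ge>N. AE x in lebesgue_on \<Omega>. x \<notin> ball 0 \<epsilon> \<longrightarrow> Q n x \<le> - \<delta>)"

text \<open>The integral of \<open>|\<nabla>u|\<^sup>2 + W u\<^sup>2\<close> over \<open>S \<subseteq> \<Omega>\<close>; the weak gradient is taken in \<open>\<Omega>\<close>.\<close>

definition energy ::
    "'a::euclidean_space set \<Rightarrow> ('a \<Rightarrow> real) \<Rightarrow> 'a set \<Rightarrow> ('a \<Rightarrow> real) \<Rightarrow> real" where
  "energy \<Omega> W S u = (\<integral>x. (norm (wgrad \<Omega> u x))\<^sup>2 + W x * (u x)\<^sup>2 \<partial>lebesgue_on S)"

definition energy_norm ::
    "'a::euclidean_space set \<Rightarrow> ('a \<Rightarrow> real) \<Rightarrow> ('a \<Rightarrow> real) \<Rightarrow> real" where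
  "energy_norm \<Omega> W u = sqrt (energy \<Omega> W \<Omega> u)"

definition weak_solution ::
    "'a::euclidean_space set \<Rightarrow> real \<Rightarrow> ('a \<Rightarrow> real) \<Rightarrow> ('a \<Rightarrow> real) \<Rightarrow> ('a \<Rightarrow> real) \<Rightarrow> bool" where
  "weak_solution \<Omega> p W q u \<longleftrightarrow> u \<in> H10 \<Omega> \<and>
     (\<forall>\<phi>\<in>H10 \<Omega>. schroedinger_form \<Omega> W u \<phi> =
        (\<integral>x. q x * \<bar>u x\<bar> powr (p - 2) * u x * \<phi> x \<partial>lebesgue_on \<Omega>))"

definition nontrivial_on :: "'a::euclidean_space set \<Rightarrow> ('a \<Rightarrow> real) \<Rightarrow> bool" where
  "nontrivial_on \<Omega> u \<longleftrightarrow> \<not> (AE x in lebesgue_on \<Omega>. u x = 0)"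

end

theory Submission
  imports Defs
begin

text \<open>
  Write \<open>E\<^sub>n\<close> for the energy \<open>\<integral>\<^bsub>\<Omega>\<^esub> |\<nabla>u\<^sub>n|\<^sup>2 + V\<^sub>n u\<^sub>n\<^sup>2\<close>. Two facts give the theorem: \<open>E\<^sub>n\<close> tends to
  infinity, and outside any ball \<open>B\<^sub>\<epsilon>\<close> both the energy and the \<open>p\<close>-th power integral of \<open>u\<^sub>n\<close>
  are \<open>o(E\<^sub>n)\<close>. The first two limits are this statement divided by \<open>E\<^sub>n\<close>, the third is the first
  one again, and the fourth follows because \<open>E\<^sub>n = \<integral> Q\<^sub>n |u\<^sub>n|\<^sup>p \<le> D \<integral> |u\<^sub>n|\<^sup>p\<close>.

  The energies blow up because \<open>Q\<^sub>n\<close> is negative off a ball \<open>B\<^sub>r\<close> that may be taken as small as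
  desired: \<open>E\<^sub>n \<le> D \<integral>\<^bsub>B r\<^esub> |u\<^sub>n|\<^sup>p\<close>. By the subcritical Sobolev embedding, localised to a small
  ball (\<open>H10_powr_small_ball\<close>), the right-hand side is at most \<open>\<eta>(r) E\<^sub>n powr (p / 2)\<close> with
  \<open>\<eta>(r) \<rightarrow> 0\<close>. As \<open>p > 2\<close>, a bounded energy would contradict this for small \<open>r\<close>.

  The exterior is controlled by testing the equation with \<open>\<zeta> u\<^sub>n\<close>, where \<open>\<zeta>\<close> is a smooth cutoff that
  vanishes near the origin and is 1 off \<open>B\<^sub>\<epsilon>\<close>. Where \<open>\<zeta>\<close> is not 0, \<open>V\<^sub>n = V \<ge> 0\<close> and \<open>Q\<^sub>n \<le> - \<delta>\<close>, so the exterior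
  energy plus \<open>\<delta>\<close> times the exterior \<open>p\<close>-integral is at most \<open>|\<integral> u\<^sub>n \<nabla>u\<^sub>n \<bullet> \<nabla>\<zeta>|\<close>, an integral
  over an annulus \<open>A\<close> (\<open>exterior_energy_estimate\<close>). Used crudely, this bounds the exterior
  \<open>p\<close>-integral by a multiple of \<open>E\<^sub>n\<close>, for every radius. Used a second time it gives \<open>o(E\<^sub>n)\<close>: on \<open>A\<close>,
  \<open>u\<^sup>2 \<le> l\<^sup>2 + l powr (2 - p) * |u| powr p\<close> for every level \<open>l\<close>, so \<open>\<integral>\<^bsub>A\<^esub> u\<^sub>n\<^sup>2\<close> is at most \<open>l\<^sup>2 |A|\<close>
  plus an arbitrarily small multiple of \<open>E\<^sub>n\<close>, and \<open>E\<^sub>n \<rightarrow> \<infinity>\<close> absorbs the first term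
  (\<open>annulus_square_le_powr\<close>).

  All this requires that the energy norm controls the \<open>H\<^sup>1\<close> norm. For \<open>-\<Delta> + V\<close> this is read off
  from the boundedness of its inverse (\<open>schroedinger_coercive\<close>); the perturbation \<open>K\<^sub>n\<close> lives in a
  small ball, where it is absorbed by the same Sobolev embedding with exponent 2
  (\<open>perturbed_coercive\<close>).

  The embedding itself is proved for functions on the whole space from \<open>\<parallel>U\<parallel> \<le> 1\<close> and
  \<open>\<parallel>U(\<sqdot> + z) - U\<parallel> \<le> |z|\<close> in \<open>L\<^sup>2\<close>, which passes from test functions to \<open>H\<^sub>0\<^sup>1\<close> by density. It yields
  a recursion for the measures of the superlevel sets of \<open>U\<close> that forces them to decay like a power
  above every subcritical exponent (\<open>superlevel_measure_step\<close>, \<open>superlevel_measure_decay\<close>).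
\<close>

section \<open>Superlevel sets under a translation bound\<close>

text \<open>
  If \<open>|U x| > 2 l\<close> and \<open>|U (x + z)| \<le> l\<close>, then \<open>U\<close> changes by at least \<open>l\<close> between \<open>x\<close> and \<open>x + z\<close>.
  The ball is at least twice as large as the superlevel set at height \<open>l\<close>, so for every such \<open>x\<close> at least half
  of all \<open>z\<close> in the ball have this property. Integrating over \<open>x\<close> and \<open>z\<close> and exchanging the
  integrals compares the size of the set at height \<open>2 l\<close> with the translation bound.
\<close>

lemma superlevel_measure_step:
  fixes U :: "'a::euclidean_space \<Rightarrow> real"
  assumes U[measurable]: "U \<in> borel_measurable borel"
    and transl: "\<And>z. (\<integral>\<^sup>+x. ennreal ((U (x + z) - U x)\<^sup>2) \<partial>lborel) \<le> ennreal ((norm z)\<^sup>2)"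
    and l: "0 < l" and t: "0 < t"
    and fin: "emeasure lborel {x. l < \<bar>U x\<bar>} < \<infinity>"
    and small: "2 * measure lborel {x. l < \<bar>U x\<bar>} \<le> measure lborel (ball (0::'a) t)"
  shows "measure lborel {x. 2 * l < \<bar>U x\<bar>} * l\<^sup>2 \<le> 2 * t\<^sup>2"
proof -
  define F where "F = {x. l < \<bar>U x\<bar>}"
  define E where "E = {x. 2 * l < \<bar>U x\<bar>}"
  define b where "b = measure lborel (ball (0::'a) t)"
  have [measurable]: "F \<in> sets borel" "E \<in> sets borel" unfolding F_def E_def by measurable
  have [measurable]: "ball (0::'a) t \<in> sets borel" by simp
  have b: "emeasure lborel (ball (0::'a) t) = ennreal b"
    unfolding b_def using emeasure_lborel_ball_finite[of "0::'a" t]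
    by (intro emeasure_eq_ennreal_measure) auto
  have bpos: "0 < b"
    unfolding b_def using content_ball_pos[OF t, of "0::'a"] by simp
  have "E \<subseteq> F" unfolding E_def F_def using l by auto
  then have Efin: "emeasure lborel E < \<infinity>"
    using fin emeasure_mono[of E F lborel] unfolding F_def[symmetric] by (auto intro: le_less_trans)
  have Eeq: "emeasure lborel E = ennreal (measure lborel E)"
    using Efin by (simp add: emeasure_eq_ennreal_measure)
  have inner: "ennreal (l\<^sup>2 * (b / 2)) * indicator E x \<le>
      (\<integral>\<^sup>+z. indicator (ball 0 t) z * ennreal ((U (x + z) - U x)\<^sup>2) \<partial>lborel)" for x
  proof (cases "x \<in> E")
    case True
    define G where "G = {z. l < \<bar>U (x + z)\<bar>}"
    have [measurable]: "G \<in> sets borel" unfolding G_def by measurable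
    have "emeasure lborel F = emeasure (distr lborel borel ((+) x)) F"
      by (simp add: lborel_distr_plus)
    also have "\<dots> = emeasure lborel G"
      by (subst emeasure_distr) (auto simp: F_def G_def vimage_def)
    finally have FG: "emeasure lborel G = emeasure lborel F" by simp
    then have mFG: "measure lborel G = measure lborel F" by (simp add: measure_def)
    have "ennreal (b / 2) \<le> ennreal (b - measure lborel G)"
      using small mFG unfolding F_def[symmetric] b_def[symmetric] by (intro ennreal_leI) simp
    also have "\<dots> = emeasure lborel (ball (0::'a) t) - emeasure lborel G"
      using FG fin by (simp add: b ennreal_minus emeasure_eq_ennreal_measure F_def[symmetric] mFG)
    also have "\<dots> \<le> emeasure lborel (ball 0 t - G)"
    proof -
      have "emeasure lborel (ball (0::'a) t) \<le> emeasure lborel ((ball 0 t - G) \<union> G)"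
        by (intro emeasure_mono) auto
      also have "\<dots> \<le> emeasure lborel (ball 0 t - G) + emeasure lborel G"
        by (intro emeasure_subadditive) auto
      finally show ?thesis
        by (metis add.commute ennreal_minus_le_iff infinity_ennreal_def F_def FG fin order_less_irrefl)
    qed
    finally have "ennreal (l\<^sup>2) * ennreal (b / 2) \<le> ennreal (l\<^sup>2) * emeasure lborel (ball 0 t - G)"
      by (intro mult_left_mono) auto
    also have "\<dots> = (\<integral>\<^sup>+z. ennreal (l\<^sup>2) * indicator (ball 0 t - G) z \<partial>lborel)"
      by (subst nn_integral_cmult_indicator) auto
    also have "\<dots> \<le> (\<integral>\<^sup>+z. indicator (ball 0 t) z * ennreal ((U (x + z) - U x)\<^sup>2) \<partial>lborel)"
    proof (intro nn_integral_mono)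
      fix z :: 'a
      have "l\<^sup>2 \<le> (U (x + z) - U x)\<^sup>2" if "z \<notin> G"
        using that True l unfolding G_def E_def by (intro abs_le_square_iff[THEN iffD1]) auto
      then show "ennreal (l\<^sup>2) * indicator (ball 0 t - G) z \<le> indicator (ball 0 t) z * ennreal ((U (x + z) - U x)\<^sup>2)"
        by (auto simp: indicator_def intro!: ennreal_leI)
    qed
    finally show ?thesis using True bpos by (simp flip: ennreal_mult')
  qed simp
  have "ennreal (l\<^sup>2 * (b / 2) * measure lborel E) = (\<integral>\<^sup>+x. ennreal (l\<^sup>2 * (b / 2)) * indicator E x \<partial>lborel)"
    using bpos by (subst nn_integral_cmult_indicator) (auto simp: Eeq ennreal_mult[symmetric] mult_ac)
  also have "\<dots> \<le> (\<integral>\<^sup>+x. (\<integral>\<^sup>+z. indicator (ball 0 t) z * ennreal ((U (x + z) - U x)\<^sup>2) \<partial>lborel) \<partial>lborel)"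
    by (intro nn_integral_mono inner)
  also have "\<dots> = (\<integral>\<^sup>+z. (\<integral>\<^sup>+x. indicator (ball 0 t) z * ennreal ((U (x + z) - U x)\<^sup>2) \<partial>lborel) \<partial>lborel)"
    by (intro lborel_pair.Fubini') measurable
  also have "\<dots> = (\<integral>\<^sup>+z. indicator (ball 0 t) z * (\<integral>\<^sup>+x. ennreal ((U (x + z) - U x)\<^sup>2) \<partial>lborel) \<partial>lborel)"
    by (intro nn_integral_cong nn_integral_cmult) measurable
  also have "\<dots> \<le> (\<integral>\<^sup>+z. ennreal (t\<^sup>2) * indicator (ball (0::'a) t) z \<partial>lborel)"
  proof (intro nn_integral_mono)
    fix z :: 'a
    show "indicator (ball 0 t) z * (\<integral>\<^sup>+x. ennreal ((U (x + z) - U x)\<^sup>2) \<partial>lborel) \<le> ennreal (t\<^sup>2) * indicator (ball 0 t) z"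
      using transl[of z] by (auto simp: indicator_def intro!: order_trans[OF transl[of z]] ennreal_leI power_mono)
  qed
  also have "\<dots> = ennreal (t\<^sup>2 * b)"
    using bpos by (subst nn_integral_cmult_indicator) (auto simp: b ennreal_mult')
  finally have "l\<^sup>2 * (b / 2) * measure lborel E \<le> t\<^sup>2 * b"
    using bpos by (subst (asm) ennreal_le_iff) auto
  then show ?thesis using bpos unfolding E_def[symmetric]
    by (simp add: field_simps)
qed

text \<open>
  The exponent \<open>s = 2 / (1 - \<alpha>)\<close> is the fixed point of \<open>s = 2 + \<alpha> s\<close>, hence the rate \<open>2 powr (- s k)\<close>
  reproduces itself under the recursion; \<open>D\<close> only has to be large enough for the constants, which is
  possible since \<open>\<alpha> < 1\<close>.
\<close>

lemma geometric_decay_of_recursion: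
  fixes a :: "nat \<Rightarrow> real"
  assumes "0 \<le> A" "0 < \<alpha>" "\<alpha> < 1"
  obtains D where "0 < D"
    "\<And>a k. a 0 \<le> 1 \<Longrightarrow> (\<And>k. 0 \<le> a k) \<Longrightarrow> (\<And>k. a (Suc k) \<le> A / 4 ^ k * a k powr \<alpha>) \<Longrightarrow>
       a k \<le> D * 2 powr (- (2 / (1 - \<alpha>)) * real k)"
proof -
  define s where "s = 2 / (1 - \<alpha>)"
  \<comment> \<open>Large enough that \<open>A * 2 powr s * D powr \<alpha> \<le> D\<close>.\<close>
  define D where "D = max 1 ((A * 2 powr s) powr (1 / (1 - \<alpha>)))"
  have D: "1 \<le> D" unfolding D_def by simp
  have "(A * 2 powr s) = ((A * 2 powr s) powr (1 / (1 - \<alpha>))) powr (1 - \<alpha>)"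
    using assms by (simp add: powr_powr)
  also have "\<dots> \<le> D powr (1 - \<alpha>)" unfolding D_def using assms by (intro powr_mono2) auto
  finally have DA: "A * 2 powr s * D powr \<alpha> \<le> D powr (1 - \<alpha>) * D powr \<alpha>"
    by (intro mult_right_mono) auto
  then have DA: "A * 2 powr s * D powr \<alpha> \<le> D" using D by (simp add: powr_add[symmetric])
  have s: "2 + \<alpha> * s = s" unfolding s_def using assms by (simp add: field_simps)
  have "a k \<le> D * 2 powr (- s * real k)"
    if a: "a 0 \<le> 1" "\<And>k. 0 \<le> a k" "\<And>k. a (Suc k) \<le> A / 4 ^ k * a k powr \<alpha>" for a k
  proof (induction k)
    case 0 then show ?case using a D by simp
  next
    case (Suc k)
    have "a (Suc k) \<le> A / 4 ^ k * a k powr \<alpha>" by fact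
    also have "\<dots> \<le> A / 4 ^ k * (D * 2 powr (- s * real k)) powr \<alpha>"
      using Suc a assms by (intro mult_left_mono powr_mono2) auto
    also have "\<dots> = A * D powr \<alpha> * (2 powr (- 2 * real k) * 2 powr (- s * real k * \<alpha>))"
    proof -
      have "A / 4 ^ k = A * 2 powr (- 2 * real k)"
        by (simp add: powr_minus powr_powr[symmetric] powr_realpow divide_inverse)
      moreover have "(2 powr (- s * real k)) powr \<alpha> = (2::real) powr (- s * real k * \<alpha>)"
        by (rule powr_powr)
      ultimately show ?thesis using D
        by (simp only: powr_mult mult_ac)
    qed
    also have "2 powr (- 2 * real k) * 2 powr (- s * real k * \<alpha>) = (2::real) powr (- (2 + \<alpha> * s) * real k)"
      by (simp add: powr_add[symmetric] algebra_simps)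
    also have "\<dots> = 2 powr (- s * real k)" by (simp only: s)
    also have "\<dots> = 2 powr s * 2 powr (- s * real (Suc k))"
      by (simp add: powr_add[symmetric] algebra_simps)
    also have "A * D powr \<alpha> * (2 powr s * 2 powr (- s * real (Suc k))) = (A * 2 powr s * D powr \<alpha>) * 2 powr (- s * real (Suc k))"
      by simp
    also have "\<dots> \<le> D * 2 powr (- s * real (Suc k))" by (intro mult_right_mono DA) auto
    finally show ?case .
  qed
  then show ?thesis using that[of D] D unfolding s_def by force
qed

text \<open>
  The unit ball of the space \<open>H\<^sup>1\<close> on the whole space, up to a factor, described without derivatives.
\<close>

definition unit_translation_bound :: "('a::euclidean_space \<Rightarrow> real) \<Rightarrow> bool" where
  "unit_translation_bound U \<longleftrightarrow> U \<in> borel_measurable borel \<and>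
     (\<integral>\<^sup>+x. ennreal ((U x)\<^sup>2) \<partial>lborel) \<le> 1 \<and>
     (\<forall>z. (\<integral>\<^sup>+x. ennreal ((U (x + z) - U x)\<^sup>2) \<partial>lborel) \<le> ennreal ((norm z)\<^sup>2))"

text \<open>
  With a ball of volume \<open>2 a\<^sub>k\<close>, where \<open>a\<^sub>k\<close> is the measure of the superlevel set at height \<open>2 ^ k\<close>,
  the preceding step becomes \<open>a\<^bsub>k+1\<^esub> \<le> A / 4 ^ k * a\<^sub>k powr (2 / N)\<close>. Since \<open>a\<^sub>k \<le> 1\<close>, the exponent may be
  lowered to an \<open>\<alpha> < 1\<close>, which treats all dimensions alike.
\<close>

lemma superlevel_measure_decay:
  assumes \<alpha>: "0 < \<alpha>" "\<alpha> < 1" "\<alpha> \<le> 2 / real DIM('a::euclidean_space)"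
  obtains D where "0 < D"
    "\<And>U k. unit_translation_bound (U :: 'a \<Rightarrow> real) \<Longrightarrow>
       emeasure lborel {x. 2 ^ k < \<bar>U x\<bar>} \<le> ennreal (D * 2 powr (- (2 / (1 - \<alpha>)) * real k))"
proof -
  define N where "N = real DIM('a)"
  define \<omega> where "\<omega> = unit_ball_vol N"
  define A where "A = 2 * (2 / \<omega>) powr (2 / N)"
  have N: "0 < N" unfolding N_def by simp
  have \<omega>: "0 < \<omega>" unfolding \<omega>_def N_def by simp
  have A: "0 \<le> A" unfolding A_def by simp
  obtain D where D: "0 < D"
    "\<And>a k. a 0 \<le> 1 \<Longrightarrow> (\<And>k. 0 \<le> a k) \<Longrightarrow> (\<And>k. a (Suc k) \<le> A / 4 ^ k * a k powr \<alpha>) \<Longrightarrow>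
       a k \<le> D * 2 powr (- (2 / (1 - \<alpha>)) * real k)"
    using geometric_decay_of_recursion[OF A \<alpha>(1,2)] by metis
  have "emeasure lborel {x. 2 ^ k < \<bar>U x\<bar>} \<le> ennreal (D * 2 powr (- (2 / (1 - \<alpha>)) * real k))"
    if U: "unit_translation_bound (U :: 'a \<Rightarrow> real)" for U k
  proof -
    have [measurable]: "U \<in> borel_measurable borel" using U unfolding unit_translation_bound_def by simp
    define a where "a k = measure lborel {x. 2 ^ k < \<bar>U x\<bar>}" for k
    have F1: "emeasure lborel {x. 2 ^ k < \<bar>U x\<bar>} \<le> 1" for k :: nat
    proof -
      have "emeasure lborel {x. 2 ^ k < \<bar>U x\<bar>} = (\<integral>\<^sup>+x. indicator {x. 2 ^ k < \<bar>U x\<bar>} x \<partial>lborel)"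
        by simp
      also have "\<dots> \<le> (\<integral>\<^sup>+x. ennreal ((U x)\<^sup>2) \<partial>lborel)"
      proof (intro nn_integral_mono)
        fix x
        have "1 \<le> (U x)\<^sup>2" if "2 ^ k < \<bar>U x\<bar>"
        proof -
          have "1 \<le> (2::real) ^ k" by simp
          then have "1 \<le> \<bar>U x\<bar>" using that by linarith
          then show ?thesis using abs_le_square_iff[of 1 "U x"] by simp
        qed
        then show "indicator {x. 2 ^ k < \<bar>U x\<bar>} x \<le> ennreal ((U x)\<^sup>2)"
          by (auto simp: indicator_def ennreal_1[symmetric] simp del: ennreal_1 intro!: ennreal_leI)
      qed
      also have "\<dots> \<le> 1" using U unfolding unit_translation_bound_def by simp
      finally show ?thesis .
    qed
    have Fa: "emeasure lborel {x. 2 ^ k < \<bar>U x\<bar>} = ennreal (a k)" for k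
      unfolding a_def using F1[of k] by (intro emeasure_eq_ennreal_measure) (auto simp: top_unique)
    have a1: "a k \<le> 1" for k using F1[of k] unfolding Fa
      by (metis ennreal_le_1)
    have a0: "0 \<le> a k" for k unfolding a_def by simp
    have step: "a (Suc k) \<le> A / 4 ^ k * a k powr \<alpha>" for k
    proof (cases "a k = 0")
      case True
      have "{x. 2 ^ Suc k < \<bar>U x\<bar>} \<subseteq> {x. 2 ^ k < \<bar>U x\<bar>}"
      proof clarify
        fix x assume "2 ^ Suc k < \<bar>U x\<bar>"
        moreover have "(0::real) < 2 ^ k" by simp
        ultimately show "2 ^ k < \<bar>U x\<bar>" unfolding power_Suc by linarith
      qed
      then have "emeasure lborel {x. 2 ^ Suc k < \<bar>U x\<bar>} \<le> emeasure lborel {x. 2 ^ k < \<bar>U x\<bar>}"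
        by (intro emeasure_mono) auto
      then have "a (Suc k) \<le> a k" unfolding Fa by (simp add: a0)
      then show ?thesis using True A a0[of k] by simp
    next
      case False
      then have apos: "0 < a k" using a0[of k] by simp
      \<comment> \<open>The radius for which the ball has exactly twice the measure of the superlevel set.\<close>
      define t where "t = (2 * a k / \<omega>) powr (1 / N)"
      have t: "0 < t" unfolding t_def using apos \<omega> by simp
      have "measure lborel (ball (0::'a) t) = \<omega> * t ^ DIM('a)"
        unfolding \<omega>_def N_def using t by (subst content_ball) auto
      also have "t ^ DIM('a) = t powr N" unfolding N_def using t by (simp add: powr_realpow)
      also have "\<dots> = 2 * a k / \<omega>" unfolding t_def using N apos \<omega> by (simp add: powr_powr)
      finally have ball: "measure lborel (ball (0::'a) t) = 2 * a k" using \<omega> by simp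
      have "measure lborel {x. 2 * 2 ^ k < \<bar>U x\<bar>} * (2 ^ k)\<^sup>2 \<le> 2 * t\<^sup>2"
        using U t ball F1[of k] unfolding unit_translation_bound_def
        by (intro superlevel_measure_step) (auto simp: a_def Fa)
      then have "a (Suc k) * 4 ^ k \<le> 2 * t\<^sup>2"
        unfolding a_def power2_eq_square by (simp flip: power_mult_distrib)
      also have "t\<^sup>2 = (2 * a k / \<omega>) powr (2 / N)"
        unfolding t_def using apos \<omega> by (simp add: powr_power)
      also have "\<dots> = (2 / \<omega>) powr (2 / N) * a k powr (2 / N)"
        using apos \<omega> powr_mult[of "2 / \<omega>" "a k" "2 / N"] by simp
      also have "2 * ((2 / \<omega>) powr (2 / N) * a k powr (2 / N)) = A * a k powr (2 / N)"
        unfolding A_def by simp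
      also have "\<dots> \<le> A * a k powr \<alpha>"
        using \<alpha> a1 a0 A apos unfolding N_def by (intro mult_left_mono powr_mono') auto
      finally show ?thesis by (simp add: field_simps)
    qed
    show ?thesis unfolding Fa using D(2)[of a k, OF a1 a0 step] by (intro ennreal_leI)
  qed
  with D(1) show ?thesis by (rule that)
qed

text \<open>
  The condition on \<open>r\<close> leaves room for an \<open>\<alpha>\<close> such that the superlevel sets decay with an exponent
  \<open>s > r\<close>. Summing over the dyadic levels above \<open>2 ^ m\<close> then gives a geometric series of ratio
  \<open>2 powr (r - s)\<close>.
\<close>

lemma unit_translation_bound_tail:
  assumes r: "2 \<le> r" "1 - 2 / r < 2 / real DIM('a::euclidean_space)" and \<eta>: "0 < (\<eta>::real)"
  shows "\<exists>m::nat. \<forall>U. unit_translation_bound (U :: 'a \<Rightarrow> real) \<longrightarrow>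
      (\<integral>\<^sup>+x. ennreal (\<bar>U x\<bar> powr r) * indicator {x. 2 ^ m < \<bar>U x\<bar>} x \<partial>lborel) \<le> ennreal \<eta>"
    and "\<exists>C. \<forall>U. unit_translation_bound (U :: 'a \<Rightarrow> real) \<longrightarrow>
      (\<integral>\<^sup>+x. ennreal (\<bar>U x\<bar> powr r) * indicator {x. 1 < \<bar>U x\<bar>} x \<partial>lborel) \<le> ennreal C"
proof -
  have "max 0 (1 - 2 / r) < min 1 (2 / real DIM('a))" using r by auto
  then obtain \<alpha> where "max 0 (1 - 2 / r) < \<alpha>" "\<alpha> < min 1 (2 / real DIM('a))" using dense by blast
  then have \<alpha>: "0 < \<alpha>" "\<alpha> < 1" "\<alpha> \<le> 2 / real DIM('a)" "1 - 2 / r < \<alpha>" by auto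
  define s where "s = 2 / (1 - \<alpha>)"
  have s: "r < s" unfolding s_def using \<alpha> r by (simp add: field_simps)
  define q where "q = 2 powr (r - s)"
  have q: "0 < q" "q < 1" unfolding q_def using s by (auto simp: powr_less_one)
  obtain D where D: "0 < D" "\<And>U k. unit_translation_bound (U :: 'a \<Rightarrow> real) \<Longrightarrow>
       emeasure lborel {x. 2 ^ k < \<bar>U x\<bar>} \<le> ennreal (D * 2 powr (- s * real k))"
    using superlevel_measure_decay[OF \<alpha>(1-3)] unfolding s_def by metis
  have main: "(\<integral>\<^sup>+x. ennreal (\<bar>U x\<bar> powr r) * indicator {x. 2 ^ m < \<bar>U x\<bar>} x \<partial>lborel)
      \<le> ennreal (D * 2 powr r / (1 - q) * q ^ m)"
    if U: "unit_translation_bound (U :: 'a \<Rightarrow> real)" for U m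
  proof -
    have [measurable]: "U \<in> borel_measurable borel" using U unfolding unit_translation_bound_def by simp
    have single_le: "h k \<le> suminf h" for h :: "nat \<Rightarrow> ennreal" and k
      using sum_le_suminf[of h "{k}"] by simp
    let ?g = "\<lambda>k x. ennreal (2 powr (real (Suc k + m) * r)) * indicator {x. 2 ^ (k + m) < \<bar>U x\<bar>} x"
    have "ennreal (\<bar>U x\<bar> powr r) * indicator {x. 2 ^ m < \<bar>U x\<bar>} x \<le> (\<Sum>k. ?g k x)" for x
    proof (cases "2 ^ m < \<bar>U x\<bar>")
      case True
      obtain j where j: "\<bar>U x\<bar> < 2 ^ j" using real_arch_pow[of 2] by auto
      define i where "i = (LEAST j. \<bar>U x\<bar> \<le> 2 ^ j)"
      have i: "\<bar>U x\<bar> \<le> 2 ^ i" unfolding i_def using j by (metis (mono_tags, lifting) LeastI less_imp_le)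
      have im: "m < i"
      proof (rule ccontr)
        assume "\<not> m < i"
        then have "(2::real) ^ i \<le> 2 ^ m" by (intro power_increasing) auto
        with i True show False by linarith
      qed
      define k where "k = i - Suc m"
      have ik: "i = Suc k + m" unfolding k_def using im by simp
      have "\<not> \<bar>U x\<bar> \<le> 2 ^ (k + m)" using not_less_Least[of "k + m" "\<lambda>j. \<bar>U x\<bar> \<le> 2 ^ j"]
        unfolding i_def[symmetric] ik by simp
      then have mem: "x \<in> {x. 2 ^ (k + m) < \<bar>U x\<bar>}" by simp
      have "\<bar>U x\<bar> powr r \<le> (2 ^ i) powr r" using i r by (intro powr_mono2) auto
      also have "\<dots> = 2 powr (real (Suc k + m) * r)"
        unfolding ik by (simp only: powr_powr[symmetric] powr_realpow zero_less_numeral)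
      finally have "ennreal (\<bar>U x\<bar> powr r) * indicator {x. 2 ^ m < \<bar>U x\<bar>} x \<le> ?g k x"
        using mem True by (simp add: ennreal_leI)
      also have "\<dots> \<le> (\<Sum>k. ?g k x)"
        by (rule single_le)
      finally show ?thesis .
    qed simp
    then have "(\<integral>\<^sup>+x. ennreal (\<bar>U x\<bar> powr r) * indicator {x. 2 ^ m < \<bar>U x\<bar>} x \<partial>lborel)
        \<le> (\<integral>\<^sup>+x. (\<Sum>k. ?g k x) \<partial>lborel)" by (intro nn_integral_mono)
    also have "\<dots> = (\<Sum>k. \<integral>\<^sup>+x. ?g k x \<partial>lborel)" by (intro nn_integral_suminf) measurable
    also have "\<dots> \<le> (\<Sum>k. ennreal (D * 2 powr r * q ^ m * q ^ k))"
    proof (intro suminf_le allI)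
      fix k
      have "(\<integral>\<^sup>+x. ?g k x \<partial>lborel) = ennreal (2 powr (real (Suc k + m) * r)) * emeasure lborel {x. 2 ^ (k + m) < \<bar>U x\<bar>}"
        by (subst nn_integral_cmult_indicator) auto
      also have "\<dots> \<le> ennreal (2 powr (real (Suc k + m) * r)) * ennreal (D * 2 powr (- s * real (k + m)))"
        by (intro mult_left_mono D U) auto
      also have "\<dots> = ennreal (2 powr (real (Suc k + m) * r) * (D * 2 powr (- s * real (k + m))))"
        by (intro ennreal_mult'[symmetric]) auto
      also have "2 powr (real (Suc k + m) * r) * (D * 2 powr (- s * real (k + m))) =
          D * 2 powr (real (Suc k + m) * r + (- s * real (k + m)))"
        by (simp only: powr_add mult_ac)
      also have "real (Suc k + m) * r + (- s * real (k + m)) = r + (r - s) * real m + (r - s) * real k"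
        by (simp add: algebra_simps)
      also have "D * 2 powr (r + (r - s) * real m + (r - s) * real k) = D * 2 powr r * q ^ m * q ^ k"
        unfolding q_def by (simp add: powr_add powr_powr[symmetric] powr_realpow)
      finally show "(\<integral>\<^sup>+x. ?g k x \<partial>lborel) \<le> ennreal (D * 2 powr r * q ^ m * q ^ k)" .
    qed auto
    also have "\<dots> = ennreal (\<Sum>k. D * 2 powr r * q ^ m * q ^ k)"
      using D q by (intro suminf_ennreal2 summable_mult summable_geometric) auto
    also have "(\<Sum>k. D * 2 powr r * q ^ m * q ^ k) = D * 2 powr r * q ^ m * (1 / (1 - q))"
      using q by (subst suminf_mult) (auto simp: suminf_geometric intro: summable_geometric)
    finally show ?thesis by (simp add: field_simps)
  qed
  have "(\<lambda>m. D * 2 powr r / (1 - q) * q ^ m) \<longlonglongrightarrow> D * 2 powr r / (1 - q) * 0"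
    using q by (intro tendsto_intros LIMSEQ_realpow_zero) auto
  then have "\<forall>\<^sub>F m in sequentially. D * 2 powr r / (1 - q) * q ^ m < \<eta>"
    using \<eta> by (intro order_tendstoD) auto
  then obtain m where "D * 2 powr r / (1 - q) * q ^ m < \<eta>" by (auto simp: eventually_sequentially)
  then show "\<exists>m::nat. \<forall>U. unit_translation_bound (U :: 'a \<Rightarrow> real) \<longrightarrow>
      (\<integral>\<^sup>+x. ennreal (\<bar>U x\<bar> powr r) * indicator {x. 2 ^ m < \<bar>U x\<bar>} x \<partial>lborel) \<le> ennreal \<eta>"
    using main by (intro exI[of _ m]) (meson ennreal_leI less_imp_le order_trans)
  show "\<exists>C. \<forall>U. unit_translation_bound (U :: 'a \<Rightarrow> real) \<longrightarrow>
      (\<integral>\<^sup>+x. ennreal (\<bar>U x\<bar> powr r) * indicator {x. 1 < \<bar>U x\<bar>} x \<partial>lborel) \<le> ennreal C"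
    using main[where m=0] by (intro exI[of _ "D * 2 powr r / (1 - q)"]) simp
qed

lemma unit_translation_bound_powr_bounded:
  assumes r: "2 \<le> r" "1 - 2 / r < 2 / real DIM('a::euclidean_space)"
  shows "\<exists>C. \<forall>U. unit_translation_bound (U :: 'a \<Rightarrow> real) \<longrightarrow>
      (\<integral>\<^sup>+x. ennreal (\<bar>U x\<bar> powr r) \<partial>lborel) \<le> ennreal C"
proof -
  obtain C where C: "\<And>U. unit_translation_bound (U :: 'a \<Rightarrow> real) \<Longrightarrow>
      (\<integral>\<^sup>+x. ennreal (\<bar>U x\<bar> powr r) * indicator {x. 1 < \<bar>U x\<bar>} x \<partial>lborel) \<le> ennreal C"
    using unit_translation_bound_tail(2)[OF r, of 1] by auto
  have "(\<integral>\<^sup>+x. ennreal (\<bar>U x\<bar> powr r) \<partial>lborel) \<le> ennreal (1 + max 0 C)"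
    if U: "unit_translation_bound (U :: 'a \<Rightarrow> real)" for U
  proof -
    have [measurable]: "U \<in> borel_measurable borel" using U unfolding unit_translation_bound_def by simp
    have "(\<integral>\<^sup>+x. ennreal (\<bar>U x\<bar> powr r) \<partial>lborel) \<le>
        (\<integral>\<^sup>+x. ennreal ((U x)\<^sup>2) + ennreal (\<bar>U x\<bar> powr r) * indicator {x. 1 < \<bar>U x\<bar>} x \<partial>lborel)"
    proof (intro nn_integral_mono)
      fix x
      have "\<bar>U x\<bar> powr r \<le> (U x)\<^sup>2" if "\<bar>U x\<bar> \<le> 1"
        using powr_mono'[of 2 r "\<bar>U x\<bar>"] r that by simp
      then show "ennreal (\<bar>U x\<bar> powr r) \<le> ennreal ((U x)\<^sup>2) + ennreal (\<bar>U x\<bar> powr r) * indicator {x. 1 < \<bar>U x\<bar>} x"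
        by (auto simp: indicator_def intro: ennreal_leI)
    qed
    also have "\<dots> = (\<integral>\<^sup>+x. ennreal ((U x)\<^sup>2) \<partial>lborel) +
        (\<integral>\<^sup>+x. ennreal (\<bar>U x\<bar> powr r) * indicator {x. 1 < \<bar>U x\<bar>} x \<partial>lborel)"
      by (intro nn_integral_add) auto
    also have "\<dots> \<le> 1 + ennreal (max 0 C)"
      using U C[OF U] unfolding unit_translation_bound_def
      by (intro add_mono) (auto intro: order_trans ennreal_leI)
    finally show ?thesis by (simp add: ennreal_plus[symmetric] del: ennreal_plus flip: ennreal_1)
  qed
  then show ?thesis by blast
qed

text \<open>
  Large values contribute little by the tail bound, uniformly in \<open>U\<close>; values below \<open>2 ^ m\<close> contribute
  at most a constant times the volume of the ball.
\<close>

lemma unit_translation_bound_powr_small_ball: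
  assumes r: "2 \<le> r" "1 - 2 / r < 2 / real DIM('a::euclidean_space)" and \<eta>: "0 < (\<eta>::real)"
  shows "\<exists>\<epsilon>>0. \<forall>U. unit_translation_bound (U :: 'a \<Rightarrow> real) \<longrightarrow>
      (\<integral>\<^sup>+x. ennreal (\<bar>U x\<bar> powr r) * indicator (ball 0 \<epsilon>) x \<partial>lborel) \<le> ennreal \<eta>"
proof -
  obtain m where m: "\<And>U. unit_translation_bound (U :: 'a \<Rightarrow> real) \<Longrightarrow>
      (\<integral>\<^sup>+x. ennreal (\<bar>U x\<bar> powr r) * indicator {x. 2 ^ m < \<bar>U x\<bar>} x \<partial>lborel) \<le> ennreal (\<eta> / 2)"
    using unit_translation_bound_tail(1)[OF r, of "\<eta> / 2"] \<eta> by auto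
  define L where "L = (2 ^ m :: real) powr r"
  have L: "0 < L" unfolding L_def by simp
  have "((\<lambda>\<epsilon>. L * (unit_ball_vol (real DIM('a)) * \<epsilon> ^ DIM('a))) \<longlongrightarrow> L * (unit_ball_vol (real DIM('a)) * 0 ^ DIM('a))) (at_right 0)"
    by (intro tendsto_intros)
  then have "\<forall>\<^sub>F \<epsilon> in at_right 0. L * (unit_ball_vol (real DIM('a)) * \<epsilon> ^ DIM('a)) < \<eta> / 2"
    using \<eta> by (intro order_tendstoD) (auto simp: zero_power)
  moreover have "\<forall>\<^sub>F \<epsilon> in at_right (0::real). 0 < \<epsilon>" by (rule eventually_at_right_less)
  ultimately have "\<forall>\<^sub>F \<epsilon> in at_right 0. L * (unit_ball_vol (real DIM('a)) * \<epsilon> ^ DIM('a)) < \<eta> / 2 \<and> 0 < \<epsilon>"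
    by eventually_elim auto
  then obtain \<epsilon> where \<epsilon>: "L * (unit_ball_vol (real DIM('a)) * \<epsilon> ^ DIM('a)) < \<eta> / 2" "0 < \<epsilon>"
    using eventually_happens by fastforce
  have "(\<integral>\<^sup>+x. ennreal (\<bar>U x\<bar> powr r) * indicator (ball 0 \<epsilon>) x \<partial>lborel) \<le> ennreal \<eta>"
    if U: "unit_translation_bound (U :: 'a \<Rightarrow> real)" for U
  proof -
    have [measurable]: "U \<in> borel_measurable borel" using U unfolding unit_translation_bound_def by simp
    have [measurable]: "ball (0::'a) \<epsilon> \<in> sets borel" "{x. 2 ^ m < \<bar>U x\<bar>} \<in> sets borel"
      by simp measurable
    have "(\<integral>\<^sup>+x. ennreal (\<bar>U x\<bar> powr r) * indicator (ball 0 \<epsilon>) x \<partial>lborel) \<le>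
        (\<integral>\<^sup>+x. ennreal L * indicator (ball 0 \<epsilon>) x + ennreal (\<bar>U x\<bar> powr r) * indicator {x. 2 ^ m < \<bar>U x\<bar>} x \<partial>lborel)"
    proof (intro nn_integral_mono)
      fix x
      have "\<bar>U x\<bar> powr r \<le> L" if "\<bar>U x\<bar> \<le> 2 ^ m"
        unfolding L_def using r that by (intro powr_mono2) auto
      then show "ennreal (\<bar>U x\<bar> powr r) * indicator (ball 0 \<epsilon>) x
         \<le> ennreal L * indicator (ball 0 \<epsilon>) x + ennreal (\<bar>U x\<bar> powr r) * indicator {x. 2 ^ m < \<bar>U x\<bar>} x"
        by (auto simp: indicator_def intro: ennreal_leI)
    qed
    also have "\<dots> = (\<integral>\<^sup>+x. ennreal L * indicator (ball (0::'a) \<epsilon>) x \<partial>lborel) +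
        (\<integral>\<^sup>+x. ennreal (\<bar>U x\<bar> powr r) * indicator {x. 2 ^ m < \<bar>U x\<bar>} x \<partial>lborel)"
      by (rule nn_integral_add) measurable
    also have "(\<integral>\<^sup>+x. ennreal L * indicator (ball (0::'a) \<epsilon>) x \<partial>lborel) = ennreal (L * (unit_ball_vol (real DIM('a)) * \<epsilon> ^ DIM('a)))"
      using L \<epsilon> by (subst nn_integral_cmult_indicator) (auto simp: emeasure_ball ennreal_mult')
    also have "\<dots> + (\<integral>\<^sup>+x. ennreal (\<bar>U x\<bar> powr r) * indicator {x. 2 ^ m < \<bar>U x\<bar>} x \<partial>lborel) \<le> ennreal (\<eta> / 2) + ennreal (\<eta> / 2)"
      using \<epsilon> by (intro add_mono m U ennreal_leI) auto
    finally show ?thesis using \<eta> by (simp add: ennreal_plus[symmetric] del: ennreal_plus)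
  qed
  with \<epsilon> show ?thesis by blast
qed

text \<open>
  For \<open>N \<ge> 3\<close> this is \<open>r < 2 N / (N - 2)\<close> rearranged; for \<open>N \<le> 2\<close> the right-hand side is at least 1.
\<close>

lemma subcritical_exponent_condition:
  assumes "2 \<le> r" "ereal r < critical_exponent N" "0 < N"
  shows "1 - 2 / r < 2 / real N"
proof (cases "3 \<le> N")
  case True
  then have "r < 2 * real N / (real N - 2)" using assms unfolding critical_exponent_def by simp
  then show ?thesis using assms True by (simp add: field_simps)
next
  case False
  then have "N = 1 \<or> N = 2" using assms by auto
  then have "1 \<le> 2 / real N" by auto
  moreover have "0 < 2 / r" using assms by simp
  ultimately show ?thesis by linarith
qed

section \<open>Smooth functions\<close>

lemma Ck_SucI:
  assumes "\<And>x. (f has_derivative f' x) (at x)" "\<And>b. b \<in> Basis \<Longrightarrow> Ck k (\<lambda>x. f' x b)"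
  shows "Ck (Suc k) f"
proof -
  have "frechet_derivative f (at x) = f' x" for x
    using frechet_derivative_at[OF assms(1)] by simp
  then show ?thesis using assms by (auto simp: differentiable_def)
qed

lemma Ck_Suc_has_derivative:
  "Ck (Suc k) f \<Longrightarrow> (f has_derivative frechet_derivative f (at x)) (at x)"
  by (simp add: frechet_derivative_works[symmetric])

lemma Ck_Suc_D: "Ck (Suc k) f \<Longrightarrow> Ck k f"
proof (induction k arbitrary: f)
  case 0
  then show ?case
    by (auto intro!: continuous_at_imp_continuous_on differentiable_imp_continuous_within)
next
  case (Suc k)
  then show ?case by (subst Ck.simps) (auto simp del: Ck.simps simp: Ck.simps(2)[of "Suc k"])
qed

lemma Ck_const: "Ck k (\<lambda>x::'a::euclidean_space. c)"
proof (induction k arbitrary: c)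
  case (Suc k)
  show ?case by (rule Ck_SucI[where f' = "\<lambda>x h. 0"]) (auto simp: Suc)
qed simp

lemma Ck_inner: "Ck k (\<lambda>x::'a::euclidean_space. x \<bullet> a)"
proof (cases k)
  case (Suc k)
  show ?thesis unfolding Suc
    by (rule Ck_SucI[where f' = "\<lambda>x h. h \<bullet> a"]) (auto intro!: Ck_const derivative_eq_intros)
qed (auto intro!: continuous_intros)

lemma Ck_add: "Ck k f \<Longrightarrow> Ck k g \<Longrightarrow> Ck k (\<lambda>x. f x + g x)"
proof (induction k arbitrary: f g)
  case (Suc k)
  show ?case
  proof (rule Ck_SucI[where f' = "\<lambda>x h. frechet_derivative f (at x) h + frechet_derivative g (at x) h"])
    show "((\<lambda>x. f x + g x) has_derivative (\<lambda>h. frechet_derivative f (at x) h + frechet_derivative g (at x) h)) (at x)" for x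
      by (intro has_derivative_add Ck_Suc_has_derivative[OF Suc.prems(1)] Ck_Suc_has_derivative[OF Suc.prems(2)])
    show "Ck k (\<lambda>x. frechet_derivative f (at x) b + frechet_derivative g (at x) b)" if "b \<in> Basis" for b
      using Suc.prems that by (intro Suc.IH) auto
  qed
qed (auto intro!: continuous_intros)

lemma Ck_mult: "Ck k f \<Longrightarrow> Ck k g \<Longrightarrow> Ck k (\<lambda>x. f x * g x)"
proof (induction k arbitrary: f g)
  case (Suc k)
  show ?case
  proof (rule Ck_SucI[where f' = "\<lambda>x h. f x * frechet_derivative g (at x) h + frechet_derivative f (at x) h * g x"])
    show "((\<lambda>x. f x * g x) has_derivative (\<lambda>h. f x * frechet_derivative g (at x) h + frechet_derivative f (at x) h * g x)) (at x)" for x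
      by (intro has_derivative_mult Ck_Suc_has_derivative[OF Suc.prems(1)] Ck_Suc_has_derivative[OF Suc.prems(2)])
    show "Ck k (\<lambda>x. f x * frechet_derivative g (at x) b + frechet_derivative f (at x) b * g x)" if "b \<in> Basis" for b
      using Suc.prems that Ck_Suc_D[OF Suc.prems(1)] Ck_Suc_D[OF Suc.prems(2)]
      by (intro Ck_add Suc.IH) auto
  qed
qed (auto intro!: continuous_intros)

lemma Ck_diff: "Ck k f \<Longrightarrow> Ck k g \<Longrightarrow> Ck k (\<lambda>x. f x - g x)"
  using Ck_add[of k f "\<lambda>x. -1 * g x"] Ck_mult[OF Ck_const[of k "-1"], of g] by simp

lemma Ck_sum: "finite I \<Longrightarrow> (\<And>i. i \<in> I \<Longrightarrow> Ck k (f i)) \<Longrightarrow> Ck k (\<lambda>x. \<Sum>i\<in>I. f i x)"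
  by (induction I rule: finite_induct) (auto intro: Ck_const Ck_add)

lemma Ck_prod: "finite I \<Longrightarrow> (\<And>i. i \<in> I \<Longrightarrow> Ck k (f i)) \<Longrightarrow> Ck k (\<lambda>x. \<Prod>i\<in>I. f i x)"
  by (induction I rule: finite_induct) (auto intro: Ck_const Ck_mult)

lemma Ck_inverse: "Ck k f \<Longrightarrow> (\<And>x. f x \<noteq> 0) \<Longrightarrow> Ck k (\<lambda>x. inverse (f x))"
proof (induction k arbitrary: f)
  case (Suc k)
  show ?case
  proof (rule Ck_SucI[where f' = "\<lambda>x h. -1 * (inverse (f x) * frechet_derivative f (at x) h * inverse (f x))"])
    show "((\<lambda>x. inverse (f x)) has_derivative (\<lambda>h. -1 * (inverse (f x) * frechet_derivative f (at x) h * inverse (f x)))) (at x)" for x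
      using Deriv.has_derivative_inverse[OF Suc.prems(2) Ck_Suc_has_derivative[OF Suc.prems(1)]] by simp
    have "Ck k (\<lambda>x. inverse (f x))" using Suc Ck_Suc_D by blast
    then show "Ck k (\<lambda>x. -1 * (inverse (f x) * frechet_derivative f (at x) b * inverse (f x)))" if "b \<in> Basis" for b
      using Suc.prems that by (intro Ck_mult Ck_const) auto
  qed
qed (auto intro!: continuous_intros)

text \<open>
  For \<open>m = 0\<close> this is the standard smooth function that is flat at 0. The factors \<open>inverse t ^ m\<close> make
  the span of the family closed under differentiation, so that all orders can be handled by one induction.
\<close>

definition flat_power :: "nat \<Rightarrow> real \<Rightarrow> real" where
  "flat_power m t = (if 0 < t then exp (- inverse t) * inverse t ^ m else 0)"

lemma flat_power_tendsto_0: "((\<lambda>t. exp (- inverse t) * inverse t ^ m) \<longlongrightarrow> (0::real)) (at_right 0)"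
proof -
  have "((\<lambda>x::real. x ^ m / exp x) \<longlongrightarrow> 0) at_top" by (rule tendsto_power_div_exp_0)
  then have "((\<lambda>t::real. inverse t ^ m / exp (inverse t)) \<longlongrightarrow> 0) (at_right 0)"
    by (rule filterlim_compose) (rule filterlim_inverse_at_top_right)
  then show ?thesis by (simp add: exp_minus field_simps)
qed

lemma flat_power_has_derivative:
  "(flat_power m has_real_derivative (flat_power (m + 2) t - real m * flat_power (m + 1) t)) (at t)"
proof -
  consider "0 < t" | "t < 0" | "t = 0" by linarith
  then show ?thesis
  proof cases
    case 1
    have "((\<lambda>t. exp (- inverse t) * inverse t ^ m) has_real_derivative
        (exp (- inverse t) * inverse t ^ (m + 2) - real m * (exp (- inverse t) * inverse t ^ (m + 1)))) (at t)"
    proof -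
      have d1: "((\<lambda>t. exp (- inverse t)) has_real_derivative exp (- inverse t) * (inverse t)\<^sup>2) (at t)"
        using 1 by (auto intro!: derivative_eq_intros simp: power2_eq_square)
      have "(inverse has_real_derivative - (inverse t)\<^sup>2) (at t)"
        using 1 by (auto intro!: derivative_eq_intros simp: power2_eq_square)
      from DERIV_mult[OF d1 DERIV_power[OF this, of m]] show ?thesis
        by (rule DERIV_cong) (cases m; simp add: power2_eq_square algebra_simps)
    qed
    moreover have "flat_power (m + 2) t - real m * flat_power (m + 1) t =
        exp (- inverse t) * inverse t ^ (m + 2) - real m * (exp (- inverse t) * inverse t ^ (m + 1))"
      using 1 by (simp add: flat_power_def)
    ultimately have "((\<lambda>t. exp (- inverse t) * inverse t ^ m) has_real_derivative
        (flat_power (m + 2) t - real m * flat_power (m + 1) t)) (at t)"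
      by (simp only:)
    then show ?thesis
      by (rule has_field_derivative_transform_within_open[where S = "{0<..}"])
        (use 1 in \<open>auto simp: flat_power_def\<close>)
  next
    case 2
    have "((\<lambda>t. 0::real) has_real_derivative 0) (at t)" by simp
    then have "(flat_power m has_real_derivative 0) (at t)"
      by (rule has_field_derivative_transform_within_open[where S = "{..<0}"])
        (use 2 in \<open>auto simp: flat_power_def\<close>)
    then show ?thesis using 2 by (simp add: flat_power_def)
  next
    case 3
    have "((\<lambda>h. flat_power m h / h) \<longlongrightarrow> 0) (at_left 0)"
      by (rule tendsto_eventually) (auto simp: eventually_at_filter flat_power_def)
    moreover have "((\<lambda>h. flat_power m h / h) \<longlongrightarrow> 0) (at_right 0)"
      by (rule Lim_transform_eventually[OF flat_power_tendsto_0[of "Suc m"]])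
        (auto simp: eventually_at_filter flat_power_def divide_inverse mult_ac)
    ultimately have "((\<lambda>h. flat_power m h / h) \<longlongrightarrow> 0) (at 0)"
      by (simp add: filterlim_split_at)
    then show ?thesis using 3 by (simp add: DERIV_def flat_power_def)
  qed
qed

lemma Ck_flat_power: "(\<And>j. Ck j f) \<Longrightarrow> Ck k (\<lambda>x. flat_power m (f x))"
proof (induction k arbitrary: m)
  case 0
  have "continuous_on UNIV (flat_power m)"
    by (intro continuous_at_imp_continuous_on ballI DERIV_isCont[OF flat_power_has_derivative])
  then show ?case using 0[of 0]
    by (auto intro: continuous_on_compose2[of UNIV "flat_power m"])
next
  case (Suc k)
  show ?case
  proof (rule Ck_SucI[where f' = "\<lambda>x h. (flat_power (m + 2) (f x) - real m * flat_power (m + 1) (f x)) * frechet_derivative f (at x) h"])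
    show "((\<lambda>x. flat_power m (f x)) has_derivative
        (\<lambda>h. (flat_power (m + 2) (f x) - real m * flat_power (m + 1) (f x)) * frechet_derivative f (at x) h)) (at x)" for x
      using has_derivative_compose[OF Ck_Suc_has_derivative[OF Suc.prems]
          flat_power_has_derivative[of m "f x", unfolded has_field_derivative_def]] by simp
    show "Ck k (\<lambda>x. (flat_power (m + 2) (f x) - real m * flat_power (m + 1) (f x)) * frechet_derivative f (at x) b)"
      if "b \<in> Basis" for b
      using Suc.prems[of "Suc k"] that by (intro Ck_mult Ck_diff Suc.IH Suc.prems Ck_const) auto
  qed
qed

lemma flat_power_pos: "0 < t \<Longrightarrow> 0 < flat_power 0 t" and flat_power_nonneg: "0 \<le> flat_power 0 t"
  and flat_power_zero: "t \<le> 0 \<Longrightarrow> flat_power 0 t = 0"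
  by (auto simp: flat_power_def)

lemma Ck_norm_square: "Ck k (\<lambda>x::'a::euclidean_space. (norm x)\<^sup>2)"
proof -
  have "(norm x)\<^sup>2 = (\<Sum>b\<in>Basis. (x \<bullet> b) * (x \<bullet> b))" for x :: 'a
    by (simp add: power2_norm_eq_inner euclidean_inner[of x x])
  then show ?thesis by (simp add: Ck_sum Ck_mult Ck_inner)
qed

text \<open>
  The quotient \<open>f / (f + g)\<close> of two flat functions of \<open>|x|\<^sup>2\<close>, where \<open>f\<close> vanishes on the inner ball, \<open>g\<close>
  vanishes off the outer ball, and the sum is positive everywhere.
\<close>

lemma smooth_cutoff_exists:
  fixes \<epsilon> :: real
  assumes "0 < \<epsilon>"
  obtains \<zeta> :: "'a::euclidean_space \<Rightarrow> real"
  where "\<And>k. Ck k \<zeta>" "\<And>x. 0 \<le> \<zeta> x" "\<And>x. \<zeta> x \<le> 1"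
    "\<And>x. norm x \<le> \<epsilon> / 2 \<Longrightarrow> \<zeta> x = 0" "\<And>x. \<epsilon> \<le> norm x \<Longrightarrow> \<zeta> x = 1"
proof -
  define f where "f x = flat_power 0 ((norm x)\<^sup>2 - (\<epsilon> / 2)\<^sup>2)" for x :: 'a
  define g where "g x = flat_power 0 (\<epsilon>\<^sup>2 - (norm x)\<^sup>2)" for x :: 'a
  have Ckf: "Ck k f" and Ckg: "Ck k g" for k
    unfolding f_def g_def by (intro Ck_flat_power Ck_diff Ck_norm_square Ck_const)+
  have f0: "0 \<le> f x" and g0: "0 \<le> g x" for x unfolding f_def g_def by (auto simp: flat_power_nonneg)
  have fpos: "0 < f x" if "\<epsilon> / 2 < norm x" for x
    unfolding f_def using that assms by (intro flat_power_pos) (auto intro!: power_strict_mono)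
  have gpos: "0 < g x" if "norm x < \<epsilon>" for x
    unfolding g_def using that assms by (intro flat_power_pos) (auto intro!: power_strict_mono)
  have pos: "0 < f x + g x" for x
    using fpos[of x] gpos[of x] f0[of x] g0[of x] assms by (cases "norm x < \<epsilon>") (auto intro: add_nonneg_pos add_pos_nonneg)
  define \<zeta> where "\<zeta> x = f x * inverse (f x + g x)" for x
  show ?thesis
  proof (rule that[of \<zeta>])
    show "Ck k \<zeta>" for k unfolding \<zeta>_def using pos
      by (intro Ck_mult Ck_inverse Ck_add Ckf Ckg) (metis less_irrefl)
    show "0 \<le> \<zeta> x" "\<zeta> x \<le> 1" for x
      using pos[of x] f0[of x] g0[of x] by (auto simp: \<zeta>_def field_simps)
    show "\<zeta> x = 0" if "norm x \<le> \<epsilon> / 2" for x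
      using that assms unfolding \<zeta>_def f_def by (simp add: flat_power_zero power_mono)
    show "\<zeta> x = 1" if "\<epsilon> \<le> norm x" for x
    proof -
      have "g x = 0" using that assms unfolding g_def by (simp add: flat_power_zero power_mono)
      then show ?thesis using pos[of x] by (simp add: \<zeta>_def)
    qed
  qed
qed

lemma smooth_box_bump_exists:
  fixes a b :: "'a::euclidean_space"
  obtains \<beta> :: "'a \<Rightarrow> real" where "\<And>k. Ck k \<beta>" "\<And>x. 0 \<le> \<beta> x"
    "\<And>x. x \<in> box a b \<Longrightarrow> 0 < \<beta> x" "\<And>x. x \<notin> box a b \<Longrightarrow> \<beta> x = 0"
proof
  define \<beta> where "\<beta> x = (\<Prod>i\<in>Basis. flat_power 0 ((x - a) \<bullet> i) * flat_power 0 ((b - x) \<bullet> i))" for x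
  show "Ck k \<beta>" for k
    unfolding \<beta>_def inner_diff_left by (intro Ck_prod Ck_mult Ck_flat_power Ck_diff Ck_inner Ck_const finite_Basis)
  show "0 \<le> \<beta> x" for x
    unfolding \<beta>_def by (intro prod_nonneg mult_nonneg_nonneg flat_power_nonneg ballI)
  show "0 < \<beta> x" if "x \<in> box a b" for x
    using that unfolding \<beta>_def by (intro prod_pos mult_pos_pos flat_power_pos ballI) (auto simp: mem_box inner_diff_left)
  show "\<beta> x = 0" if "x \<notin> box a b" for x
  proof -
    obtain i where i: "i \<in> Basis" "x \<bullet> i \<le> a \<bullet> i \<or> b \<bullet> i \<le> x \<bullet> i"
      using \<open>x \<notin> box a b\<close> by (auto simp: mem_box not_less)
    then have "flat_power 0 ((x - a) \<bullet> i) * flat_power 0 ((b - x) \<bullet> i) = 0"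
      by (auto simp: flat_power_zero inner_diff_left)
    then show ?thesis unfolding \<beta>_def using i by (intro prod_zero) auto
  qed
qed

section \<open>Test functions\<close>

definition gradient :: "('a::euclidean_space \<Rightarrow> real) \<Rightarrow> 'a \<Rightarrow> 'a" where
  "gradient f x = (\<Sum>b\<in>Basis. frechet_derivative f (at x) b *\<^sub>R b)"

lemma inner_gradient_Basis: "b \<in> Basis \<Longrightarrow> gradient f x \<bullet> b = frechet_derivative f (at x) b"
  unfolding gradient_def by (simp add: inner_sum_left inner_Basis if_distrib cong: if_cong)

lemma frechet_derivative_gradient:
  assumes "f differentiable (at x)"
  shows "frechet_derivative f (at x) z = gradient f x \<bullet> z"
proof -
  have "linear (frechet_derivative f (at x))" by (rule linear_frechet_derivative[OF assms])
  then have "frechet_derivative f (at x) (\<Sum>b\<in>Basis. (z \<bullet> b) *\<^sub>R b) = (\<Sum>b\<in>Basis. (z \<bullet> b) * frechet_derivative f (at x) b)"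
    by (simp add: linear_sum linear_cmul)
  then show ?thesis
    by (simp add: euclidean_representation euclidean_inner[of _ z] inner_gradient_Basis mult.commute)
qed

lemma continuous_gradient: "Ck (Suc 0) f \<Longrightarrow> continuous_on UNIV (gradient f)"
  unfolding gradient_def by (auto intro!: continuous_intros)

lemma test_funD:
  assumes "test_fun \<Omega> \<phi>"
  shows "Ck k \<phi>" "\<phi> differentiable (at x)" "continuous_on UNIV \<phi>" "continuous_on UNIV (gradient \<phi>)"
    "\<exists>S. compact S \<and> S \<subseteq> \<Omega> \<and> (\<forall>x. x \<notin> S \<longrightarrow> \<phi> x = 0 \<and> gradient \<phi> x = 0)"
proof -
  show *: "Ck k \<phi>" for k using assms unfolding test_fun_def by simp
  show "\<phi> differentiable (at x)" for x using *[of "Suc 0"] by simp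
  show "continuous_on UNIV \<phi>" using *[of 0] by simp
  show "continuous_on UNIV (gradient \<phi>)" by (intro continuous_gradient *)
  let ?S = "closure {x. \<phi> x \<noteq> 0}"
  have "\<phi> x = 0 \<and> gradient \<phi> x = 0" if "x \<notin> ?S" for x
  proof
    show "\<phi> x = 0" using that closure_subset[of "{x. \<phi> x \<noteq> 0}"] by auto
    have "(\<phi> has_derivative (\<lambda>h. 0)) (at x)"
    proof (rule has_derivative_transform_within_open[where s = "- ?S"])
      show "((\<lambda>x. 0) has_derivative (\<lambda>h. 0)) (at x)" by simp
      show "open (- ?S)" by (intro open_Compl closed_closure)
      show "x \<in> - ?S" using that by simp
      show "0 = \<phi> y" if "y \<in> - ?S" for y using that closure_subset[of "{x. \<phi> x \<noteq> 0}"] by auto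
    qed
    then have "frechet_derivative \<phi> (at x) = (\<lambda>h. 0)" using frechet_derivative_at by metis
    then show "gradient \<phi> x = 0" by (simp add: gradient_def)
  qed
  then show "\<exists>S. compact S \<and> S \<subseteq> \<Omega> \<and> (\<forall>x. x \<notin> S \<longrightarrow> \<phi> x = 0 \<and> gradient \<phi> x = 0)"
    using assms unfolding test_fun_def by blast
qed

lemma test_funI:
  assumes "\<And>k. Ck k \<phi>" "compact S" "S \<subseteq> \<Omega>" "\<And>x. x \<notin> S \<Longrightarrow> \<phi> x = 0"
  shows "test_fun \<Omega> \<phi>"
proof -
  have "closure {x. \<phi> x \<noteq> 0} \<subseteq> S"
    using assms by (intro closure_minimal compact_imp_closed) auto
  moreover have "bounded {x. \<phi> x \<noteq> 0}"
    using assms(4) by (auto intro: bounded_subset[OF compact_imp_bounded[OF assms(2)]])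
  ultimately have "compact (closure {x. \<phi> x \<noteq> 0})" "closure {x. \<phi> x \<noteq> 0} \<subseteq> \<Omega>"
    using assms(3) by (simp_all only: compact_closure)
  with assms(1) show ?thesis unfolding test_fun_def by blast
qed

lemma test_fun_mult:
  assumes "test_fun \<Omega> \<phi>" "\<And>k. Ck k \<zeta>"
  shows "test_fun \<Omega> (\<lambda>x. \<zeta> x * \<phi> x)"
proof -
  obtain S where "compact S" "S \<subseteq> \<Omega>" "\<And>x. x \<notin> S \<Longrightarrow> \<phi> x = 0"
    using test_funD(5)[OF assms(1)] by blast
  then show ?thesis
    by (intro test_funI[of _ S] Ck_mult assms(2) test_funD(1)[OF assms(1)]) auto
qed

lemma gradient_mult:
  assumes "\<phi> differentiable (at x)" "\<psi> differentiable (at x)"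
  shows "gradient (\<lambda>x. \<phi> x * \<psi> x) x = \<phi> x *\<^sub>R gradient \<psi> x + \<psi> x *\<^sub>R gradient \<phi> x"
proof -
  have "((\<lambda>x. \<phi> x * \<psi> x) has_derivative (\<lambda>h. \<phi> x * frechet_derivative \<psi> (at x) h + frechet_derivative \<phi> (at x) h * \<psi> x)) (at x)"
    using assms by (intro has_derivative_mult) (auto simp: frechet_derivative_works[symmetric])
  from frechet_derivative_at[OF this, symmetric] show ?thesis
    by (simp add: gradient_def scaleR_add_left sum.distrib scaleR_right.sum mult.commute)
qed

section \<open>Integration over subsets\<close>

lemma lebesgue_on_eq_restricted:
  fixes f :: "'a::euclidean_space \<Rightarrow> 'b::euclidean_space"
  assumes "S \<in> sets lebesgue" "T \<in> sets lebesgue" "S \<subseteq> T" "\<And>x. x \<in> T - S \<Longrightarrow> f x = 0"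
  shows "integrable (lebesgue_on T) f \<longleftrightarrow> integrable (lebesgue_on S) f"
    and "integral\<^sup>L (lebesgue_on T) f = integral\<^sup>L (lebesgue_on S) f"
proof -
  have eq: "(\<lambda>x. if x \<in> T then f x else 0) = (\<lambda>x. if x \<in> S then f x else 0)"
    using assms by (auto simp: fun_eq_iff)
  show "integrable (lebesgue_on T) f \<longleftrightarrow> integrable (lebesgue_on S) f"
    using Lebesgue_Measure.integrable_restrict_UNIV[OF assms(1), of f]
      Lebesgue_Measure.integrable_restrict_UNIV[OF assms(2), of f] eq by simp
  show "integral\<^sup>L (lebesgue_on T) f = integral\<^sup>L (lebesgue_on S) f"
    using Lebesgue_Measure.integral_restrict_UNIV[OF assms(1), of f]
      Lebesgue_Measure.integral_restrict_UNIV[OF assms(2), of f] eq by simp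
qed

lemma integrable_lebesgue_on_subset:
  fixes f :: "'a::euclidean_space \<Rightarrow> 'b::euclidean_space"
  assumes "integrable (lebesgue_on T) f" "S \<in> sets lebesgue" "T \<in> sets lebesgue" "S \<subseteq> T"
  shows "integrable (lebesgue_on S) f"
proof -
  have S: "S \<in> sets (lebesgue_on T)" using assms by (simp add: sets_restrict_space_iff)
  have "integrable (lebesgue_on T) (\<lambda>x. indicator S x *\<^sub>R f x)"
    by (rule integrable_mult_indicator[OF S assms(1)])
  then have "integrable (lebesgue_on S) (\<lambda>x. indicator S x *\<^sub>R f x)"
    using lebesgue_on_eq_restricted(1)[OF assms(2-4), of "\<lambda>x. indicator S x *\<^sub>R f x"] by simp
  then show ?thesis
    by (rule Bochner_Integration.integrable_cong[THEN iffD1, rotated -1]) auto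
qed

lemma integral_lebesgue_on_subset:
  fixes f :: "'a::euclidean_space \<Rightarrow> real"
  assumes "S \<in> sets lebesgue" "T \<in> sets lebesgue" "S \<subseteq> T"
  shows "integral\<^sup>L (lebesgue_on S) f = (\<integral>x. indicator S x * f x \<partial>lebesgue_on T)"
proof -
  have "(\<integral>x. indicator S x * f x \<partial>lebesgue_on T) = (\<integral>x. indicator S x * f x \<partial>lebesgue_on S)"
    by (rule lebesgue_on_eq_restricted(2)[OF assms]) auto
  also have "\<dots> = integral\<^sup>L (lebesgue_on S) f"
    by (rule Bochner_Integration.integral_cong) auto
  finally show ?thesis by simp
qed

lemma borel_measurable_lebesgue_onI:
  "f \<in> borel_measurable borel \<Longrightarrow> f \<in> borel_measurable (lebesgue_on S)"
  by (intro measurable_restrict_space1 measurable_completion) simp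

lemma continuous_UNIV_borel_measurable_lebesgue_on:
  fixes f :: "'a::euclidean_space \<Rightarrow> 'b::euclidean_space"
  shows "continuous_on UNIV f \<Longrightarrow> f \<in> borel_measurable (lebesgue_on S)"
  by (intro borel_measurable_lebesgue_onI borel_measurable_continuous_onI)

lemma lborel_lebesgue_on_supported:
  fixes f :: "'a::euclidean_space \<Rightarrow> 'b::euclidean_space"
  assumes "S \<in> sets lebesgue" "f \<in> borel_measurable borel" "\<And>x. x \<notin> S \<Longrightarrow> f x = 0"
  shows "integrable (lebesgue_on S) f \<longleftrightarrow> integrable lborel f"
    and "integral\<^sup>L (lebesgue_on S) f = integral\<^sup>L lborel f"
proof -
  have "integrable (lebesgue_on S) f \<longleftrightarrow> integrable lebesgue f"
    using lebesgue_on_eq_restricted(1)[of S UNIV f] assms by (simp add: lebesgue_on_UNIV_eq)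
  also have "\<dots> \<longleftrightarrow> integrable lborel f"
    using assms by (intro integrable_completion) simp
  finally show "integrable (lebesgue_on S) f \<longleftrightarrow> integrable lborel f" .
  have "integral\<^sup>L (lebesgue_on S) f = integral\<^sup>L lebesgue f"
    using lebesgue_on_eq_restricted(2)[of S UNIV f] assms by (simp add: lebesgue_on_UNIV_eq)
  also have "\<dots> = integral\<^sup>L lborel f"
    using assms by (intro integral_completion) simp
  finally show "integral\<^sup>L (lebesgue_on S) f = integral\<^sup>L lborel f" .
qed

lemma open_compact_lebesgue[simp, intro]:
  fixes S :: "'a::euclidean_space set"
  shows "open S \<Longrightarrow> S \<in> sets lebesgue" "compact S \<Longrightarrow> S \<in> sets lebesgue"
  by (auto intro: lmeasurable_compact fmeasurableD)

lemma borel_measurable_indicator_lebesgue_on: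
  assumes "T \<in> sets borel"
  shows "(indicator T :: 'a::euclidean_space \<Rightarrow> real) \<in> borel_measurable (lebesgue_on S)"
  by (intro borel_measurable_lebesgue_onI borel_measurable_indicator assms)

lemma integrable_bounded_mult:
  fixes f m :: "'a::euclidean_space \<Rightarrow> real"
  assumes "m \<in> borel_measurable (lebesgue_on S)" "AE x in lebesgue_on S. \<bar>m x\<bar> \<le> B"
    and "integrable (lebesgue_on S) f"
  shows "integrable (lebesgue_on S) (\<lambda>x. m x * f x)"
proof (rule Bochner_Integration.integrable_bound)
  show "integrable (lebesgue_on S) (\<lambda>x. B * f x)" using assms(3) by simp
  show "(\<lambda>x. m x * f x) \<in> borel_measurable (lebesgue_on S)"
    by (intro borel_measurable_times assms borel_measurable_integrable)
  show "AE x in lebesgue_on S. norm (m x * f x) \<le> norm (B * f x)"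
    using assms(2) by eventually_elim (auto simp: abs_mult intro!: mult_right_mono)
qed

lemma integrable_indicator_mult:
  fixes f :: "'a::euclidean_space \<Rightarrow> real"
  assumes "T \<in> sets borel" "integrable (lebesgue_on S) f"
  shows "integrable (lebesgue_on S) (\<lambda>x. indicator T x * f x)"
  by (rule integrable_bounded_mult[OF borel_measurable_indicator_lebesgue_on[OF assms(1)] _ assms(2), where B = 1])
    (auto simp: indicator_def)

section \<open>Locally integrable functions and weak gradients\<close>

text \<open>
  Stated for an arbitrary bilinear product because the product rule below needs multiplication of
  reals and scalar multiplication from either side.
\<close>

lemma loc_integrable_product:
  fixes f :: "'a::euclidean_space \<Rightarrow> 'b::euclidean_space" and g :: "'a \<Rightarrow> 'c::euclidean_space"
  assumes f: "loc_integrable \<Omega> f" and B: "bounded_bilinear B"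
    and g: "continuous_on UNIV g"
  shows "loc_integrable \<Omega> (\<lambda>x. B (f x) (g x) :: 'd::euclidean_space)"
  unfolding loc_integrable_def
proof safe
  fix S assume S: "compact S" "S \<subseteq> \<Omega>"
  then have fS: "integrable (lebesgue_on S) f" using f unfolding loc_integrable_def by auto
  have "bounded (g ` S)"
    using S by (intro compact_imp_bounded compact_continuous_image continuous_on_subset[OF g]) auto
  then obtain b where b: "\<And>x. x \<in> S \<Longrightarrow> norm (g x) \<le> b" unfolding bounded_iff by auto
  obtain k where k: "0 < k" "\<And>x y. norm (B x y) \<le> norm x * norm y * k"
    using bounded_bilinear.pos_bounded[OF B] by blast
  show "integrable (lebesgue_on S) (\<lambda>x. B (f x) (g x))"
  proof (rule Bochner_Integration.integrable_bound)
    show "integrable (lebesgue_on S) (\<lambda>x. norm (f x) * (b * k))"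
      using fS by (intro integrable_mult_left integrable_norm)
    have "isCont (\<lambda>p. B (fst p) (snd p)) p" for p
      by (intro bounded_bilinear.isCont[OF B] continuous_intros)
    then have "continuous_on UNIV (\<lambda>p. B (fst p) (snd p))"
      by (simp add: continuous_at_imp_continuous_on)
    from borel_measurable_continuous_Pair[OF borel_measurable_integrable[OF fS]
        continuous_UNIV_borel_measurable_lebesgue_on[OF g] this]
    show "(\<lambda>x. B (f x) (g x)) \<in> borel_measurable (lebesgue_on S)" by simp
    show "AE x in lebesgue_on S. norm (B (f x) (g x)) \<le> norm (norm (f x) * (b * k))"
    proof (rule AE_I2)
      fix x assume "x \<in> space (lebesgue_on S)"
      then have x: "x \<in> S" by simp
      have "norm (B (f x) (g x)) \<le> norm (f x) * norm (g x) * k" by (rule k)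
      also have "\<dots> \<le> norm (f x) * b * k"
        using b[OF x] k(1) by (intro mult_right_mono mult_left_mono) auto
      also have "\<dots> \<le> \<bar>norm (f x) * b * k\<bar>" by (rule abs_ge_self)
      finally show "norm (B (f x) (g x)) \<le> norm (norm (f x) * (b * k))" by (simp only: mult.assoc real_norm_def)
    qed
  qed
qed

lemma loc_integrable_add:
  "loc_integrable \<Omega> f \<Longrightarrow> loc_integrable \<Omega> g \<Longrightarrow> loc_integrable \<Omega> (\<lambda>x. f x + g x)"
  by (auto simp: loc_integrable_def)

lemma loc_integrable_diff:
  "loc_integrable \<Omega> f \<Longrightarrow> loc_integrable \<Omega> g \<Longrightarrow> loc_integrable \<Omega> (\<lambda>x. f x - g x)"
  by (auto simp: loc_integrable_def)

lemma loc_integrable_scaleR: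
  "loc_integrable \<Omega> f \<Longrightarrow> loc_integrable \<Omega> (\<lambda>x. c *\<^sub>R f x)"
  by (auto simp: loc_integrable_def)

lemma loc_integrable_inner_const:
  "loc_integrable \<Omega> f \<Longrightarrow> loc_integrable \<Omega> (\<lambda>x. f x \<bullet> c)"
  by (auto simp: loc_integrable_def)

lemma loc_integrable_continuous:
  fixes f :: "'a::euclidean_space \<Rightarrow> 'b::euclidean_space"
  assumes "continuous_on UNIV f"
  shows "loc_integrable \<Omega> f"
proof -
  have "loc_integrable \<Omega> (\<lambda>x::'a. 1::real)"
    unfolding loc_integrable_def
  proof safe
    fix S :: "'a set" assume "compact S"
    then interpret finite_measure "lebesgue_on S" by (intro finite_measure_lebesgue_on lmeasurable_compact)
    show "integrable (lebesgue_on S) (\<lambda>x. 1::real)" by simp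
  qed
  from loc_integrable_product[OF this bounded_bilinear_scaleR assms] show ?thesis by simp
qed

lemma loc_integrable_imp_integrable:
  fixes f :: "'a::euclidean_space \<Rightarrow> 'b::euclidean_space"
  assumes "loc_integrable \<Omega> f" "open \<Omega>" "compact S" "S \<subseteq> \<Omega>" "\<And>x. x \<notin> S \<Longrightarrow> f x = 0"
  shows "integrable (lebesgue_on \<Omega>) f"
  using lebesgue_on_eq_restricted(1)[of S \<Omega> f] assms unfolding loc_integrable_def by auto

lemma integrable_mult_test_fun:
  fixes f :: "'a::euclidean_space \<Rightarrow> real"
  assumes "loc_integrable \<Omega> f" "open \<Omega>" "test_fun \<Omega> \<phi>"
  shows "integrable (lebesgue_on \<Omega>) (\<lambda>x. f x * \<phi> x)"
    and "integrable (lebesgue_on \<Omega>) (\<lambda>x. f x * (gradient \<phi> x \<bullet> b))"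
proof -
  obtain S where S: "compact S" "S \<subseteq> \<Omega>" "\<And>x. x \<notin> S \<Longrightarrow> \<phi> x = 0" "\<And>x. x \<notin> S \<Longrightarrow> gradient \<phi> x = 0"
    using test_funD(5)[OF assms(3)] by blast
  show "integrable (lebesgue_on \<Omega>) (\<lambda>x. f x * \<phi> x)"
    using S by (intro loc_integrable_imp_integrable[OF loc_integrable_product[OF assms(1) bounded_bilinear_mult] assms(2)]
      test_funD(3)[OF assms(3)]) auto
  have "continuous_on UNIV (\<lambda>x. gradient \<phi> x \<bullet> b)"
    by (intro continuous_intros test_funD(4)[OF assms(3)])
  then show "integrable (lebesgue_on \<Omega>) (\<lambda>x. f x * (gradient \<phi> x \<bullet> b))"
    using S by (intro loc_integrable_imp_integrable[OF loc_integrable_product[OF assms(1) bounded_bilinear_mult] assms(2)]) auto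
qed

text \<open>
  The indicator of an open box is the bounded pointwise limit of the test functions
  \<open>\<beta> / (\<beta> + 1 / (j + 1))\<close>, where \<open>\<beta>\<close> is a smooth function that is positive exactly on the box.
\<close>

lemma integral_cbox_eq_0_of_test_fun:
  fixes g :: "'a::euclidean_space \<Rightarrow> real"
  assumes g: "loc_integrable \<Omega> g" "open \<Omega>"
    and zero: "\<And>\<phi>. test_fun \<Omega> \<phi> \<Longrightarrow> (\<integral>x. g x * \<phi> x \<partial>lebesgue_on \<Omega>) = 0"
    and sub: "cbox a b \<subseteq> \<Omega>"
  shows "integral (cbox a b) g = 0"
proof -
  let ?M = "lebesgue_on (cbox a b)"
  have gi: "integrable ?M g" using g(1) sub unfolding loc_integrable_def by auto
  obtain \<beta> :: "'a \<Rightarrow> real" where \<beta>: "\<And>k. Ck k \<beta>" "\<And>x. 0 \<le> \<beta> x"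
    "\<And>x. x \<in> box a b \<Longrightarrow> 0 < \<beta> x" "\<And>x. x \<notin> box a b \<Longrightarrow> \<beta> x = 0"
    using smooth_box_bump_exists[of a b] by blast
  define \<phi> where "\<phi> j x = \<beta> x * inverse (\<beta> x + inverse (real (Suc j)))" for j x
  have pos: "0 < \<beta> x + inverse (real (Suc j))" for j x
    using \<beta>(2)[of x] by (intro add_nonneg_pos) auto
  have Ck: "Ck k (\<phi> j)" for k j
    unfolding \<phi>_def using pos by (intro Ck_mult Ck_inverse Ck_add Ck_const \<beta>(1)) (metis less_irrefl)
  have out: "\<phi> j x = 0" if "x \<notin> cbox a b" for j x
    unfolding \<phi>_def using \<beta>(4)[of x] that box_subset_cbox[of a b] by auto
  have test: "test_fun \<Omega> (\<phi> j)" for j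
    by (rule test_funI[OF Ck compact_cbox sub out])
  have meas: "\<phi> j \<in> borel_measurable ?M" for j
    by (intro continuous_UNIV_borel_measurable_lebesgue_on test_funD(3)[OF test])
  have "(\<integral>x. g x * \<phi> j x \<partial>?M) = 0" for j
    using lebesgue_on_eq_restricted(2)[of "cbox a b" \<Omega> "\<lambda>x. g x * \<phi> j x"] zero[OF test[of j]] out sub g(2)
    by simp
  moreover have "(\<lambda>j. \<integral>x. g x * \<phi> j x \<partial>?M) \<longlonglongrightarrow> (\<integral>x. g x * indicator (box a b) x \<partial>?M)"
  proof (rule integral_dominated_convergence)
    show "integrable ?M (\<lambda>x. norm (g x))" using gi by simp
    show "(\<lambda>x. g x * indicator (box a b) x) \<in> borel_measurable ?M"
      by (intro borel_measurable_times[OF borel_measurable_integrable[OF gi]] borel_measurable_lebesgue_onI) auto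
    show "(\<lambda>x. g x * \<phi> j x) \<in> borel_measurable ?M" for j
      using borel_measurable_integrable[OF gi] meas by simp
    show "AE x in ?M. (\<lambda>j. g x * \<phi> j x) \<longlonglongrightarrow> g x * indicator (box a b) x"
    proof (rule AE_I2, rule tendsto_mult[OF tendsto_const])
      fix x
      show "(\<lambda>j. \<phi> j x) \<longlonglongrightarrow> indicator (box a b) x"
      proof (cases "x \<in> box a b")
        case True
        have "(\<lambda>j. \<beta> x * inverse (\<beta> x + inverse (real (Suc j)))) \<longlonglongrightarrow> \<beta> x * inverse (\<beta> x + 0)"
          using \<beta>(3)[OF True] by (intro tendsto_intros LIMSEQ_inverse_real_of_nat) auto
        then show ?thesis using True \<beta>(3)[OF True] by (simp add: \<phi>_def)
      qed (simp add: \<phi>_def \<beta>(4))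
    qed
    show "AE x in ?M. norm (g x * \<phi> j x) \<le> norm (g x)" for j
    proof (rule AE_I2)
      fix x
      have "\<bar>\<phi> j x\<bar> \<le> 1" using pos[of x j] \<beta>(2)[of x] by (simp add: \<phi>_def abs_mult field_simps)
      then show "norm (g x * \<phi> j x) \<le> norm (g x)" by (simp add: abs_mult mult_left_le)
    qed
  qed
  ultimately have "(\<integral>x. g x * indicator (box a b) x \<partial>?M) = 0"
    by (simp add: LIMSEQ_const_iff)
  moreover have "(\<integral>x. g x * indicator (box a b) x \<partial>?M) = (\<integral>x. g x * indicator (box a b) x \<partial>lebesgue_on (box a b))"
    by (rule lebesgue_on_eq_restricted(2)) (auto simp: box_subset_cbox indicator_def)
  moreover have "\<dots> = integral\<^sup>L (lebesgue_on (box a b)) g"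
    by (rule Bochner_Integration.integral_cong) auto
  moreover have "\<dots> = integral (box a b) g"
    by (intro lebesgue_integral_eq_integral integrable_lebesgue_on_subset[OF gi]) (auto simp: box_subset_cbox)
  ultimately show ?thesis by (simp add: integral_open_interval)
qed

text \<open>
  The fundamental lemma of the calculus of variations: the averages of \<open>g\<close> over small cubes vanish and
  converge to \<open>g\<close> almost everywhere by Lebesgue differentiation, applied on each of countably many
  boxes that exhaust \<open>\<Omega>\<close>.
\<close>

lemma AE_eq_0_of_test_fun:
  fixes g :: "'a::euclidean_space \<Rightarrow> real"
  assumes g: "loc_integrable \<Omega> g" "open \<Omega>"
    and zero: "\<And>\<phi>. test_fun \<Omega> \<phi> \<Longrightarrow> (\<integral>x. g x * \<phi> x \<partial>lebesgue_on \<Omega>) = 0"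
  shows "AE x in lebesgue_on \<Omega>. g x = 0"
proof -
  have box: "AE x in lebesgue. x \<in> cbox a b \<longrightarrow> g x = 0" if sub: "cbox a b \<subseteq> \<Omega>" for a b
  proof -
    have gi: "integrable (lebesgue_on (cbox a b)) g"
      using g(1) sub unfolding loc_integrable_def by auto
    define f where "f x = (if x \<in> cbox a b then g x else 0)" for x
    have "integrable lebesgue f"
      unfolding f_def using gi by (subst Lebesgue_Measure.integrable_restrict_UNIV) auto
    then have "f absolutely_integrable_on UNIV"
      by (simp add: set_integrable_def)
    then have "f absolutely_integrable_on cbox c d" for c d
      by (rule set_integrable_subset) auto
    then have "f integrable_on cbox c d" for c d
      using absolutely_integrable_on_def by blast
    then obtain N where N: "negligible N" "\<And>x e. \<lbrakk>x \<notin> N; 0 < e\<rbrakk> \<Longrightarrow>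
        \<exists>d>0. \<forall>h. 0 < h \<and> h < d \<longrightarrow> norm (integral (cbox x (x + h *\<^sub>R One)) f /\<^sub>R h ^ DIM('a) - f x) < e"
      using integrable_ccontinuous_explicit[of f] by blast
    have zeroN: "g x = 0" if x: "x \<in> box a b" "x \<notin> N" for x
    proof (rule ccontr)
      assume "g x \<noteq> 0"
      then obtain d where d: "0 < d" "\<And>h. 0 < h \<Longrightarrow> h < d \<Longrightarrow>
          norm (integral (cbox x (x + h *\<^sub>R One)) f /\<^sub>R h ^ DIM('a) - f x) < \<bar>g x\<bar>"
        using N(2)[OF x(2), of "\<bar>g x\<bar>"] by auto
      obtain r where r: "0 < r" "ball x r \<subseteq> box a b"
        using x(1) open_box open_contains_ball by blast
      have "(\<lambda>h. norm (h *\<^sub>R (One::'a))) \<midarrow>0\<rightarrow> norm (0 *\<^sub>R (One::'a))"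
        by (intro tendsto_intros)
      then have "\<forall>\<^sub>F h in at (0::real). norm (h *\<^sub>R (One::'a)) < r"
        using r by (intro order_tendstoD) auto
      then obtain s where s: "0 < s" "\<And>h. h \<noteq> 0 \<Longrightarrow> \<bar>h\<bar> < s \<Longrightarrow> norm (h *\<^sub>R (One::'a)) < r"
        unfolding eventually_at by (auto simp: dist_real_def)
      \<comment> \<open>Small enough both for the differentiation theorem and for the cube to stay in the box.\<close>
      define h where "h = min d s / 2"
      have h: "0 < h" "h < d" "h < s" unfolding h_def using d s by auto
      have "cbox x (x + h *\<^sub>R One) \<subseteq> ball x r"
      proof
        fix y assume y: "y \<in> cbox x (x + h *\<^sub>R One)"
        have "norm (y - x) \<le> norm (h *\<^sub>R (One::'a))"
          using y h by (intro norm_le_componentwise) (auto simp: mem_box inner_diff_left inner_add_left)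
        also have "\<dots> < r" using s(2)[of h] h by auto
        finally show "y \<in> ball x r" by (simp add: dist_norm norm_minus_commute)
      qed
      then have Q: "cbox x (x + h *\<^sub>R One) \<subseteq> cbox a b"
        using r box_subset_cbox by blast
      have "integral (cbox x (x + h *\<^sub>R One)) f = integral (cbox x (x + h *\<^sub>R One)) g"
        by (rule integral_cong) (use Q in \<open>auto simp: f_def\<close>)
      also have "\<dots> = 0"
        by (rule integral_cbox_eq_0_of_test_fun[OF g zero]) (use Q sub in auto)
      finally have "\<bar>f x\<bar> < \<bar>g x\<bar>" using d(2)[OF h(1,2)] by simp
      then show False using x(1) box_subset_cbox[of a b] by (auto simp: f_def)
    qed
    have "negligible (N \<union> (cbox a b - box a b))"
      using N(1) negligible_frontier_interval[of a b] by simp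
    then have "N \<union> (cbox a b - box a b) \<in> null_sets lebesgue"
      by (simp add: negligible_iff_null_sets)
    then show ?thesis
      by (rule AE_I') (use zeroN in blast)
  qed
  obtain \<D> where \<D>: "countable \<D>" "\<And>X. X \<in> \<D> \<Longrightarrow> \<exists>a b. X = cbox a b" "\<Union>\<D> = \<Omega>"
    using open_countable_Union_open_cbox[OF g(2)] by metis
  have "AE x in lebesgue. \<forall>X\<in>\<D>. x \<in> X \<longrightarrow> g x = 0"
    unfolding AE_ball_countable[OF \<D>(1)]
  proof
    fix X assume X: "X \<in> \<D>"
    then obtain a b where "X = cbox a b" using \<D> by blast
    then show "AE x in lebesgue. x \<in> X \<longrightarrow> g x = 0" using box[of a b] X \<D>(3) by auto
  qed
  then have "AE x in lebesgue. x \<in> \<Omega> \<longrightarrow> g x = 0"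
    using \<D>(3) by (auto elim!: eventually_mono)
  then show ?thesis using g(2) by (subst AE_restrict_space_iff) auto
qed

lemma has_weak_gradient_iff:
  "has_weak_gradient \<Omega> u g \<longleftrightarrow> loc_integrable \<Omega> u \<and> loc_integrable \<Omega> g \<and>
     (\<forall>\<phi>. test_fun \<Omega> \<phi> \<longrightarrow> (\<forall>b\<in>Basis.
        (\<integral>x. u x * (gradient \<phi> x \<bullet> b) \<partial>lebesgue_on \<Omega>) = - (\<integral>x. (g x \<bullet> b) * \<phi> x \<partial>lebesgue_on \<Omega>)))"
  unfolding has_weak_gradient_def by (simp add: inner_gradient_Basis cong: conj_cong)

lemma weak_gradient_unique:
  assumes \<Omega>: "open \<Omega>" and g: "has_weak_gradient \<Omega> u g" and h: "has_weak_gradient \<Omega> u h"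
  shows "AE x in lebesgue_on \<Omega>. g x = h x"
proof -
  have lg: "loc_integrable \<Omega> g" and lh: "loc_integrable \<Omega> h"
    using g h unfolding has_weak_gradient_def by auto
  have "AE x in lebesgue_on \<Omega>. (g x - h x) \<bullet> b = 0" if b: "b \<in> Basis" for b
  proof (rule AE_eq_0_of_test_fun[OF _ \<Omega>])
    show "loc_integrable \<Omega> (\<lambda>x. (g x - h x) \<bullet> b)"
      by (intro loc_integrable_inner_const loc_integrable_diff lg lh)
    fix \<phi> assume \<phi>: "test_fun \<Omega> \<phi>"
    have "(\<integral>x. (g x - h x) \<bullet> b * \<phi> x \<partial>lebesgue_on \<Omega>) =
        (\<integral>x. (g x \<bullet> b) * \<phi> x - (h x \<bullet> b) * \<phi> x \<partial>lebesgue_on \<Omega>)"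
      by (simp add: inner_diff_left algebra_simps)
    also have "\<dots> = (\<integral>x. (g x \<bullet> b) * \<phi> x \<partial>lebesgue_on \<Omega>) - (\<integral>x. (h x \<bullet> b) * \<phi> x \<partial>lebesgue_on \<Omega>)"
      by (intro Bochner_Integration.integral_diff integrable_mult_test_fun(1)[OF _ \<Omega> \<phi>] loc_integrable_inner_const lg lh)
    also have "\<dots> = 0" using g h \<phi> b unfolding has_weak_gradient_iff by force
    finally show "(\<integral>x. (g x - h x) \<bullet> b * \<phi> x \<partial>lebesgue_on \<Omega>) = 0" .
  qed
  then have "AE x in lebesgue_on \<Omega>. \<forall>b\<in>Basis. (g x - h x) \<bullet> b = 0"
    by (intro AE_finite_allI) auto
  then show ?thesis
    by eventually_elim (metis euclidean_all_zero_iff eq_iff_diff_eq_0)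
qed

text \<open>
  Since the weak gradient is chosen by a choice operator, every computation with it goes through this
  lemma: a candidate is exhibited, and uniqueness identifies it with the chosen gradient.
\<close>

lemma wgrad_AE_eq:
  assumes "open \<Omega>" "has_weak_gradient \<Omega> u g"
  shows "has_weak_gradient \<Omega> u (wgrad \<Omega> u)" "AE x in lebesgue_on \<Omega>. wgrad \<Omega> u x = g x"
proof -
  show *: "has_weak_gradient \<Omega> u (wgrad \<Omega> u)"
    unfolding wgrad_def using assms(2) by (metis someI)
  show "AE x in lebesgue_on \<Omega>. wgrad \<Omega> u x = g x"
    by (rule weak_gradient_unique[OF assms(1) * assms(2)])
qed

lemma has_weak_gradient_diff:
  assumes \<Omega>: "open \<Omega>" and u: "has_weak_gradient \<Omega> u g" and v: "has_weak_gradient \<Omega> v h"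
  shows "has_weak_gradient \<Omega> (\<lambda>x. u x - v x) (\<lambda>x. g x - h x)"
  unfolding has_weak_gradient_iff
proof (intro conjI allI impI ballI)
  have loc: "loc_integrable \<Omega> u" "loc_integrable \<Omega> v" "loc_integrable \<Omega> g" "loc_integrable \<Omega> h"
    using u v unfolding has_weak_gradient_def by auto
  show "loc_integrable \<Omega> (\<lambda>x. u x - v x)" "loc_integrable \<Omega> (\<lambda>x. g x - h x)"
    by (intro loc_integrable_diff loc)+
  fix \<phi> and b :: 'a assume \<phi>: "test_fun \<Omega> \<phi>" and b: "b \<in> Basis"
  show "(\<integral>x. (u x - v x) * (gradient \<phi> x \<bullet> b) \<partial>lebesgue_on \<Omega>) = - (\<integral>x. (g x - h x) \<bullet> b * \<phi> x \<partial>lebesgue_on \<Omega>)"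
    using u v \<phi> b integrable_mult_test_fun[OF loc(1) \<Omega> \<phi>] integrable_mult_test_fun[OF loc(2) \<Omega> \<phi>]
      integrable_mult_test_fun(1)[OF loc_integrable_inner_const[OF loc(3)] \<Omega> \<phi>, of b]
      integrable_mult_test_fun(1)[OF loc_integrable_inner_const[OF loc(4)] \<Omega> \<phi>, of b]
    unfolding has_weak_gradient_iff
    by (simp add: left_diff_distrib inner_diff_left)
qed

lemma has_weak_gradient_scale:
  assumes u: "has_weak_gradient \<Omega> u g"
  shows "has_weak_gradient \<Omega> (\<lambda>x. c * u x) (\<lambda>x. c *\<^sub>R g x)"
  using u loc_integrable_scaleR[of \<Omega> u c] loc_integrable_scaleR[of \<Omega> g c]
  unfolding has_weak_gradient_iff by (simp add: mult.assoc)

text \<open>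
  The product \<open>\<zeta> \<phi>\<close> is again a test function, and \<open>\<zeta> \<nabla>\<phi> = \<nabla>(\<zeta> \<phi>) - \<phi> \<nabla>\<zeta>\<close>.
\<close>

lemma has_weak_gradient_smooth_mult:
  assumes \<Omega>: "open \<Omega>" and u: "has_weak_gradient \<Omega> u g" and \<zeta>: "\<And>k. Ck k \<zeta>"
  shows "has_weak_gradient \<Omega> (\<lambda>x. \<zeta> x * u x) (\<lambda>x. \<zeta> x *\<^sub>R g x + u x *\<^sub>R gradient \<zeta> x)"
  unfolding has_weak_gradient_iff
proof (intro conjI allI impI ballI)
  have loc: "loc_integrable \<Omega> u" "loc_integrable \<Omega> g"
    using u unfolding has_weak_gradient_def by auto
  have cont: "continuous_on UNIV \<zeta>" "continuous_on UNIV (gradient \<zeta>)"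
    using \<zeta>[of 0] continuous_gradient[OF \<zeta>] by auto
  have "loc_integrable \<Omega> (\<lambda>x. u x * \<zeta> x)"
    by (intro loc_integrable_product[OF loc(1) bounded_bilinear_mult] cont)
  then show "loc_integrable \<Omega> (\<lambda>x. \<zeta> x * u x)" by (simp add: mult.commute)
  show "loc_integrable \<Omega> (\<lambda>x. \<zeta> x *\<^sub>R g x + u x *\<^sub>R gradient \<zeta> x)"
    by (intro loc_integrable_add loc_integrable_product[OF loc(1) bounded_bilinear_scaleR]
      loc_integrable_product[OF loc(2) bounded_bilinear.flip[OF bounded_bilinear_scaleR]] cont)
  fix \<phi> and b :: 'a assume \<phi>: "test_fun \<Omega> \<phi>" and b: "b \<in> Basis"
  have \<zeta>\<phi>: "test_fun \<Omega> (\<lambda>x. \<zeta> x * \<phi> x)" by (rule test_fun_mult[OF \<phi> \<zeta>])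
  have "\<zeta> differentiable (at x)" for x using \<zeta>[of "Suc 0"] by simp
  then have gr: "gradient (\<lambda>x. \<zeta> x * \<phi> x) x = \<zeta> x *\<^sub>R gradient \<phi> x + \<phi> x *\<^sub>R gradient \<zeta> x" for x
    by (intro gradient_mult test_funD(2)[OF \<phi>])
  have loc2: "loc_integrable \<Omega> (\<lambda>x. u x * (gradient \<zeta> x \<bullet> b))"
    by (intro loc_integrable_product[OF loc(1) bounded_bilinear_mult] continuous_intros cont)
  note int = integrable_mult_test_fun(2)[OF loc(1) \<Omega> \<zeta>\<phi>, of b] integrable_mult_test_fun(1)[OF loc2 \<Omega> \<phi>]
    integrable_mult_test_fun(1)[OF loc_integrable_inner_const[OF loc(2)] \<Omega> \<zeta>\<phi>, of b]
  have "(\<integral>x. \<zeta> x * u x * (gradient \<phi> x \<bullet> b) \<partial>lebesgue_on \<Omega>) =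
      (\<integral>x. u x * (gradient (\<lambda>x. \<zeta> x * \<phi> x) x \<bullet> b) - u x * (gradient \<zeta> x \<bullet> b) * \<phi> x \<partial>lebesgue_on \<Omega>)"
    unfolding gr by (intro Bochner_Integration.integral_cong) (auto simp: inner_add_left algebra_simps)
  also have "\<dots> = (\<integral>x. u x * (gradient (\<lambda>x. \<zeta> x * \<phi> x) x \<bullet> b) \<partial>lebesgue_on \<Omega>) - (\<integral>x. u x * (gradient \<zeta> x \<bullet> b) * \<phi> x \<partial>lebesgue_on \<Omega>)"
    by (intro Bochner_Integration.integral_diff int)
  also have "(\<integral>x. u x * (gradient (\<lambda>x. \<zeta> x * \<phi> x) x \<bullet> b) \<partial>lebesgue_on \<Omega>) = - (\<integral>x. (g x \<bullet> b) * (\<zeta> x * \<phi> x) \<partial>lebesgue_on \<Omega>)"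
    using u b \<zeta>\<phi> unfolding has_weak_gradient_iff by auto
  also have "- (\<integral>x. (g x \<bullet> b) * (\<zeta> x * \<phi> x) \<partial>lebesgue_on \<Omega>) - (\<integral>x. u x * (gradient \<zeta> x \<bullet> b) * \<phi> x \<partial>lebesgue_on \<Omega>) =
      - (\<integral>x. (g x \<bullet> b) * (\<zeta> x * \<phi> x) + u x * (gradient \<zeta> x \<bullet> b) * \<phi> x \<partial>lebesgue_on \<Omega>)"
    using int by simp
  also have "(\<integral>x. (g x \<bullet> b) * (\<zeta> x * \<phi> x) + u x * (gradient \<zeta> x \<bullet> b) * \<phi> x \<partial>lebesgue_on \<Omega>) =
      (\<integral>x. (\<zeta> x *\<^sub>R g x + u x *\<^sub>R gradient \<zeta> x) \<bullet> b * \<phi> x \<partial>lebesgue_on \<Omega>)"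
    by (intro Bochner_Integration.integral_cong) (auto simp: inner_add_left algebra_simps)
  finally show "(\<integral>x. \<zeta> x * u x * (gradient \<phi> x \<bullet> b) \<partial>lebesgue_on \<Omega>) =
      - (\<integral>x. (\<zeta> x *\<^sub>R g x + u x *\<^sub>R gradient \<zeta> x) \<bullet> b * \<phi> x \<partial>lebesgue_on \<Omega>)" .
qed

section \<open>Square integrable functions\<close>

lemma Ltwo_norm_square: "(Ltwo_norm \<Omega> f)\<^sup>2 = (\<integral>x. (norm (f x))\<^sup>2 \<partial>lebesgue_on \<Omega>)"
  unfolding Ltwo_norm_def by simp

lemma LtwoD:
  assumes "Ltwo \<Omega> f"
  shows "f \<in> borel_measurable (lebesgue_on \<Omega>)" "integrable (lebesgue_on \<Omega>) (\<lambda>x. (norm (f x))\<^sup>2)"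
  using assms unfolding Ltwo_def by auto

lemma norm_add_square_le: "(norm (a + b))\<^sup>2 \<le> 2 * (norm a)\<^sup>2 + 2 * (norm b)\<^sup>2"
  for a b :: "'b::real_normed_vector"
proof -
  have "(norm (a + b))\<^sup>2 \<le> (norm a + norm b)\<^sup>2" by (intro power_mono norm_triangle_ineq) simp
  also have "\<dots> \<le> 2 * (norm a)\<^sup>2 + 2 * (norm b)\<^sup>2"
    using sum_squares_bound[of "norm a" "norm b"] by (simp add: power2_sum)
  finally show ?thesis .
qed

lemma Ltwo_bound:
  assumes "f \<in> borel_measurable (lebesgue_on \<Omega>)" "integrable (lebesgue_on \<Omega>) h"
    "AE x in lebesgue_on \<Omega>. (norm (f x))\<^sup>2 \<le> h x"
  shows "Ltwo \<Omega> f" "(\<integral>x. (norm (f x))\<^sup>2 \<partial>lebesgue_on \<Omega>) \<le> (\<integral>x. h x \<partial>lebesgue_on \<Omega>)"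
proof -
  have "integrable (lebesgue_on \<Omega>) (\<lambda>x. (norm (f x))\<^sup>2)"
    by (rule Bochner_Integration.integrable_bound[OF assms(2)])
      (use assms in \<open>auto elim!: eventually_mono\<close>)
  then show "Ltwo \<Omega> f" "(\<integral>x. (norm (f x))\<^sup>2 \<partial>lebesgue_on \<Omega>) \<le> (\<integral>x. h x \<partial>lebesgue_on \<Omega>)"
    using assms unfolding Ltwo_def by (auto intro: integral_mono_AE)
qed

lemma Ltwo_add:
  assumes "Ltwo \<Omega> f" "Ltwo \<Omega> g"
  shows "Ltwo \<Omega> (\<lambda>x. f x + g x)"
    "(\<integral>x. (norm (f x + g x))\<^sup>2 \<partial>lebesgue_on \<Omega>) \<le> 2 * (\<integral>x. (norm (f x))\<^sup>2 \<partial>lebesgue_on \<Omega>) + 2 * (\<integral>x. (norm (g x))\<^sup>2 \<partial>lebesgue_on \<Omega>)"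
proof -
  have m: "(\<lambda>x. f x + g x) \<in> borel_measurable (lebesgue_on \<Omega>)"
    by (intro borel_measurable_add LtwoD(1)[OF assms(1)] LtwoD(1)[OF assms(2)])
  have i: "integrable (lebesgue_on \<Omega>) (\<lambda>x. 2 * (norm (f x))\<^sup>2)" "integrable (lebesgue_on \<Omega>) (\<lambda>x. 2 * (norm (g x))\<^sup>2)"
    using assms unfolding Ltwo_def by simp_all
  have b: "AE x in lebesgue_on \<Omega>. (norm (f x + g x))\<^sup>2 \<le> 2 * (norm (f x))\<^sup>2 + 2 * (norm (g x))\<^sup>2"
    by (intro AE_I2 norm_add_square_le)
  note * = Ltwo_bound[OF m Bochner_Integration.integrable_add[OF i] b]
  show "Ltwo \<Omega> (\<lambda>x. f x + g x)" by (rule *(1))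
  show "(\<integral>x. (norm (f x + g x))\<^sup>2 \<partial>lebesgue_on \<Omega>) \<le> 2 * (\<integral>x. (norm (f x))\<^sup>2 \<partial>lebesgue_on \<Omega>) + 2 * (\<integral>x. (norm (g x))\<^sup>2 \<partial>lebesgue_on \<Omega>)"
    using *(2) Bochner_Integration.integral_add[OF i] by simp
qed

lemma Ltwo_scaleR: "Ltwo \<Omega> f \<Longrightarrow> Ltwo \<Omega> (\<lambda>x. c *\<^sub>R f x)"
  unfolding Ltwo_def by (auto simp: power_mult_distrib)

lemma Ltwo_diff: "Ltwo \<Omega> f \<Longrightarrow> Ltwo \<Omega> g \<Longrightarrow> Ltwo \<Omega> (\<lambda>x. f x - g x)"
  using Ltwo_add(1)[OF _ Ltwo_scaleR[of \<Omega> g "-1"]] by simp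

lemma Ltwo_inner_integrable:
  assumes "Ltwo \<Omega> f" "Ltwo \<Omega> g"
  shows "integrable (lebesgue_on \<Omega>) (\<lambda>x. f x \<bullet> g x)"
proof (rule Bochner_Integration.integrable_bound)
  show "integrable (lebesgue_on \<Omega>) (\<lambda>x. (norm (f x))\<^sup>2 + (norm (g x))\<^sup>2)"
    using assms unfolding Ltwo_def by auto
  show "(\<lambda>x. f x \<bullet> g x) \<in> borel_measurable (lebesgue_on \<Omega>)"
    using assms unfolding Ltwo_def by auto
  have "\<bar>a \<bullet> b\<bar> \<le> (norm a)\<^sup>2 + (norm b)\<^sup>2" for a b :: 'b
  proof -
    have "0 \<le> norm a * norm b" by simp
    then show ?thesis
      using Cauchy_Schwarz_ineq2[of a b] sum_squares_bound[of "norm a" "norm b"] by linarith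
  qed
  then show "AE x in lebesgue_on \<Omega>. norm (f x \<bullet> g x) \<le> norm ((norm (f x))\<^sup>2 + (norm (g x))\<^sup>2)"
    by (intro AE_I2) simp
qed

lemma Ltwo_bounded_scaleR:
  assumes "Ltwo \<Omega> f" "m \<in> borel_measurable (lebesgue_on \<Omega>)" "AE x in lebesgue_on \<Omega>. \<bar>m x\<bar> \<le> c"
  shows "Ltwo \<Omega> (\<lambda>x. m x *\<^sub>R f x)"
    "(\<integral>x. (norm (m x *\<^sub>R f x))\<^sup>2 \<partial>lebesgue_on \<Omega>) \<le> c\<^sup>2 * (\<integral>x. (norm (f x))\<^sup>2 \<partial>lebesgue_on \<Omega>)"
proof -
  have *: "AE x in lebesgue_on \<Omega>. (norm (m x *\<^sub>R f x))\<^sup>2 \<le> c\<^sup>2 * (norm (f x))\<^sup>2"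
    using assms(3) by eventually_elim (auto simp: power_mult_distrib intro!: mult_right_mono abs_le_square_iff[THEN iffD1])
  have m: "(\<lambda>x. m x *\<^sub>R f x) \<in> borel_measurable (lebesgue_on \<Omega>)"
    by (intro borel_measurable_scaleR LtwoD(1)[OF assms(1)] assms(2))
  have i: "integrable (lebesgue_on \<Omega>) (\<lambda>x. c\<^sup>2 * (norm (f x))\<^sup>2)"
    using assms unfolding Ltwo_def by simp
  show "Ltwo \<Omega> (\<lambda>x. m x *\<^sub>R f x)" by (rule Ltwo_bound(1)[OF m i *])
  show "(\<integral>x. (norm (m x *\<^sub>R f x))\<^sup>2 \<partial>lebesgue_on \<Omega>) \<le> c\<^sup>2 * (\<integral>x. (norm (f x))\<^sup>2 \<partial>lebesgue_on \<Omega>)"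
    using Ltwo_bound(2)[OF m i *] by simp
qed

text \<open>
  Measurability may be checked on countably many compact boxes. In particular the chosen weak gradient
  is measurable on all of \<open>\<Omega>\<close>.
\<close>

lemma loc_integrable_borel_measurable:
  fixes f :: "'a::euclidean_space \<Rightarrow> 'b::euclidean_space"
  assumes "open \<Omega>" "loc_integrable \<Omega> f"
  shows "f \<in> borel_measurable (lebesgue_on \<Omega>)"
proof -
  obtain \<D> where \<D>: "countable \<D>" "\<D> \<subseteq> Pow \<Omega>" "\<And>X. X \<in> \<D> \<Longrightarrow> \<exists>a b. X = cbox a b" "\<Union>\<D> = \<Omega>"
    using open_countable_Union_open_cbox[OF assms(1)] by metis
  show ?thesis
  proof (rule measurable_piecewise_restrict[OF \<D>(1)])
    fix X assume X: "X \<in> \<D>"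
    then obtain a b where X': "X = cbox a b" "X \<subseteq> \<Omega>" using \<D> by blast
    show "X \<inter> space (lebesgue_on \<Omega>) \<in> sets (lebesgue_on \<Omega>)"
      using X' assms(1) by (auto simp: sets_restrict_space_iff)
    have "f \<in> borel_measurable (lebesgue_on X)"
      using assms(2) X' unfolding loc_integrable_def by (intro borel_measurable_integrable) auto
    then show "f \<in> borel_measurable (restrict_space (lebesgue_on \<Omega>) X)"
      using X' assms(1) by (simp add: restrict_restrict_space Int_absorb1)
  qed (use \<D> in auto)
qed

section \<open>Integration by parts and translations\<close>

lemma C1_has_derivative_gradient:
  assumes "Ck (Suc 0) f"
  shows "(f has_derivative (\<lambda>h. gradient f x \<bullet> h)) (at x)"
proof -
  have "frechet_derivative f (at x) = (\<lambda>h. gradient f x \<bullet> h)"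
    using assms by (intro ext frechet_derivative_gradient) simp
  then show ?thesis using Ck_Suc_has_derivative[OF assms, of x] by simp
qed

lemma line_has_integral:
  fixes f :: "'a::euclidean_space \<Rightarrow> real"
  assumes "Ck (Suc 0) f"
  shows "((\<lambda>s. gradient f (x + s *\<^sub>R z) \<bullet> z) has_integral f (x + z) - f x) {0..1}"
proof -
  have "((\<lambda>s. f (x + s *\<^sub>R z)) has_vector_derivative gradient f (x + s *\<^sub>R z) \<bullet> z) (at s within {0..1})" for s
  proof -
    have d: "(f has_derivative (\<lambda>h. gradient f (x + s *\<^sub>R z) \<bullet> h)) (at (x + s *\<^sub>R z))"
      by (rule C1_has_derivative_gradient[OF assms])
    have "((\<lambda>s. x + s *\<^sub>R z) has_derivative (\<lambda>t. t *\<^sub>R z)) (at s within {0..1})"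
      by (auto intro!: derivative_eq_intros)
    from has_derivative_compose[OF this d] show ?thesis
      unfolding has_vector_derivative_def by simp
  qed
  from fundamental_theorem_of_calculus[OF _ this] show ?thesis by simp
qed

lemma lborel_integral_translate:
  fixes f :: "'a::euclidean_space \<Rightarrow> real"
  assumes [measurable]: "f \<in> borel_measurable borel"
  shows "integral\<^sup>L lborel (\<lambda>x. f (x + z)) = integral\<^sup>L lborel f"
    and "integrable lborel (\<lambda>x. f (x + z)) \<longleftrightarrow> integrable lborel f"
proof -
  have "integral\<^sup>L lborel f = integral\<^sup>L (distr lborel borel ((+) z)) f"
    by (simp add: lborel_distr_plus)
  also have "\<dots> = integral\<^sup>L lborel (\<lambda>x. f (z + x))"
    by (rule integral_distr) auto
  finally show "integral\<^sup>L lborel (\<lambda>x. f (x + z)) = integral\<^sup>L lborel f" by (simp add: add.commute)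
  have "integrable lborel f \<longleftrightarrow> integrable (distr lborel borel ((+) z)) f"
    by (simp add: lborel_distr_plus)
  also have "\<dots> \<longleftrightarrow> integrable lborel (\<lambda>x. f (z + x))"
    by (rule integrable_distr_eq) auto
  finally show "integrable lborel (\<lambda>x. f (x + z)) \<longleftrightarrow> integrable lborel f" by (simp add: add.commute)
qed

lemma lborel_nn_integral_translate:
  fixes f :: "'a::euclidean_space \<Rightarrow> ennreal"
  assumes "f \<in> borel_measurable borel"
  shows "(\<integral>\<^sup>+x. f (x + z) \<partial>lborel) = (\<integral>\<^sup>+x. f x \<partial>lborel)"
proof -
  have "(\<integral>\<^sup>+x. f x \<partial>lborel) = (\<integral>\<^sup>+x. f x \<partial>distr lborel borel ((+) z))"
    by (simp add: lborel_distr_plus)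
  also have "\<dots> = (\<integral>\<^sup>+x. f (z + x) \<partial>lborel)"
    using assms by (subst nn_integral_distr) auto
  finally show ?thesis by (simp add: add.commute)
qed

text \<open>
  Difference quotients of \<open>f\<close> have integral 0 by translation invariance, and they converge boundedly
  to the directional derivative.
\<close>

lemma integral_gradient_compact_support:
  fixes f :: "'a::euclidean_space \<Rightarrow> real"
  assumes f: "Ck (Suc 0) f" and S: "compact S" "\<And>x. x \<notin> S \<Longrightarrow> f x = 0" "\<And>x. x \<notin> S \<Longrightarrow> gradient f x = 0"
  shows "(\<integral>x. gradient f x \<bullet> b \<partial>lborel) = 0"
proof -
  have cg: "continuous_on UNIV (gradient f)" by (rule continuous_gradient[OF f])
  have cf: "continuous_on UNIV f" using Ck_Suc_D[OF f] by simp
  have [measurable]: "f \<in> borel_measurable borel" by (rule borel_measurable_continuous_onI[OF cf])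
  have [measurable]: "gradient f \<in> borel_measurable borel" by (rule borel_measurable_continuous_onI[OF cg])
  have "bounded (gradient f ` S)"
    by (intro compact_imp_bounded compact_continuous_image continuous_on_subset[OF cg] S) auto
  then obtain L0 where L0: "\<And>x. x \<in> S \<Longrightarrow> norm (gradient f x) \<le> L0" unfolding bounded_iff by auto
  define L where "L = max 0 L0"
  have L: "norm (gradient f x) \<le> L" for x
    using L0[of x] S(3)[of x] by (cases "x \<in> S") (auto simp: L_def)
  have L': "0 \<le> L" unfolding L_def by simp
  obtain R where R: "\<And>x. x \<in> S \<Longrightarrow> norm x \<le> R" using compact_imp_bounded[OF S(1)] unfolding bounded_iff by auto
  define t where "t n = inverse (real (Suc n))" for n
  have t: "0 < t n" "t n \<le> 1" for n by (auto simp: t_def field_simps)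
  define D where "D n x = (f (x + t n *\<^sub>R b) - f x) / t n" for n x
  have tlim: "t \<longlonglongrightarrow> 0" unfolding t_def by (rule LIMSEQ_inverse_real_of_nat)
  have bound: "\<bar>D n x\<bar> \<le> L * norm b * indicator (cball 0 (\<bar>R\<bar> + norm b)) x" for n x
  proof (cases "norm x \<le> \<bar>R\<bar> + norm b")
    case True
    have "norm (f (x + t n *\<^sub>R b) - f x) \<le> (L * (t n * norm b)) * measure lborel (cbox (0::real) 1)"
    proof (rule has_integral_bound)
      show "0 \<le> L * (t n * norm b)" using L' t(1)[of n] by simp
      show "((\<lambda>s. gradient f (x + s *\<^sub>R (t n *\<^sub>R b)) \<bullet> (t n *\<^sub>R b)) has_integral f (x + t n *\<^sub>R b) - f x) (cbox 0 1)"
        using line_has_integral[OF f, of x "t n *\<^sub>R b"] by simp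
      fix s :: real
      have "\<bar>gradient f (x + s *\<^sub>R (t n *\<^sub>R b)) \<bullet> (t n *\<^sub>R b)\<bar> \<le> norm (gradient f (x + s *\<^sub>R (t n *\<^sub>R b))) * norm (t n *\<^sub>R b)"
        by (rule Cauchy_Schwarz_ineq2)
      also have "\<dots> \<le> L * norm (t n *\<^sub>R b)" by (intro mult_right_mono L) simp
      finally show "norm (gradient f (x + s *\<^sub>R (t n *\<^sub>R b)) \<bullet> (t n *\<^sub>R b)) \<le> L * (t n * norm b)"
        using t(1)[of n] by simp
    qed
    then show ?thesis using True t(1)[of n] by (simp add: D_def field_simps)
  next
    case False
    have "norm (t n *\<^sub>R b) \<le> norm b" using t[of n] by (simp add: mult_left_le_one_le)
    moreover have "norm x \<le> norm (x + t n *\<^sub>R b) + norm (t n *\<^sub>R b)"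
      using norm_triangle_ineq4[of "x + t n *\<^sub>R b" "t n *\<^sub>R b"] by simp
    ultimately have "\<not> norm (x + t n *\<^sub>R b) \<le> R" "\<not> norm x \<le> R" using False norm_ge_zero[of b] by linarith+
    then have "x \<notin> S" "x + t n *\<^sub>R b \<notin> S" using R by auto
    then show ?thesis using S(2) False by (simp add: D_def)
  qed
  have int: "integrable lborel f"
    using lborel_lebesgue_on_supported(1)[of S f] S(1,2) loc_integrable_continuous[OF cf, of S]
    unfolding loc_integrable_def by auto
  have "integral\<^sup>L lborel (D n) = 0" for n
    unfolding D_def using int by (simp add: lborel_integral_translate)
  moreover have "(\<lambda>n. integral\<^sup>L lborel (D n)) \<longlonglongrightarrow> (\<integral>x. gradient f x \<bullet> b \<partial>lborel)"
  proof (rule integral_dominated_convergence)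
    show "integrable lborel (\<lambda>x. L * norm b * indicator (cball (0::'a) (\<bar>R\<bar> + norm b)) x)"
      by (intro integrable_mult_right integrable_real_indicator) (use emeasure_lborel_cball_finite[of "0::'a"] in auto)
    show "AE x in lborel. (\<lambda>n. D n x) \<longlonglongrightarrow> gradient f x \<bullet> b"
    proof (rule AE_I2)
      fix x
      have "(f has_derivative (\<lambda>h. gradient f x \<bullet> h)) (at x)"
        by (rule C1_has_derivative_gradient[OF f])
      moreover have "((\<lambda>s. x + s *\<^sub>R b) has_derivative (\<lambda>t. t *\<^sub>R b)) (at 0)"
        by (auto intro!: derivative_eq_intros)
      ultimately have "((\<lambda>s. f (x + s *\<^sub>R b)) has_derivative (\<lambda>s. gradient f x \<bullet> (s *\<^sub>R b))) (at 0)"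
        by (intro has_derivative_compose[of "\<lambda>s. x + s *\<^sub>R b" _ 0 UNIV f]) auto
      then have "((\<lambda>s. f (x + s *\<^sub>R b)) has_real_derivative (gradient f x \<bullet> b)) (at 0)"
        unfolding has_field_derivative_def by (rule has_derivative_eq_rhs) (simp add: fun_eq_iff)
      then have "((\<lambda>h. (f (x + h *\<^sub>R b) - f x) / h) \<longlongrightarrow> gradient f x \<bullet> b) (at 0)"
        by (simp add: DERIV_def)
      moreover have "filterlim t (at 0) sequentially"
        using tlim t(1) by (auto simp: filterlim_at less_imp_neq[symmetric])
      ultimately show "(\<lambda>n. D n x) \<longlonglongrightarrow> gradient f x \<bullet> b"
        unfolding D_def by (rule filterlim_compose)
    qed
    show "AE x in lborel. norm (D n x) \<le> L * norm b * indicator (cball 0 (\<bar>R\<bar> + norm b)) x" for n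
      using bound by simp
    show "D n \<in> borel_measurable lborel" for n unfolding D_def by measurable
    show "(\<lambda>x. gradient f x \<bullet> b) \<in> borel_measurable lborel" by measurable
  qed
  ultimately show ?thesis by (simp add: LIMSEQ_const_iff)
qed

lemma test_fun_has_weak_gradient:
  assumes \<Omega>: "open \<Omega>" and \<phi>: "test_fun \<Omega> \<phi>"
  shows "has_weak_gradient \<Omega> \<phi> (gradient \<phi>)"
  unfolding has_weak_gradient_iff
proof (intro conjI allI impI ballI)
  note c = test_funD(3,4)[OF \<phi>]
  show loc: "loc_integrable \<Omega> \<phi>" "loc_integrable \<Omega> (gradient \<phi>)"
    by (intro loc_integrable_continuous c)+
  fix \<psi> and b :: 'a assume \<psi>: "test_fun \<Omega> \<psi>"
  have \<phi>\<psi>: "test_fun \<Omega> (\<lambda>x. \<phi> x * \<psi> x)" by (rule test_fun_mult[OF \<psi> test_funD(1)[OF \<phi>]])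
  obtain S where S: "compact S" "S \<subseteq> \<Omega>" "\<And>x. x \<notin> S \<Longrightarrow> \<phi> x * \<psi> x = 0" "\<And>x. x \<notin> S \<Longrightarrow> gradient (\<lambda>x. \<phi> x * \<psi> x) x = 0"
    using test_funD(5)[OF \<phi>\<psi>] by blast
  have gr: "gradient (\<lambda>x. \<phi> x * \<psi> x) x = \<phi> x *\<^sub>R gradient \<psi> x + \<psi> x *\<^sub>R gradient \<phi> x" for x
    by (intro gradient_mult test_funD(2)[OF \<phi>] test_funD(2)[OF \<psi>])
  have "(\<lambda>x. gradient (\<lambda>x. \<phi> x * \<psi> x) x \<bullet> b) \<in> borel_measurable borel"
    by (intro borel_measurable_continuous_onI continuous_intros test_funD(4)[OF \<phi>\<psi>])
  then have "(\<integral>x. gradient (\<lambda>x. \<phi> x * \<psi> x) x \<bullet> b \<partial>lebesgue_on \<Omega>) = (\<integral>x. gradient (\<lambda>x. \<phi> x * \<psi> x) x \<bullet> b \<partial>lborel)"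
  proof (intro lborel_lebesgue_on_supported(2))
    fix x assume "x \<notin> \<Omega>"
    then have "x \<notin> S" using S(2) by blast
    then show "gradient (\<lambda>x. \<phi> x * \<psi> x) x \<bullet> b = 0" by (simp add: S(4))
  qed (use \<Omega> in auto)
  also have "\<dots> = 0"
    by (rule integral_gradient_compact_support[OF test_funD(1)[OF \<phi>\<psi>] S(1,3,4)])
  finally have "0 = (\<integral>x. \<phi> x * (gradient \<psi> x \<bullet> b) + (gradient \<phi> x \<bullet> b) * \<psi> x \<partial>lebesgue_on \<Omega>)"
    by (simp add: gr inner_add_left mult.commute)
  also have "\<dots> = (\<integral>x. \<phi> x * (gradient \<psi> x \<bullet> b) \<partial>lebesgue_on \<Omega>) + (\<integral>x. (gradient \<phi> x \<bullet> b) * \<psi> x \<partial>lebesgue_on \<Omega>)"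
    by (intro Bochner_Integration.integral_add integrable_mult_test_fun[OF _ \<Omega> \<psi>] loc loc_integrable_inner_const)
  finally show "(\<integral>x. \<phi> x * (gradient \<psi> x \<bullet> b) \<partial>lebesgue_on \<Omega>) = - (\<integral>x. gradient \<phi> x \<bullet> b * \<psi> x \<partial>lebesgue_on \<Omega>)"
    by simp
qed

text \<open>
  The increment is the mean over the segment of the directional derivative; its square is at most the
  mean of the squares, and each translate of the gradient has the same \<open>L\<^sup>2\<close> norm.
\<close>

lemma translation_estimate_C1:
  fixes f :: "'a::euclidean_space \<Rightarrow> real"
  assumes f: "Ck (Suc 0) f"
  shows "(\<integral>\<^sup>+x. ennreal ((f (x + z) - f x)\<^sup>2) \<partial>lborel) \<le>
    ennreal ((norm z)\<^sup>2) * (\<integral>\<^sup>+x. ennreal ((norm (gradient f x))\<^sup>2) \<partial>lborel)"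
proof -
  have cg: "continuous_on UNIV (gradient f)" by (rule continuous_gradient[OF f])
  have cf: "continuous_on UNIV f" using Ck_Suc_D[OF f] by simp
  have [measurable]: "f \<in> borel_measurable borel" by (rule borel_measurable_continuous_onI[OF cf])
  have [measurable]: "gradient f \<in> borel_measurable borel" by (rule borel_measurable_continuous_onI[OF cg])
  define g where "g x s = gradient f (x + s *\<^sub>R z) \<bullet> z" for x s
  have "ennreal ((f (x + z) - f x)\<^sup>2) \<le> (\<integral>\<^sup>+s. indicator {0..1} s * ennreal ((g x s)\<^sup>2) \<partial>lborel)" for x
  proof -
    define m where "m = f (x + z) - f x"
    have cont: "continuous_on UNIV (g x)"
      unfolding g_def by (intro continuous_intros continuous_on_compose2[OF cg]) auto
    then have [measurable]: "g x \<in> borel_measurable borel" by (rule borel_measurable_continuous_onI)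
    have i1: "(g x has_integral m) {0..1}" unfolding g_def m_def by (rule line_has_integral[OF f])
    obtain I where I: "((\<lambda>s. (g x s)\<^sup>2) has_integral I) {0..1}"
      using integrable_continuous_real[of 0 1 "\<lambda>s. (g x s)\<^sup>2"] continuous_on_subset[OF cont]
      by (auto simp: integrable_on_def intro: continuous_intros)
    have "((\<lambda>s. (g x s)\<^sup>2 - 2 * m * g x s + m\<^sup>2) has_integral (I - 2 * m * m + m\<^sup>2 * (1 - 0))) {0..1}"
      using has_integral_const_real[of "m\<^sup>2" 0 1]
      by (intro has_integral_add has_integral_diff has_integral_mult_right I i1) auto
    then have "0 \<le> I - 2 * m * m + m\<^sup>2 * (1 - 0)"
    proof (rule has_integral_nonneg)
      fix s :: real
      have "(g x s)\<^sup>2 - 2 * m * g x s + m\<^sup>2 = (g x s - m)\<^sup>2" by (simp add: power2_diff)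
      then show "0 \<le> (g x s)\<^sup>2 - 2 * m * g x s + m\<^sup>2" by simp
    qed
    then have "m\<^sup>2 \<le> I" by (simp add: power2_eq_square)
    then have "ennreal (m\<^sup>2) \<le> ennreal I" by (rule ennreal_leI)
    also have "\<dots> = (\<integral>\<^sup>+s. ennreal (indicator {0..1} s * (g x s)\<^sup>2) \<partial>lborel)"
      by (rule nn_integral_has_integral_lebesgue[OF _ I, symmetric]) auto
    also have "\<dots> = (\<integral>\<^sup>+s. indicator {0..1} s * ennreal ((g x s)\<^sup>2) \<partial>lborel)"
      by (intro nn_integral_cong) (auto simp: indicator_def)
    finally show ?thesis unfolding m_def .
  qed
  then have "(\<integral>\<^sup>+x. ennreal ((f (x + z) - f x)\<^sup>2) \<partial>lborel) \<le>
      (\<integral>\<^sup>+x. (\<integral>\<^sup>+s. indicator {0..1} s * ennreal ((g x s)\<^sup>2) \<partial>lborel) \<partial>lborel)"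
    by (intro nn_integral_mono)
  also have "\<dots> = (\<integral>\<^sup>+s. (\<integral>\<^sup>+x. indicator {0..1::real} s * ennreal ((g x s)\<^sup>2) \<partial>lborel) \<partial>lborel)"
    unfolding g_def by (intro lborel_pair.Fubini') measurable
  also have "\<dots> = (\<integral>\<^sup>+s. indicator {0..1::real} s * (\<integral>\<^sup>+x. ennreal ((g x s)\<^sup>2) \<partial>lborel) \<partial>lborel)"
    unfolding g_def by (intro nn_integral_cong nn_integral_cmult) measurable
  also have "\<dots> \<le> (\<integral>\<^sup>+s. (ennreal ((norm z)\<^sup>2) * (\<integral>\<^sup>+x. ennreal ((norm (gradient f x))\<^sup>2) \<partial>lborel)) * indicator {0..1::real} s \<partial>lborel)"
  proof (intro nn_integral_mono)
    fix s :: real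
    have "(\<integral>\<^sup>+x. ennreal ((g x s)\<^sup>2) \<partial>lborel) \<le> (\<integral>\<^sup>+x. ennreal ((norm z)\<^sup>2) * ennreal ((norm (gradient f (x + s *\<^sub>R z)))\<^sup>2) \<partial>lborel)"
    proof (intro nn_integral_mono)
      fix x
      have "\<bar>g x s\<bar> \<le> norm (gradient f (x + s *\<^sub>R z)) * norm z"
        unfolding g_def by (rule Cauchy_Schwarz_ineq2)
      then have "(g x s)\<^sup>2 \<le> (norm z)\<^sup>2 * (norm (gradient f (x + s *\<^sub>R z)))\<^sup>2"
        by (metis abs_ge_zero mult.commute power2_abs power_mono power_mult_distrib)
      then show "ennreal ((g x s)\<^sup>2) \<le> ennreal ((norm z)\<^sup>2) * ennreal ((norm (gradient f (x + s *\<^sub>R z)))\<^sup>2)"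
        by (simp add: ennreal_leI flip: ennreal_mult)
    qed
    also have "\<dots> = ennreal ((norm z)\<^sup>2) * (\<integral>\<^sup>+x. ennreal ((norm (gradient f (x + s *\<^sub>R z)))\<^sup>2) \<partial>lborel)"
      by (intro nn_integral_cmult) measurable
    also have "(\<integral>\<^sup>+x. ennreal ((norm (gradient f (x + s *\<^sub>R z)))\<^sup>2) \<partial>lborel) = (\<integral>\<^sup>+x. ennreal ((norm (gradient f x))\<^sup>2) \<partial>lborel)"
      by (rule lborel_nn_integral_translate) measurable
    finally show "indicator {0..1} s * (\<integral>\<^sup>+x. ennreal ((g x s)\<^sup>2) \<partial>lborel) \<le>
        (ennreal ((norm z)\<^sup>2) * (\<integral>\<^sup>+x. ennreal ((norm (gradient f x))\<^sup>2) \<partial>lborel)) * indicator {0..1} s"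
      by (auto simp: indicator_def)
  qed
  also have "\<dots> = ennreal ((norm z)\<^sup>2) * (\<integral>\<^sup>+x. ennreal ((norm (gradient f x))\<^sup>2) \<partial>lborel)"
    by (subst nn_integral_cmult_indicator) auto
  finally show ?thesis .
qed

section \<open>Sobolev spaces\<close>

lemma H1I:
  assumes "Ltwo \<Omega> u" "has_weak_gradient \<Omega> u g" "Ltwo \<Omega> g"
  shows "u \<in> H1 \<Omega>"
  using assms unfolding H1_def by auto

lemma H1D:
  assumes "open \<Omega>" "u \<in> H1 \<Omega>"
  shows "Ltwo \<Omega> u" "has_weak_gradient \<Omega> u (wgrad \<Omega> u)" "Ltwo \<Omega> (wgrad \<Omega> u)"
proof -
  obtain g where g: "Ltwo \<Omega> u" "has_weak_gradient \<Omega> u g" "Ltwo \<Omega> g" using assms unfolding H1_def by auto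
  show "Ltwo \<Omega> u" by fact
  show h: "has_weak_gradient \<Omega> u (wgrad \<Omega> u)" by (rule wgrad_AE_eq[OF assms(1) g(2)])
  have m: "wgrad \<Omega> u \<in> borel_measurable (lebesgue_on \<Omega>)"
    using h unfolding has_weak_gradient_def by (intro loc_integrable_borel_measurable assms) auto
  have "AE x in lebesgue_on \<Omega>. (norm (wgrad \<Omega> u x))\<^sup>2 \<le> (norm (g x))\<^sup>2"
    using wgrad_AE_eq(2)[OF assms(1) g(2)] by eventually_elim simp
  then show "Ltwo \<Omega> (wgrad \<Omega> u)"
    by (rule Ltwo_bound(1)[OF m, rotated]) (use g in \<open>simp add: Ltwo_def\<close>)
qed

lemma H1_norm_square: "(H1_norm \<Omega> u)\<^sup>2 = (\<integral>x. (u x)\<^sup>2 \<partial>lebesgue_on \<Omega>) + (\<integral>x. (norm (wgrad \<Omega> u x))\<^sup>2 \<partial>lebesgue_on \<Omega>)"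
  unfolding H1_norm_def by (simp add: Ltwo_norm_square)

lemma integral_square_le_H1_norm:
  "(\<integral>x. (u x)\<^sup>2 \<partial>lebesgue_on \<Omega>) \<le> (H1_norm \<Omega> u)\<^sup>2"
  "(\<integral>x. (norm (wgrad \<Omega> u x))\<^sup>2 \<partial>lebesgue_on \<Omega>) \<le> (H1_norm \<Omega> u)\<^sup>2"
  by (simp_all add: H1_norm_square)

lemma H1_diff:
  assumes "open \<Omega>" "u \<in> H1 \<Omega>" "v \<in> H1 \<Omega>"
  shows "(\<lambda>x. u x - v x) \<in> H1 \<Omega>"
    "AE x in lebesgue_on \<Omega>. wgrad \<Omega> (\<lambda>x. u x - v x) x = wgrad \<Omega> u x - wgrad \<Omega> v x"
proof -
  note u = H1D[OF assms(1,2)] and v = H1D[OF assms(1,3)]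
  note wg = has_weak_gradient_diff[OF assms(1) u(2) v(2)]
  show "(\<lambda>x. u x - v x) \<in> H1 \<Omega>"
    by (rule H1I[OF Ltwo_diff[OF u(1) v(1)] wg Ltwo_diff[OF u(3) v(3)]])
  show "AE x in lebesgue_on \<Omega>. wgrad \<Omega> (\<lambda>x. u x - v x) x = wgrad \<Omega> u x - wgrad \<Omega> v x"
    by (rule wgrad_AE_eq(2)[OF assms(1) wg])
qed

lemma test_fun_Ltwo:
  assumes "open \<Omega>" "test_fun \<Omega> \<phi>"
  shows "Ltwo \<Omega> \<phi>" "Ltwo \<Omega> (gradient \<phi>)"
proof -
  obtain S where S: "compact S" "S \<subseteq> \<Omega>" "\<And>x. x \<notin> S \<Longrightarrow> \<phi> x = 0" "\<And>x. x \<notin> S \<Longrightarrow> gradient \<phi> x = 0"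
    using test_funD(5)[OF assms(2)] by blast
  note c = test_funD(3,4)[OF assms(2)]
  have "integrable (lebesgue_on \<Omega>) (\<lambda>x. (norm (\<phi> x))\<^sup>2)"
    by (rule loc_integrable_imp_integrable[OF loc_integrable_continuous assms(1) S(1,2)])
      (auto intro!: continuous_intros c simp: S)
  then show "Ltwo \<Omega> \<phi>"
    unfolding Ltwo_def by (simp add: continuous_UNIV_borel_measurable_lebesgue_on[OF c(1)])
  have "integrable (lebesgue_on \<Omega>) (\<lambda>x. (norm (gradient \<phi> x))\<^sup>2)"
    by (rule loc_integrable_imp_integrable[OF loc_integrable_continuous assms(1) S(1,2)])
      (auto intro!: continuous_intros c simp: S)
  then show "Ltwo \<Omega> (gradient \<phi>)"
    unfolding Ltwo_def by (simp add: continuous_UNIV_borel_measurable_lebesgue_on[OF c(2)])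
qed

lemma test_fun_H1:
  assumes "open \<Omega>" "test_fun \<Omega> \<phi>"
  shows "\<phi> \<in> H1 \<Omega>" "AE x in lebesgue_on \<Omega>. wgrad \<Omega> \<phi> x = gradient \<phi> x"
  using H1I[OF test_fun_Ltwo(1)[OF assms] test_fun_has_weak_gradient[OF assms] test_fun_Ltwo(2)[OF assms]]
    wgrad_AE_eq(2)[OF assms(1) test_fun_has_weak_gradient[OF assms]] by auto

lemma wgrad_scale:
  assumes "open \<Omega>" "u \<in> H1 \<Omega>"
  shows "AE x in lebesgue_on \<Omega>. wgrad \<Omega> (\<lambda>x. c * u x) x = c *\<^sub>R wgrad \<Omega> u x"
  by (rule wgrad_AE_eq(2)[OF assms(1) has_weak_gradient_scale[OF H1D(2)[OF assms]]])

text \<open>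
  Multiplication by a bounded smooth function with bounded gradient is continuous on \<open>H\<^sup>1\<close>.
\<close>

lemma H1_smooth_mult:
  assumes \<Omega>: "open \<Omega>" and u: "u \<in> H1 \<Omega>"
    and \<zeta>: "\<And>k. Ck k \<zeta>" "\<And>x. \<bar>\<zeta> x\<bar> \<le> 1" "\<And>x. norm (gradient \<zeta> x) \<le> L"
  shows "(\<lambda>x. \<zeta> x * u x) \<in> H1 \<Omega>"
    "AE x in lebesgue_on \<Omega>. wgrad \<Omega> (\<lambda>x. \<zeta> x * u x) x = \<zeta> x *\<^sub>R wgrad \<Omega> u x + u x *\<^sub>R gradient \<zeta> x"
    "(H1_norm \<Omega> (\<lambda>x. \<zeta> x * u x))\<^sup>2 \<le> (2 + 2 * L\<^sup>2) * (H1_norm \<Omega> u)\<^sup>2"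
proof -
  let ?M = "lebesgue_on \<Omega>"
  note uD = H1D[OF \<Omega> u]
  have c: "continuous_on UNIV \<zeta>" "continuous_on UNIV (gradient \<zeta>)"
    using \<zeta>(1)[of 0] continuous_gradient[OF \<zeta>(1)] by auto
  note m = continuous_UNIV_borel_measurable_lebesgue_on[OF c(1), of \<Omega>]
    continuous_UNIV_borel_measurable_lebesgue_on[OF c(2), of \<Omega>]
  have le1: "AE x in ?M. \<bar>\<zeta> x\<bar> \<le> 1" by (intro AE_I2 \<zeta>)
  note 1 = Ltwo_bounded_scaleR[OF uD(1) m(1) le1] and 2 = Ltwo_bounded_scaleR[OF uD(3) m(1) le1]
  have L: "0 \<le> L" using \<zeta>(3)[of 0] norm_ge_zero order_trans by blast
  have mm: "(\<lambda>x. u x *\<^sub>R gradient \<zeta> x) \<in> borel_measurable ?M"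
    by (intro borel_measurable_scaleR LtwoD(1)[OF uD(1)] m(2))
  have ii: "integrable ?M (\<lambda>x. L\<^sup>2 * (u x)\<^sup>2)" using uD(1) unfolding Ltwo_def by simp
  have bb: "AE x in ?M. (norm (u x *\<^sub>R gradient \<zeta> x))\<^sup>2 \<le> L\<^sup>2 * (u x)\<^sup>2"
  proof (rule AE_I2)
    fix x
    have "(norm (gradient \<zeta> x))\<^sup>2 \<le> L\<^sup>2" by (intro power_mono \<zeta>) simp
    then have "(u x)\<^sup>2 * (norm (gradient \<zeta> x))\<^sup>2 \<le> (u x)\<^sup>2 * L\<^sup>2" by (intro mult_left_mono) auto
    then show "(norm (u x *\<^sub>R gradient \<zeta> x))\<^sup>2 \<le> L\<^sup>2 * (u x)\<^sup>2"
      by (simp add: power_mult_distrib mult.commute)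
  qed
  note 3 = Ltwo_bound[OF mm ii bb]
  note 4 = Ltwo_add[OF 2(1) 3(1)]
  note wg = has_weak_gradient_smooth_mult[OF \<Omega> uD(2) \<zeta>(1)]
  show "(\<lambda>x. \<zeta> x * u x) \<in> H1 \<Omega>"
    using H1I[OF _ wg 4(1)] 1(1) by simp
  show ae: "AE x in ?M. wgrad \<Omega> (\<lambda>x. \<zeta> x * u x) x = \<zeta> x *\<^sub>R wgrad \<Omega> u x + u x *\<^sub>R gradient \<zeta> x"
    by (rule wgrad_AE_eq(2)[OF \<Omega> wg])
  have "(\<integral>x. (norm (wgrad \<Omega> (\<lambda>x. \<zeta> x * u x) x))\<^sup>2 \<partial>?M) = (\<integral>x. (norm (\<zeta> x *\<^sub>R wgrad \<Omega> u x + u x *\<^sub>R gradient \<zeta> x))\<^sup>2 \<partial>?M)"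
  proof (rule integral_cong_AE)
    show "(\<lambda>x. (norm (wgrad \<Omega> (\<lambda>x. \<zeta> x * u x) x))\<^sup>2) \<in> borel_measurable ?M"
      by (rule borel_measurable_integrable[OF LtwoD(2)[OF H1D(3)[OF \<Omega> \<open>(\<lambda>x. \<zeta> x * u x) \<in> H1 \<Omega>\<close>]]])
    show "(\<lambda>x. (norm (\<zeta> x *\<^sub>R wgrad \<Omega> u x + u x *\<^sub>R gradient \<zeta> x))\<^sup>2) \<in> borel_measurable ?M"
      by (rule borel_measurable_integrable[OF LtwoD(2)[OF 4(1)]])
    show "AE x in ?M. (norm (wgrad \<Omega> (\<lambda>x. \<zeta> x * u x) x))\<^sup>2 = (norm (\<zeta> x *\<^sub>R wgrad \<Omega> u x + u x *\<^sub>R gradient \<zeta> x))\<^sup>2"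
      using ae by eventually_elim simp
  qed
  then have "(H1_norm \<Omega> (\<lambda>x. \<zeta> x * u x))\<^sup>2 \<le> (\<integral>x. (u x)\<^sup>2 \<partial>?M) + (2 * (\<integral>x. (norm (wgrad \<Omega> u x))\<^sup>2 \<partial>?M) + 2 * (L\<^sup>2 * (\<integral>x. (u x)\<^sup>2 \<partial>?M)))"
    using 1(2) 2(2) 3(2) 4(2) unfolding H1_norm_square by (simp add: power_mult_distrib)
  also have "\<dots> \<le> (2 + 2 * L\<^sup>2) * ((\<integral>x. (u x)\<^sup>2 \<partial>?M) + (\<integral>x. (norm (wgrad \<Omega> u x))\<^sup>2 \<partial>?M))"
  proof -
    have "0 \<le> (\<integral>x. (u x)\<^sup>2 \<partial>?M)" "0 \<le> L\<^sup>2 * (\<integral>x. (norm (wgrad \<Omega> u x))\<^sup>2 \<partial>?M)" by simp_all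
    then show ?thesis by (simp add: algebra_simps)
  qed
  finally show "(H1_norm \<Omega> (\<lambda>x. \<zeta> x * u x))\<^sup>2 \<le> (2 + 2 * L\<^sup>2) * (H1_norm \<Omega> u)\<^sup>2"
    unfolding H1_norm_square .
qed

text \<open>
  If \<open>\<phi>\<close> approximates \<open>u\<close>, then \<open>\<zeta> \<phi>\<close> approximates \<open>\<zeta> u\<close>. This makes cutoff multiples of a solution
  admissible in the weak equation.
\<close>

lemma H10_smooth_mult:
  assumes \<Omega>: "open \<Omega>" and u: "u \<in> H10 \<Omega>"
    and \<zeta>: "\<And>k. Ck k \<zeta>" "\<And>x. \<bar>\<zeta> x\<bar> \<le> 1" "\<And>x. norm (gradient \<zeta> x) \<le> L"
  shows "(\<lambda>x. \<zeta> x * u x) \<in> H10 \<Omega>"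
  unfolding H10_def
proof (intro CollectI conjI allI impI)
  have uH: "u \<in> H1 \<Omega>" using u unfolding H10_def by simp
  show "(\<lambda>x. \<zeta> x * u x) \<in> H1 \<Omega>" by (rule H1_smooth_mult(1)[OF \<Omega> uH \<zeta>])
  fix e :: real assume e: "0 < e"
  define C where "C = sqrt (2 + 2 * L\<^sup>2)"
  have C: "0 < C" "C\<^sup>2 = 2 + 2 * L\<^sup>2" unfolding C_def by (auto intro: add_pos_nonneg)
  obtain \<phi> where \<phi>: "test_fun \<Omega> \<phi>" "H1_norm \<Omega> (\<lambda>x. u x - \<phi> x) < e / C"
    using u e C unfolding H10_def by (auto dest!: spec[of _ "e / C"])
  have "(H1_norm \<Omega> (\<lambda>x. \<zeta> x * (u x - \<phi> x)))\<^sup>2 \<le> (C * H1_norm \<Omega> (\<lambda>x. u x - \<phi> x))\<^sup>2"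
    using H1_smooth_mult(3)[OF \<Omega> H1_diff(1)[OF \<Omega> uH test_fun_H1(1)[OF \<Omega> \<phi>(1)]] \<zeta>]
    by (simp add: power_mult_distrib C(2))
  then have "H1_norm \<Omega> (\<lambda>x. \<zeta> x * (u x - \<phi> x)) \<le> C * H1_norm \<Omega> (\<lambda>x. u x - \<phi> x)"
    by (rule power2_le_imp_le) (use C in \<open>simp add: H1_norm_def\<close>)
  also have "\<dots> < e" using \<phi>(2) C(1) by (simp add: field_simps)
  finally have "H1_norm \<Omega> (\<lambda>x. \<zeta> x * u x - \<zeta> x * \<phi> x) < e" by (simp add: right_diff_distrib)
  then show "\<exists>\<phi>. test_fun \<Omega> \<phi> \<and> H1_norm \<Omega> (\<lambda>x. \<zeta> x * u x - \<phi> x) < e"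
    using test_fun_mult[OF \<phi>(1) \<zeta>(1)] by blast
qed

section \<open>The subcritical Sobolev embedding\<close>

lemma nn_integral_lborel_eq_lebesgue_on:
  fixes v :: "'a::euclidean_space \<Rightarrow> real"
  assumes \<Omega>: "\<Omega> \<in> sets lebesgue" and v: "integrable (lebesgue_on \<Omega>) v" "\<And>x. 0 \<le> v x"
    and h: "AE x in lborel. h x = (if x \<in> \<Omega> then v x else 0)"
  shows "(\<integral>\<^sup>+x. ennreal (h x) \<partial>lborel) = ennreal (integral\<^sup>L (lebesgue_on \<Omega>) v)"
proof -
  have "(\<integral>\<^sup>+x. ennreal (h x) \<partial>lborel) = (\<integral>\<^sup>+x. ennreal (if x \<in> \<Omega> then v x else 0) \<partial>lborel)"
    using h by (intro nn_integral_cong_AE) auto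
  also have "\<dots> = (\<integral>\<^sup>+x. ennreal (if x \<in> \<Omega> then v x else 0) \<partial>lebesgue)"
    by (simp add: nn_integral_completion)
  also have "\<dots> = ennreal (\<integral>x. (if x \<in> \<Omega> then v x else 0) \<partial>lebesgue)"
    using v \<Omega> by (intro nn_integral_eq_integral) (auto simp: Lebesgue_Measure.integrable_restrict_UNIV)
  also have "(\<integral>x. (if x \<in> \<Omega> then v x else 0) \<partial>lebesgue) = integral\<^sup>L (lebesgue_on \<Omega>) v"
    using \<Omega> by (rule Lebesgue_Measure.integral_restrict_UNIV)
  finally show ?thesis .
qed

lemma three_square_bound: "(a + b + c)\<^sup>2 \<le> 3 * a\<^sup>2 + 3 * b\<^sup>2 + 3 * (c::real)\<^sup>2"
proof -
  have "0 \<le> (a - b)\<^sup>2 + (b - c)\<^sup>2 + (a - c)\<^sup>2" by simp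
  then show ?thesis by (simp add: power2_eq_square algebra_simps)
qed

text \<open>
  For test functions this is the estimate by the gradient. For \<open>u\<close> in \<open>H\<^sub>0\<^sup>1\<close>, compare the extension by
  zero with a test function at distance \<open>e\<close> and let \<open>e\<close> tend to 0; the factor 6 pays for splitting
  the squares. The Borel representative \<open>U\<close> permits the exchange of integrals on the product space.
\<close>

lemma H10_translation_estimate:
  fixes u :: "'a::euclidean_space \<Rightarrow> real"
  assumes \<Omega>: "open \<Omega>" and u: "u \<in> H10 \<Omega>"
    and U[measurable]: "U \<in> borel_measurable borel" and Uu: "AE x in lborel. U x = (if x \<in> \<Omega> then u x else 0)"
  shows "(\<integral>\<^sup>+x. ennreal ((U (x + z) - U x)\<^sup>2) \<partial>lborel) \<le> ennreal (6 * (norm z)\<^sup>2 * (H1_norm \<Omega> u)\<^sup>2)"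
proof (rule ennreal_le_epsilon)
  fix \<eta> :: real assume \<eta>: "0 < \<eta>"
  let ?M = "lebesgue_on \<Omega>"
  \<comment> \<open>Makes the total error in the final estimate equal to \<open>\<eta>\<close>.\<close>
  define e where "e = sqrt (\<eta> / (6 + 6 * (norm z)\<^sup>2))"
  have den: "0 < 6 + 6 * (norm z)\<^sup>2" by (intro add_pos_nonneg) auto
  have e: "0 < e" "e\<^sup>2 * (6 + 6 * (norm z)\<^sup>2) = \<eta>" unfolding e_def using \<eta> den by auto
  have uH: "u \<in> H1 \<Omega>" using u unfolding H10_def by simp
  obtain \<phi> where \<phi>: "test_fun \<Omega> \<phi>" "H1_norm \<Omega> (\<lambda>x. u x - \<phi> x) < e"
    using u e(1) unfolding H10_def by auto
  note \<phi>H = test_fun_H1[OF \<Omega> \<phi>(1)] and d = H1_diff[OF \<Omega> uH test_fun_H1(1)[OF \<Omega> \<phi>(1)]]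
  note dD = H1D[OF \<Omega> d(1)] and uD = H1D[OF \<Omega> uH]
  have [measurable]: "\<phi> \<in> borel_measurable borel" "gradient \<phi> \<in> borel_measurable borel"
    by (intro borel_measurable_continuous_onI test_funD(3,4)[OF \<phi>(1)])+
  have He: "(H1_norm \<Omega> (\<lambda>x. u x - \<phi> x))\<^sup>2 \<le> e\<^sup>2"
    using \<phi>(2) by (intro power_mono) (auto simp: H1_norm_def)
  obtain S where S: "S \<subseteq> \<Omega>" "\<And>x. x \<notin> S \<Longrightarrow> \<phi> x = 0" "\<And>x. x \<notin> S \<Longrightarrow> gradient \<phi> x = 0"
    using test_funD(5)[OF \<phi>(1)] by blast
  have out: "\<phi> x = 0" "gradient \<phi> x = 0" if "x \<notin> \<Omega>" for x using that S by blast+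
  have "(\<integral>\<^sup>+x. ennreal ((U x - \<phi> x)\<^sup>2) \<partial>lborel) = ennreal (\<integral>x. (u x - \<phi> x)\<^sup>2 \<partial>?M)"
  proof (rule nn_integral_lborel_eq_lebesgue_on)
    show "integrable ?M (\<lambda>x. (u x - \<phi> x)\<^sup>2)" using LtwoD(2)[OF dD(1)] by simp
    show "AE x in lborel. (U x - \<phi> x)\<^sup>2 = (if x \<in> \<Omega> then (u x - \<phi> x)\<^sup>2 else 0)"
      using Uu by eventually_elim (auto simp: out)
  qed (use \<Omega> in auto)
  also have "\<dots> \<le> ennreal (e\<^sup>2)"
    using integral_square_le_H1_norm(1)[where u = "\<lambda>x. u x - \<phi> x" and \<Omega> = \<Omega>] He by (intro ennreal_leI) linarith
  finally have d1: "(\<integral>\<^sup>+x. ennreal ((U x - \<phi> x)\<^sup>2) \<partial>lborel) \<le> ennreal (e\<^sup>2)" .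
  have d2: "(\<integral>\<^sup>+x. ennreal ((U (x + z) - \<phi> (x + z))\<^sup>2) \<partial>lborel) \<le> ennreal (e\<^sup>2)"
    using d1 by (subst lborel_nn_integral_translate[where f = "\<lambda>x. ennreal ((U x - \<phi> x)\<^sup>2)"]) auto
  have g: "(\<integral>x. (norm (gradient \<phi> x))\<^sup>2 \<partial>?M) \<le> 2 * (H1_norm \<Omega> u)\<^sup>2 + 2 * e\<^sup>2"
  proof -
    have wd: "Ltwo \<Omega> (\<lambda>x. - wgrad \<Omega> (\<lambda>x. u x - \<phi> x) x)" using Ltwo_scaleR[OF dD(3), of "-1"] by simp
    note s = Ltwo_add[OF uD(3) wd]
    have "(\<integral>x. (norm (gradient \<phi> x))\<^sup>2 \<partial>?M) = (\<integral>x. (norm (wgrad \<Omega> u x + - wgrad \<Omega> (\<lambda>x. u x - \<phi> x) x))\<^sup>2 \<partial>?M)"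
    proof (rule integral_cong_AE)
      show "AE x in ?M. (norm (gradient \<phi> x))\<^sup>2 = (norm (wgrad \<Omega> u x + - wgrad \<Omega> (\<lambda>x. u x - \<phi> x) x))\<^sup>2"
        using \<phi>H(2) d(2) by eventually_elim simp
    qed (use LtwoD(2)[OF test_fun_Ltwo(2)[OF \<Omega> \<phi>(1)]] LtwoD(2)[OF s(1)] in auto)
    also have "\<dots> \<le> 2 * (\<integral>x. (norm (wgrad \<Omega> u x))\<^sup>2 \<partial>?M) + 2 * (\<integral>x. (norm (wgrad \<Omega> (\<lambda>x. u x - \<phi> x) x))\<^sup>2 \<partial>?M)"
      using s(2) by simp
    also have "\<dots> \<le> 2 * (H1_norm \<Omega> u)\<^sup>2 + 2 * e\<^sup>2"
      using integral_square_le_H1_norm(2)[where u = "\<lambda>x. u x - \<phi> x" and \<Omega> = \<Omega>] He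
        integral_square_le_H1_norm(2)[of \<Omega> u] by linarith
    finally show ?thesis .
  qed
  have "(\<integral>\<^sup>+x. ennreal ((norm (gradient \<phi> x))\<^sup>2) \<partial>lborel) = ennreal (\<integral>x. (norm (gradient \<phi> x))\<^sup>2 \<partial>?M)"
    by (rule nn_integral_lborel_eq_lebesgue_on)
      (use \<Omega> LtwoD(2)[OF test_fun_Ltwo(2)[OF \<Omega> \<phi>(1)]] in \<open>auto simp: out\<close>)
  also have "\<dots> \<le> ennreal (2 * (H1_norm \<Omega> u)\<^sup>2 + 2 * e\<^sup>2)"
    by (intro ennreal_leI g)
  finally have "ennreal ((norm z)\<^sup>2) * (\<integral>\<^sup>+x. ennreal ((norm (gradient \<phi> x))\<^sup>2) \<partial>lborel) \<le>
      ennreal ((norm z)\<^sup>2) * ennreal (2 * (H1_norm \<Omega> u)\<^sup>2 + 2 * e\<^sup>2)"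
    by (rule mult_left_mono) simp
  also have "\<dots> = ennreal ((norm z)\<^sup>2 * (2 * (H1_norm \<Omega> u)\<^sup>2 + 2 * e\<^sup>2))"
    by (intro ennreal_mult[symmetric]) auto
  finally have d3: "(\<integral>\<^sup>+x. ennreal ((\<phi> (x + z) - \<phi> x)\<^sup>2) \<partial>lborel) \<le> ennreal ((norm z)\<^sup>2 * (2 * (H1_norm \<Omega> u)\<^sup>2 + 2 * e\<^sup>2))"
    using translation_estimate_C1[OF test_funD(1)[OF \<phi>(1)], of z] by (rule order_trans[rotated])
  have "(\<integral>\<^sup>+x. ennreal ((U (x + z) - U x)\<^sup>2) \<partial>lborel) \<le>
      (\<integral>\<^sup>+x. ennreal 3 * ennreal ((U (x + z) - \<phi> (x + z))\<^sup>2) + (ennreal 3 * ennreal ((U x - \<phi> x)\<^sup>2) + ennreal 3 * ennreal ((\<phi> (x + z) - \<phi> x)\<^sup>2)) \<partial>lborel)"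
  proof (intro nn_integral_mono)
    fix x
    have "(U (x + z) - U x)\<^sup>2 \<le> 3 * (U (x + z) - \<phi> (x + z))\<^sup>2 + 3 * (\<phi> x - U x)\<^sup>2 + 3 * (\<phi> (x + z) - \<phi> x)\<^sup>2"
      using three_square_bound[of "U (x + z) - \<phi> (x + z)" "\<phi> x - U x" "\<phi> (x + z) - \<phi> x"] by simp
    then have "(U (x + z) - U x)\<^sup>2 \<le> 3 * (U (x + z) - \<phi> (x + z))\<^sup>2 + (3 * (U x - \<phi> x)\<^sup>2 + 3 * (\<phi> (x + z) - \<phi> x)\<^sup>2)"
      by (simp add: power2_commute)
    then show "ennreal ((U (x + z) - U x)\<^sup>2) \<le> ennreal 3 * ennreal ((U (x + z) - \<phi> (x + z))\<^sup>2) + (ennreal 3 * ennreal ((U x - \<phi> x)\<^sup>2) + ennreal 3 * ennreal ((\<phi> (x + z) - \<phi> x)\<^sup>2))"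
      by (simp only: ennreal_mult[symmetric] ennreal_plus[symmetric] zero_le_power2 mult_nonneg_nonneg add_nonneg_nonneg zero_le_numeral ennreal_leI)
  qed
  also have "\<dots> = ennreal 3 * (\<integral>\<^sup>+x. ennreal ((U (x + z) - \<phi> (x + z))\<^sup>2) \<partial>lborel) +
      (ennreal 3 * (\<integral>\<^sup>+x. ennreal ((U x - \<phi> x)\<^sup>2) \<partial>lborel) + ennreal 3 * (\<integral>\<^sup>+x. ennreal ((\<phi> (x + z) - \<phi> x)\<^sup>2) \<partial>lborel))"
    by (subst nn_integral_add, measurable, subst nn_integral_add, measurable) (simp add: nn_integral_cmult)
  also have "\<dots> \<le> ennreal 3 * ennreal (e\<^sup>2) + (ennreal 3 * ennreal (e\<^sup>2) + ennreal 3 * ennreal ((norm z)\<^sup>2 * (2 * (H1_norm \<Omega> u)\<^sup>2 + 2 * e\<^sup>2)))"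
    by (intro add_mono mult_left_mono d1 d2 d3) auto
  also have "\<dots> = ennreal (3 * e\<^sup>2 + (3 * e\<^sup>2 + 3 * ((norm z)\<^sup>2 * (2 * (H1_norm \<Omega> u)\<^sup>2 + 2 * e\<^sup>2))))"
    by (simp only: ennreal_mult[symmetric] ennreal_plus[symmetric] zero_le_power2 mult_nonneg_nonneg add_nonneg_nonneg zero_le_numeral)
  also have "3 * e\<^sup>2 + (3 * e\<^sup>2 + 3 * ((norm z)\<^sup>2 * (2 * (H1_norm \<Omega> u)\<^sup>2 + 2 * e\<^sup>2))) =
      6 * (norm z)\<^sup>2 * (H1_norm \<Omega> u)\<^sup>2 + e\<^sup>2 * (6 + 6 * (norm z)\<^sup>2)"
    by (simp add: algebra_simps)
  also have "ennreal (6 * (norm z)\<^sup>2 * (H1_norm \<Omega> u)\<^sup>2 + e\<^sup>2 * (6 + 6 * (norm z)\<^sup>2)) = ennreal (6 * (norm z)\<^sup>2 * (H1_norm \<Omega> u)\<^sup>2) + ennreal \<eta>"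
    unfolding e(2) using \<eta> by (intro ennreal_plus) auto
  finally show "(\<integral>\<^sup>+x. ennreal ((U (x + z) - U x)\<^sup>2) \<partial>lborel) \<le> ennreal (6 * (norm z)\<^sup>2 * (H1_norm \<Omega> u)\<^sup>2) + ennreal \<eta>" .
qed

text \<open>
  The scale is any positive \<open>\<kappa>\<close> above the norm, rather than the norm itself, so that no division by a
  vanishing norm occurs; 3 works because \<open>3\<^sup>2 \<ge> 6\<close>.
\<close>

lemma H10_unit_translation_bound:
  fixes u :: "'a::euclidean_space \<Rightarrow> real"
  assumes \<Omega>: "open \<Omega>" and u: "u \<in> H10 \<Omega>" and \<kappa>: "0 < \<kappa>" "H1_norm \<Omega> u \<le> \<kappa>"
  obtains U where "unit_translation_bound U" "AE x in lborel. 3 * \<kappa> * U x = (if x \<in> \<Omega> then u x else 0)"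
proof -
  have uH: "u \<in> H1 \<Omega>" using u unfolding H10_def by simp
  note uD = H1D[OF \<Omega> uH]
  have "(\<lambda>x. if x \<in> \<Omega> then u x else 0) \<in> borel_measurable lebesgue"
    using LtwoD(1)[OF uD(1)] \<Omega> by (subst borel_measurable_if) auto
  then obtain W where W[measurable]: "W \<in> borel_measurable lborel" and Wu: "AE x in lborel. (if x \<in> \<Omega> then u x else 0) = W x"
    using completion_ex_borel_measurable_real by blast
  define c where "c = 1 / (3 * \<kappa>)"
  have c: "0 < c" "c\<^sup>2 * (9 * \<kappa>\<^sup>2) = 1" unfolding c_def using \<kappa>(1) by (auto simp: power2_eq_square)
  have Wb[measurable]: "W \<in> borel_measurable borel" using W by simp
  have Wu': "AE x in lborel. W x = (if x \<in> \<Omega> then u x else 0)" using Wu by eventually_elim simp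
  have H\<kappa>: "(H1_norm \<Omega> u)\<^sup>2 \<le> \<kappa>\<^sup>2" using \<kappa> by (intro power_mono) (auto simp: H1_norm_def)
  show ?thesis
  proof (rule that[of "\<lambda>x. c * W x"])
    show "AE x in lborel. 3 * \<kappa> * (c * W x) = (if x \<in> \<Omega> then u x else 0)"
      using Wu' by eventually_elim (use \<kappa>(1) in \<open>simp add: c_def\<close>)
    show "unit_translation_bound (\<lambda>x. c * W x)"
      unfolding unit_translation_bound_def
    proof (intro conjI allI)
      show "(\<lambda>x. c * W x) \<in> borel_measurable borel" by measurable
      have "(\<integral>\<^sup>+x. ennreal ((c * W x)\<^sup>2) \<partial>lborel) = (\<integral>\<^sup>+x. ennreal (c\<^sup>2) * ennreal ((W x)\<^sup>2) \<partial>lborel)"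
        by (intro nn_integral_cong) (simp add: power_mult_distrib ennreal_mult)
      also have "\<dots> = ennreal (c\<^sup>2) * (\<integral>\<^sup>+x. ennreal ((W x)\<^sup>2) \<partial>lborel)"
        by (rule nn_integral_cmult) measurable
      also have "(\<integral>\<^sup>+x. ennreal ((W x)\<^sup>2) \<partial>lborel) = ennreal (\<integral>x. (u x)\<^sup>2 \<partial>lebesgue_on \<Omega>)"
      proof (rule nn_integral_lborel_eq_lebesgue_on)
        show "AE x in lborel. (W x)\<^sup>2 = (if x \<in> \<Omega> then (u x)\<^sup>2 else 0)" using Wu' by eventually_elim auto
      qed (use \<Omega> LtwoD(2)[OF uD(1)] in auto)
      also have "ennreal (c\<^sup>2) * \<dots> = ennreal (c\<^sup>2 * (\<integral>x. (u x)\<^sup>2 \<partial>lebesgue_on \<Omega>))"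
        by (intro ennreal_mult[symmetric]) auto
      also have "\<dots> \<le> ennreal (c\<^sup>2 * (9 * \<kappa>\<^sup>2))"
        using integral_square_le_H1_norm(1)[where u = u and \<Omega> = \<Omega>] H\<kappa> zero_le_power2[of \<kappa>]
        by (intro ennreal_leI mult_left_mono) (linarith, simp)
      finally show "(\<integral>\<^sup>+x. ennreal ((c * W x)\<^sup>2) \<partial>lborel) \<le> 1" using c(2) by simp
      fix z :: 'a
      have "(\<integral>\<^sup>+x. ennreal ((c * W (x + z) - c * W x)\<^sup>2) \<partial>lborel) = (\<integral>\<^sup>+x. ennreal (c\<^sup>2) * ennreal ((W (x + z) - W x)\<^sup>2) \<partial>lborel)"
        by (intro nn_integral_cong) (simp add: power_mult_distrib flip: ennreal_mult right_diff_distrib)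
      also have "\<dots> = ennreal (c\<^sup>2) * (\<integral>\<^sup>+x. ennreal ((W (x + z) - W x)\<^sup>2) \<partial>lborel)"
        by (rule nn_integral_cmult) measurable
      also have "\<dots> \<le> ennreal (c\<^sup>2) * ennreal (6 * (norm z)\<^sup>2 * (H1_norm \<Omega> u)\<^sup>2)"
        by (intro mult_left_mono H10_translation_estimate[OF \<Omega> u Wb Wu']) simp
      also have "\<dots> = ennreal (c\<^sup>2 * (6 * (norm z)\<^sup>2 * (H1_norm \<Omega> u)\<^sup>2))"
        by (intro ennreal_mult[symmetric]) auto
      also have "\<dots> \<le> ennreal (c\<^sup>2 * (9 * (norm z)\<^sup>2 * \<kappa>\<^sup>2))"
        using H\<kappa> by (intro ennreal_leI mult_left_mono mult_mono) auto
      also have "c\<^sup>2 * (9 * (norm z)\<^sup>2 * \<kappa>\<^sup>2) = (c\<^sup>2 * (9 * \<kappa>\<^sup>2)) * (norm z)\<^sup>2" by simp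
      finally show "(\<integral>\<^sup>+x. ennreal ((c * W (x + z) - c * W x)\<^sup>2) \<partial>lborel) \<le> ennreal ((norm z)\<^sup>2)"
        using c(2) by simp
    qed
  qed
qed

text \<open>
  Transfers bounds for the normalised functions on the whole space back to \<open>H\<^sub>0\<^sup>1(\<Omega>)\<close> by homogeneity.
\<close>

lemma H10_weighted_powr_bound:
  fixes u :: "'a::euclidean_space \<Rightarrow> real" and r C :: real
  assumes \<Omega>: "open \<Omega>" and u: "u \<in> H10 \<Omega>" and \<kappa>: "0 < \<kappa>" "H1_norm \<Omega> u \<le> \<kappa>"
    and T: "T \<in> sets borel" and C: "0 \<le> C"
    and bound: "\<And>U. unit_translation_bound (U :: 'a \<Rightarrow> real) \<Longrightarrow>
      (\<integral>\<^sup>+x. ennreal (\<bar>U x\<bar> powr r) * indicator T x \<partial>lborel) \<le> ennreal C"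
  shows "integrable (lebesgue_on \<Omega>) (\<lambda>x. indicator T x * \<bar>u x\<bar> powr r)"
    "(\<integral>x. indicator T x * \<bar>u x\<bar> powr r \<partial>lebesgue_on \<Omega>) \<le> C * (3 * \<kappa>) powr r"
proof -
  let ?M = "lebesgue_on \<Omega>"
  obtain U where U: "unit_translation_bound U" and Uu: "AE x in lborel. 3 * \<kappa> * U x = (if x \<in> \<Omega> then u x else 0)"
    using H10_unit_translation_bound[OF \<Omega> u \<kappa>] by blast
  have [measurable]: "U \<in> borel_measurable borel" using U unfolding unit_translation_bound_def by simp
  note [measurable] = T
  have um: "u \<in> borel_measurable ?M" using u H1D(1)[OF \<Omega>] LtwoD(1) unfolding H10_def by blast
  have m: "(\<lambda>x. indicator T x * \<bar>u x\<bar> powr r) \<in> borel_measurable ?M"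
    using um by (intro borel_measurable_times borel_measurable_lebesgue_onI[of "indicator T"]) auto
  have Uu': "AE x in lebesgue. 3 * \<kappa> * U x = (if x \<in> \<Omega> then u x else 0)"
    using Uu by (rule AE_completion)
  have "(\<integral>\<^sup>+x. ennreal (indicator T x * \<bar>u x\<bar> powr r) \<partial>?M) =
      (\<integral>\<^sup>+x. ennreal (indicator T x * \<bar>u x\<bar> powr r) * indicator \<Omega> x \<partial>lebesgue)"
    using \<Omega> by (intro nn_integral_restrict_space) auto
  also have "\<dots> \<le> (\<integral>\<^sup>+x. ennreal ((3 * \<kappa>) powr r) * (ennreal (\<bar>U x\<bar> powr r) * indicator T x) \<partial>lebesgue)"
  proof (rule nn_integral_mono_AE)
    show "AE x in lebesgue. ennreal (indicator T x * \<bar>u x\<bar> powr r) * indicator \<Omega> x \<le>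
        ennreal ((3 * \<kappa>) powr r) * (ennreal (\<bar>U x\<bar> powr r) * indicator T x)"
      using Uu'
    proof eventually_elim
      fix x assume x: "3 * \<kappa> * U x = (if x \<in> \<Omega> then u x else 0)"
      show "ennreal (indicator T x * \<bar>u x\<bar> powr r) * indicator \<Omega> x \<le>
        ennreal ((3 * \<kappa>) powr r) * (ennreal (\<bar>U x\<bar> powr r) * indicator T x)"
      proof (cases "x \<in> \<Omega> \<and> x \<in> T")
        case True
        then have "u x = 3 * \<kappa> * U x" using x by simp
        then have "\<bar>u x\<bar> = 3 * \<kappa> * \<bar>U x\<bar>" using \<kappa>(1) by (simp add: abs_mult)
        then have "\<bar>u x\<bar> powr r = (3 * \<kappa>) powr r * \<bar>U x\<bar> powr r" using \<kappa>(1) by (simp add: powr_mult)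
        then show ?thesis using True by (simp add: ennreal_mult)
      qed auto
    qed
  qed
  also have "\<dots> = (\<integral>\<^sup>+x. ennreal ((3 * \<kappa>) powr r) * (ennreal (\<bar>U x\<bar> powr r) * indicator T x) \<partial>lborel)"
    by (simp add: nn_integral_completion)
  also have "\<dots> = ennreal ((3 * \<kappa>) powr r) * (\<integral>\<^sup>+x. ennreal (\<bar>U x\<bar> powr r) * indicator T x \<partial>lborel)"
    by (rule nn_integral_cmult) measurable
  also have "\<dots> \<le> ennreal ((3 * \<kappa>) powr r) * ennreal C"
    by (intro mult_left_mono bound U) simp
  also have "\<dots> = ennreal (C * (3 * \<kappa>) powr r)"
    using C by (simp add: ennreal_mult mult.commute)
  finally have fin: "(\<integral>\<^sup>+x. ennreal (indicator T x * \<bar>u x\<bar> powr r) \<partial>?M) \<le> ennreal (C * (3 * \<kappa>) powr r)" .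
  show int: "integrable ?M (\<lambda>x. indicator T x * \<bar>u x\<bar> powr r)"
    using m fin by (intro integrableI_bounded) (auto simp: abs_mult less_top[symmetric] top_unique)
  have "ennreal (\<integral>x. indicator T x * \<bar>u x\<bar> powr r \<partial>?M) \<le> ennreal (C * (3 * \<kappa>) powr r)"
    using fin by (subst nn_integral_eq_integral[OF int, symmetric]) auto
  then show "(\<integral>x. indicator T x * \<bar>u x\<bar> powr r \<partial>?M) \<le> C * (3 * \<kappa>) powr r"
    using C by (subst (asm) ennreal_le_iff) auto
qed

text \<open>
  The subcritical Sobolev embedding.
\<close>

lemma H10_powr_bound:
  assumes r: "2 \<le> r" "ereal r < critical_exponent DIM('a::euclidean_space)"
  obtains C where "0 \<le> C" "\<And>\<Omega> (u :: 'a \<Rightarrow> real) \<kappa>. \<lbrakk>open \<Omega>; u \<in> H10 \<Omega>; 0 < \<kappa>; H1_norm \<Omega> u \<le> \<kappa>\<rbrakk> \<Longrightarrow>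
      integrable (lebesgue_on \<Omega>) (\<lambda>x. \<bar>u x\<bar> powr r) \<and> (\<integral>x. \<bar>u x\<bar> powr r \<partial>lebesgue_on \<Omega>) \<le> C * \<kappa> powr r"
proof -
  obtain C0 where C0: "\<And>U. unit_translation_bound (U :: 'a \<Rightarrow> real) \<Longrightarrow> (\<integral>\<^sup>+x. ennreal (\<bar>U x\<bar> powr r) \<partial>lborel) \<le> ennreal C0"
    using unit_translation_bound_powr_bounded[OF r(1) subcritical_exponent_condition[OF r DIM_positive]] by blast
  define C where "C = max 0 C0"
  have C: "0 \<le> C" "\<And>U. unit_translation_bound (U :: 'a \<Rightarrow> real) \<Longrightarrow> (\<integral>\<^sup>+x. ennreal (\<bar>U x\<bar> powr r) * indicator UNIV x \<partial>lborel) \<le> ennreal C"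
    unfolding C_def by (auto intro!: order_trans[OF C0 ennreal_leI])
  show ?thesis
  proof (rule that[of "C * 3 powr r"])
    fix \<Omega> :: "'a set" and u :: "'a \<Rightarrow> real" and \<kappa> :: real
    assume A: "open \<Omega>" "u \<in> H10 \<Omega>" "0 < \<kappa>" "H1_norm \<Omega> u \<le> \<kappa>"
    show "integrable (lebesgue_on \<Omega>) (\<lambda>x. \<bar>u x\<bar> powr r) \<and> (\<integral>x. \<bar>u x\<bar> powr r \<partial>lebesgue_on \<Omega>) \<le> C * 3 powr r * \<kappa> powr r"
      using H10_weighted_powr_bound[OF A _ C] A(3) by (simp add: powr_mult mult.assoc)
  qed (use C in simp)
qed

text \<open>
  The embedding constant becomes arbitrarily small on small balls, uniformly over all domains.
\<close>

lemma H10_powr_small_ball: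
  assumes r: "2 \<le> r" "ereal r < critical_exponent DIM('a::euclidean_space)" and \<eta>: "0 < (\<eta>::real)"
  obtains \<epsilon> where "0 < \<epsilon>" "\<And>\<Omega> (u :: 'a \<Rightarrow> real) \<kappa>. \<lbrakk>open \<Omega>; u \<in> H10 \<Omega>; 0 < \<kappa>; H1_norm \<Omega> u \<le> \<kappa>\<rbrakk> \<Longrightarrow>
      (\<integral>x. indicator (ball 0 \<epsilon>) x * \<bar>u x\<bar> powr r \<partial>lebesgue_on \<Omega>) \<le> \<eta> * \<kappa> powr r"
proof -
  obtain \<epsilon> where \<epsilon>: "0 < \<epsilon>" "\<And>U. unit_translation_bound (U :: 'a \<Rightarrow> real) \<Longrightarrow>
      (\<integral>\<^sup>+x. ennreal (\<bar>U x\<bar> powr r) * indicator (ball 0 \<epsilon>) x \<partial>lborel) \<le> ennreal (\<eta> / 3 powr r)"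
    using unit_translation_bound_powr_small_ball[OF r(1) subcritical_exponent_condition[OF r DIM_positive], of "\<eta> / 3 powr r"] \<eta> by auto
  show ?thesis
  proof (rule that[OF \<epsilon>(1)])
    fix \<Omega> :: "'a set" and u :: "'a \<Rightarrow> real" and \<kappa> :: real
    assume A: "open \<Omega>" "u \<in> H10 \<Omega>" "0 < \<kappa>" "H1_norm \<Omega> u \<le> \<kappa>"
    show "(\<integral>x. indicator (ball 0 \<epsilon>) x * \<bar>u x\<bar> powr r \<partial>lebesgue_on \<Omega>) \<le> \<eta> * \<kappa> powr r"
      using H10_weighted_powr_bound(2)[OF A _ _ \<epsilon>(2)] A(3) \<eta> by (simp add: powr_mult)
  qed
qed

section \<open>Bounded potentials and the energy\<close>

lemma Linf_bounded:
  assumes "Linf \<Omega> f" "Linf_norm \<Omega> f \<le> ereal B"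
  shows "f \<in> borel_measurable (lebesgue_on \<Omega>)" "AE x in lebesgue_on \<Omega>. \<bar>f x\<bar> \<le> B"
proof -
  show "f \<in> borel_measurable (lebesgue_on \<Omega>)" using assms unfolding Linf_def by simp
  have "AE x in lebesgue_on \<Omega>. ereal \<bar>f x\<bar> \<le> Linf_norm \<Omega> f"
    unfolding Linf_norm_def by (rule esssup_AE)
  then show "AE x in lebesgue_on \<Omega>. \<bar>f x\<bar> \<le> B"
  proof eventually_elim
    fix x assume "ereal \<bar>f x\<bar> \<le> Linf_norm \<Omega> f"
    then have "ereal \<bar>f x\<bar> \<le> ereal B" using assms(2) by (rule order_trans)
    then show "\<bar>f x\<bar> \<le> B" by simp
  qed
qed

text \<open>
  The complement of the support is covered by balls on which \<open>f\<close> vanishes almost everywhere, and by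
  the Lindeloef property countably many of them suffice.
\<close>

lemma AE_eq_0_outside_ess_support:
  fixes f :: "'a::euclidean_space \<Rightarrow> real"
  assumes "ess_support \<Omega> f \<subseteq> T"
  shows "AE x in lebesgue_on \<Omega>. x \<notin> T \<longrightarrow> f x = 0"
proof -
  define \<F> where "\<F> = {S. \<exists>x r. S = ball x r \<and> (AE y in lebesgue_on \<Omega>. y \<in> ball x r \<longrightarrow> f y = 0)}"
  have "\<And>S. S \<in> \<F> \<Longrightarrow> open S" unfolding \<F>_def by auto
  then obtain \<F>' where \<F>': "\<F>' \<subseteq> \<F>" "countable \<F>'" "\<Union>\<F>' = \<Union>\<F>"
    using Lindelof by metis
  have cover: "x \<in> \<Union>\<F>" if "x \<notin> T" for x
  proof -
    have "x \<notin> ess_support \<Omega> f" using that assms by blast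
    then obtain r where "r > 0" "AE y in lebesgue_on \<Omega>. y \<in> ball x r \<longrightarrow> f y = 0"
      unfolding ess_support_def by blast
    then have "ball x r \<in> \<F>" "x \<in> ball x r" unfolding \<F>_def by auto
    then show ?thesis by blast
  qed
  have "AE y in lebesgue_on \<Omega>. \<forall>S\<in>\<F>'. y \<in> S \<longrightarrow> f y = 0"
    unfolding AE_ball_countable[OF \<F>'(2)] using \<F>'(1) unfolding \<F>_def by blast
  then show ?thesis
    by eventually_elim (use cover \<F>'(3) in blast)
qed

lemma integrable_energy_density:
  assumes "open \<Omega>" "u \<in> H1 \<Omega>" "W \<in> borel_measurable (lebesgue_on \<Omega>)" "AE x in lebesgue_on \<Omega>. \<bar>W x\<bar> \<le> B"
  shows "integrable (lebesgue_on \<Omega>) (\<lambda>x. (norm (wgrad \<Omega> u x))\<^sup>2 + W x * (u x)\<^sup>2)"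
  using LtwoD(2)[OF H1D(3)[OF assms(1,2)]] integrable_bounded_mult[OF assms(3,4) LtwoD(2)[OF H1D(1)[OF assms(1,2)]]]
  by simp

lemma schroedinger_form_self: "schroedinger_form \<Omega> W u u = energy \<Omega> W \<Omega> u"
  unfolding schroedinger_form_def energy_def by (simp add: dot_square_norm power2_eq_square[of "u _"] mult.assoc)

section \<open>Coercivity\<close>

lemma Ltwo_complex:
  assumes "Ltwo \<Omega> (\<lambda>x. Re (v x))" "Ltwo \<Omega> (\<lambda>x. Im (v x))"
  shows "(\<integral>x. (Re (v x))\<^sup>2 \<partial>lebesgue_on \<Omega>) \<le> (Ltwo_norm \<Omega> v)\<^sup>2"
  unfolding Ltwo_norm_square cmod_power2
  using LtwoD(2)[OF assms(1)] LtwoD(2)[OF assms(2)] by simp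

text \<open>
  Solve \<open>(-\<Delta> + V) a = u\<close> with \<open>\<parallel>a\<parallel> \<le> C\<^sub>1 \<parallel>u\<parallel>\<close>. Then \<open>\<parallel>u\<parallel>\<^sup>2\<close> is the form evaluated at \<open>(a, u)\<close>, which by
  Young's inequality is at most \<open>C\<^sub>1 / 2\<close> times the energy of \<open>u\<close> plus \<open>1 / (2 C\<^sub>1)\<close> times the energy of
  \<open>a\<close>. The latter energy is \<open>\<integral> u a \<le> C\<^sub>1 \<parallel>u\<parallel>\<^sup>2\<close>, so half of \<open>\<parallel>u\<parallel>\<^sup>2\<close> can be absorbed on the left. Since
  \<open>V \<ge> 0\<close>, the energy also bounds the gradient.
\<close>

lemma schroedinger_coercive:
  fixes V :: "'a::euclidean_space \<Rightarrow> real"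
  assumes \<Omega>: "open \<Omega>" and V: "V \<in> borel_measurable (lebesgue_on \<Omega>)" "AE x in lebesgue_on \<Omega>. \<bar>V x\<bar> \<le> B"
    "AE x in lebesgue_on \<Omega>. 0 \<le> V x"
    and res: "0 \<in> schroedinger_resolvent_set \<Omega> V"
  obtains C where "0 < C" "\<And>u. u \<in> H10 \<Omega> \<Longrightarrow> (H1_norm \<Omega> u)\<^sup>2 \<le> C * energy \<Omega> V \<Omega> u"
proof -
  let ?M = "lebesgue_on \<Omega>"
  have H: "\<And>u. u \<in> H10 \<Omega> \<Longrightarrow> u \<in> H1 \<Omega>" unfolding H10_def by simp
  obtain C0 where C0: "\<And>v g. schroedinger_op_complex \<Omega> V v g \<Longrightarrow> Ltwo_norm \<Omega> v \<le> C0 * Ltwo_norm \<Omega> (\<lambda>x. g x - 0 * v x)"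
    and surj: "\<And>f. Ltwo \<Omega> f \<Longrightarrow> \<exists>v. schroedinger_op_complex \<Omega> V v (\<lambda>x. f x + 0 * v x)"
    using res unfolding schroedinger_resolvent_set_def by blast
  define C1 where "C1 = max 1 C0"
  have C1: "1 \<le> C1" "C0 \<le> C1" unfolding C1_def by auto
  have "(H1_norm \<Omega> u)\<^sup>2 \<le> (C1 + 1) * energy \<Omega> V \<Omega> u" if u: "u \<in> H10 \<Omega>" for u
  proof -
    note uD = H1D[OF \<Omega> H[OF u]]
    define S where "S = (\<integral>x. (u x)\<^sup>2 \<partial>?M)"
    have S: "0 \<le> S" unfolding S_def by simp
    let ?f = "\<lambda>x. complex_of_real (u x)"
    have "Ltwo \<Omega> ?f" using LtwoD[OF uD(1)] unfolding Ltwo_def by simp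
    then obtain v where v: "schroedinger_op_complex \<Omega> V v ?f"
      using surj[of ?f] by auto
    define a where "a x = Re (v x)" for x
    have a: "a \<in> H10 \<Omega>" "\<And>\<phi>. \<phi> \<in> H10 \<Omega> \<Longrightarrow> schroedinger_form \<Omega> V a \<phi> = (\<integral>x. u x * \<phi> x \<partial>?M)"
      using v unfolding schroedinger_op_complex_def schroedinger_op_def a_def[abs_def] by auto
    have b: "(\<lambda>x. Im (v x)) \<in> H10 \<Omega>"
      using v unfolding schroedinger_op_complex_def schroedinger_op_def by auto
    note aD = H1D[OF \<Omega> H[OF a(1)]]
    define A where "A = (\<integral>x. (a x)\<^sup>2 \<partial>?M)"
    have "Ltwo_norm \<Omega> v \<le> C0 * Ltwo_norm \<Omega> ?f" using C0[OF v] by simp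
    also have "\<dots> \<le> C1 * Ltwo_norm \<Omega> ?f" using C1 by (intro mult_right_mono) (auto simp: Ltwo_norm_def)
    finally have "(Ltwo_norm \<Omega> v)\<^sup>2 \<le> (C1 * Ltwo_norm \<Omega> ?f)\<^sup>2"
      by (intro power_mono) (auto simp: Ltwo_norm_def)
    also have "\<dots> = C1\<^sup>2 * S" by (simp add: power_mult_distrib Ltwo_norm_square S_def)
    finally have A: "A \<le> C1\<^sup>2 * S"
      using Ltwo_complex[of \<Omega> v] aD(1) H1D(1)[OF \<Omega> H[OF b]] unfolding A_def a_def by fastforce
    note eia = integrable_energy_density[OF \<Omega> H[OF a(1)] V(1,2)]
      and eiu = integrable_energy_density[OF \<Omega> H[OF u] V(1,2)]
    have uu: "integrable ?M (\<lambda>x. (u x)\<^sup>2)" and aa: "integrable ?M (\<lambda>x. (a x)\<^sup>2)"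
      using LtwoD(2)[OF uD(1)] LtwoD(2)[OF aD(1)] by simp_all
    have ua: "integrable ?M (\<lambda>x. u x * a x)" using Ltwo_inner_integrable[OF uD(1) aD(1)] by simp
    have young: "s * t \<le> C1 / 2 * s\<^sup>2 + 1 / (2 * C1) * t\<^sup>2" for s t
    proof -
      have "0 \<le> (C1 * s - t)\<^sup>2 / (2 * C1)" using C1 by simp
      also have "\<dots> = C1 / 2 * s\<^sup>2 + 1 / (2 * C1) * t\<^sup>2 - s * t"
        using C1 by (simp add: power2_diff field_simps power2_eq_square)
      finally show ?thesis by simp
    qed
    have "energy \<Omega> V \<Omega> a = (\<integral>x. u x * a x \<partial>?M)"
      using a(2)[OF a(1)] by (simp add: schroedinger_form_self)
    also have "\<dots> \<le> (\<integral>x. C1 / 2 * (u x)\<^sup>2 + 1 / (2 * C1) * (a x)\<^sup>2 \<partial>?M)"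
      using uu aa ua by (intro integral_mono young) auto
    also have "\<dots> = C1 / 2 * S + 1 / (2 * C1) * A"
      using uu aa unfolding S_def A_def by simp
    also have "\<dots> \<le> C1 / 2 * S + 1 / (2 * C1) * (C1\<^sup>2 * S)"
      using A C1 by (intro add_left_mono mult_left_mono) auto
    also have "\<dots> = C1 * S" using C1 by (simp add: field_simps power2_eq_square)
    finally have Ea: "energy \<Omega> V \<Omega> a \<le> C1 * S" .
    have fi: "integrable ?M (\<lambda>x. wgrad \<Omega> a x \<bullet> wgrad \<Omega> u x + V x * a x * u x)"
    proof -
      have "Ltwo \<Omega> (\<lambda>x. V x *\<^sub>R a x)" by (rule Ltwo_bounded_scaleR(1)[OF aD(1) V(1,2)])
      from Ltwo_inner_integrable[OF this uD(1)] Ltwo_inner_integrable[OF aD(3) uD(3)] show ?thesis by simp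
    qed
    have "S = schroedinger_form \<Omega> V a u"
      using a(2)[OF u] by (simp add: S_def power2_eq_square)
    also have "\<dots> \<le> (\<integral>x. C1 / 2 * ((norm (wgrad \<Omega> u x))\<^sup>2 + V x * (u x)\<^sup>2) + 1 / (2 * C1) * ((norm (wgrad \<Omega> a x))\<^sup>2 + V x * (a x)\<^sup>2) \<partial>?M)"
      unfolding schroedinger_form_def
    proof (rule integral_mono_AE[OF fi])
      show "AE x in ?M. wgrad \<Omega> a x \<bullet> wgrad \<Omega> u x + V x * a x * u x \<le>
        C1 / 2 * ((norm (wgrad \<Omega> u x))\<^sup>2 + V x * (u x)\<^sup>2) + 1 / (2 * C1) * ((norm (wgrad \<Omega> a x))\<^sup>2 + V x * (a x)\<^sup>2)"
        using V(3)
      proof eventually_elim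
        fix x assume Vx: "0 \<le> V x"
        have "wgrad \<Omega> a x \<bullet> wgrad \<Omega> u x \<le> norm (wgrad \<Omega> u x) * norm (wgrad \<Omega> a x)"
          using norm_cauchy_schwarz[of "wgrad \<Omega> a x" "wgrad \<Omega> u x"] by (simp add: mult.commute)
        also have "\<dots> \<le> C1 / 2 * (norm (wgrad \<Omega> u x))\<^sup>2 + 1 / (2 * C1) * (norm (wgrad \<Omega> a x))\<^sup>2" by (rule young)
        finally have 1: "wgrad \<Omega> a x \<bullet> wgrad \<Omega> u x \<le> \<dots>" .
        have 2: "V x * (u x * a x) \<le> V x * (C1 / 2 * (u x)\<^sup>2 + 1 / (2 * C1) * (a x)\<^sup>2)"
          by (intro mult_left_mono young Vx)
        have "C1 / 2 * ((norm (wgrad \<Omega> u x))\<^sup>2 + V x * (u x)\<^sup>2) + 1 / (2 * C1) * ((norm (wgrad \<Omega> a x))\<^sup>2 + V x * (a x)\<^sup>2) =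
          (C1 / 2 * (norm (wgrad \<Omega> u x))\<^sup>2 + 1 / (2 * C1) * (norm (wgrad \<Omega> a x))\<^sup>2) + V x * (C1 / 2 * (u x)\<^sup>2 + 1 / (2 * C1) * (a x)\<^sup>2)"
          by (simp only: distrib_left mult_ac add_ac)
        moreover have "V x * a x * u x = V x * (u x * a x)" by simp
        ultimately show "wgrad \<Omega> a x \<bullet> wgrad \<Omega> u x + V x * a x * u x \<le>
          C1 / 2 * ((norm (wgrad \<Omega> u x))\<^sup>2 + V x * (u x)\<^sup>2) + 1 / (2 * C1) * ((norm (wgrad \<Omega> a x))\<^sup>2 + V x * (a x)\<^sup>2)"
          using 1 2 by linarith
      qed
    qed (use eia eiu in simp)
    also have "\<dots> = C1 / 2 * energy \<Omega> V \<Omega> u + 1 / (2 * C1) * energy \<Omega> V \<Omega> a"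
      unfolding energy_def
      by (subst Bochner_Integration.integral_add)
        (use eia eiu in \<open>auto simp only: integral_mult_right_zero integrable_mult_right\<close>)
    also have "\<dots> \<le> C1 / 2 * energy \<Omega> V \<Omega> u + 1 / (2 * C1) * (C1 * S)"
      using Ea C1 by (intro add_left_mono mult_left_mono) auto
    also have "\<dots> = C1 / 2 * energy \<Omega> V \<Omega> u + S / 2" using C1 by simp
    finally have S1: "S \<le> C1 * energy \<Omega> V \<Omega> u" by simp
    have "(\<integral>x. (norm (wgrad \<Omega> u x))\<^sup>2 \<partial>?M) \<le> energy \<Omega> V \<Omega> u"
      unfolding energy_def
    proof (rule integral_mono_AE[OF _ eiu])
      show "AE x in ?M. (norm (wgrad \<Omega> u x))\<^sup>2 \<le> (norm (wgrad \<Omega> u x))\<^sup>2 + V x * (u x)\<^sup>2"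
        using V(3) by eventually_elim simp
    qed (use LtwoD(2)[OF uD(3)] in simp)
    then show ?thesis using S1 unfolding H1_norm_square S_def by (simp add: algebra_simps)
  qed
  then show ?thesis using C1 by (intro that[of "C1 + 1"]) auto
qed

text \<open>
  The embedding with exponent 2 on a small ball gives \<open>|\<integral> K u\<^sup>2| \<le> B \<eta> \<parallel>u\<parallel>\<^sup>2\<close> in the \<open>H\<^sup>1\<close> norm, and \<open>\<eta>\<close> is
  chosen such that this costs at most half of the coercivity.
\<close>

lemma perturbed_coercive:
  fixes V :: "'a::euclidean_space \<Rightarrow> real"
  assumes \<Omega>: "open \<Omega>" and V: "V \<in> borel_measurable (lebesgue_on \<Omega>)" "AE x in lebesgue_on \<Omega>. \<bar>V x\<bar> \<le> BV"
    and C: "0 < C" "\<And>u. u \<in> H10 \<Omega> \<Longrightarrow> (H1_norm \<Omega> u)\<^sup>2 \<le> C * energy \<Omega> V \<Omega> u"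
    and crit: "ereal 2 < critical_exponent DIM('a)" and B: "0 \<le> B"
  obtains \<epsilon> where "0 < \<epsilon>" "\<And>K u. \<lbrakk>K \<in> borel_measurable (lebesgue_on \<Omega>); AE x in lebesgue_on \<Omega>. \<bar>K x\<bar> \<le> B;
      AE x in lebesgue_on \<Omega>. x \<notin> ball 0 \<epsilon> \<longrightarrow> K x = 0; u \<in> H10 \<Omega>\<rbrakk> \<Longrightarrow>
      (H1_norm \<Omega> u)\<^sup>2 \<le> 2 * C * energy \<Omega> (\<lambda>x. V x + K x) \<Omega> u"
proof -
  let ?M = "lebesgue_on \<Omega>"
  \<comment> \<open>The summand 1 only guards against \<open>B = 0\<close>.\<close>
  define \<eta> where "\<eta> = 1 / (2 * C * (B + 1))"
  have "B * \<eta> * (2 * C) = B / (B + 1)" unfolding \<eta>_def using C(1) by simp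
  also have "\<dots> \<le> 1" using B by simp
  finally have \<eta>: "B * \<eta> * (2 * C) \<le> 1" "0 < \<eta>" unfolding \<eta>_def using C(1) B by auto
  obtain \<epsilon> where \<epsilon>: "0 < \<epsilon>" "\<And>\<Omega> (u :: 'a \<Rightarrow> real) \<kappa>. \<lbrakk>open \<Omega>; u \<in> H10 \<Omega>; 0 < \<kappa>; H1_norm \<Omega> u \<le> \<kappa>\<rbrakk> \<Longrightarrow>
      (\<integral>x. indicator (ball 0 \<epsilon>) x * \<bar>u x\<bar> powr 2 \<partial>lebesgue_on \<Omega>) \<le> \<eta> * \<kappa> powr 2"
    by (rule H10_powr_small_ball[OF order_refl crit \<eta>(2)]) blast
  show ?thesis
  proof (rule that[OF \<epsilon>(1)])
    fix K and u :: "'a \<Rightarrow> real"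
    assume K: "K \<in> borel_measurable ?M" "AE x in ?M. \<bar>K x\<bar> \<le> B" "AE x in ?M. x \<notin> ball 0 \<epsilon> \<longrightarrow> K x = 0"
      and u: "u \<in> H10 \<Omega>"
    have uH: "u \<in> H1 \<Omega>" using u unfolding H10_def by simp
    note uD = H1D[OF \<Omega> uH]
    define H where "H = H1_norm \<Omega> u"
    have H: "0 \<le> H" unfolding H_def H1_norm_def by simp
    have u2: "integrable ?M (\<lambda>x. (u x)\<^sup>2)" using LtwoD(2)[OF uD(1)] by simp
    have iu: "integrable ?M (\<lambda>x. indicator (ball 0 \<epsilon>) x * (u x)\<^sup>2)"
      by (rule integrable_indicator_mult[OF _ u2]) simp
    \<comment> \<open>Second use: the annulus for \<open>\<epsilon>\<close> lies outside the ball of radius \<open>\<epsilon> / 2\<close>, where the crude bound is available.\<close>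
    have small: "(\<integral>x. indicator (ball 0 \<epsilon>) x * (u x)\<^sup>2 \<partial>?M) \<le> \<eta> * H\<^sup>2"
    proof (cases "H = 0")
      case True
      have "(\<integral>x. indicator (ball 0 \<epsilon>) x * (u x)\<^sup>2 \<partial>?M) \<le> (\<integral>x. (u x)\<^sup>2 \<partial>?M)"
        by (intro integral_mono iu u2) (auto simp: indicator_def)
      also have "\<dots> \<le> H\<^sup>2" unfolding H_def by (rule integral_square_le_H1_norm)
      finally show ?thesis using True by simp
    next
      case False
      then show ?thesis using \<epsilon>(2)[OF \<Omega> u, of H] H by (simp add: H_def)
    qed
    have Ki: "integrable ?M (\<lambda>x. K x * (u x)\<^sup>2)"
      by (rule integrable_bounded_mult[OF K(1,2) u2])
    have "- (B * (\<integral>x. indicator (ball 0 \<epsilon>) x * (u x)\<^sup>2 \<partial>?M)) = (\<integral>x. - (B * (indicator (ball 0 \<epsilon>) x * (u x)\<^sup>2)) \<partial>?M)"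
      using iu by simp
    also have "\<dots> \<le> (\<integral>x. K x * (u x)\<^sup>2 \<partial>?M)"
    proof (rule integral_mono_AE[OF _ Ki])
      show "integrable ?M (\<lambda>x. - (B * (indicator (ball 0 \<epsilon>) x * (u x)\<^sup>2)))" using iu by simp
      show "AE x in ?M. - (B * (indicator (ball 0 \<epsilon>) x * (u x)\<^sup>2)) \<le> K x * (u x)\<^sup>2"
        using K(2,3)
      proof eventually_elim
        fix x assume k: "\<bar>K x\<bar> \<le> B" "x \<notin> ball 0 \<epsilon> \<longrightarrow> K x = 0"
        have "- B * (u x)\<^sup>2 \<le> K x * (u x)\<^sup>2" using k by (intro mult_right_mono) auto
        then show "- (B * (indicator (ball 0 \<epsilon>) x * (u x)\<^sup>2)) \<le> K x * (u x)\<^sup>2"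
          using k by (auto simp: indicator_def)
      qed
    qed
    finally have "- (B * (\<eta> * H\<^sup>2)) \<le> (\<integral>x. K x * (u x)\<^sup>2 \<partial>?M)"
      using mult_left_mono[OF small B] by linarith
    then have "- (B * \<eta> * (2 * C)) * H\<^sup>2 \<le> 2 * C * (\<integral>x. K x * (u x)\<^sup>2 \<partial>?M)"
    proof -
      assume "- (B * (\<eta> * H\<^sup>2)) \<le> (\<integral>x. K x * (u x)\<^sup>2 \<partial>?M)"
      then have "2 * C * - (B * (\<eta> * H\<^sup>2)) \<le> 2 * C * (\<integral>x. K x * (u x)\<^sup>2 \<partial>?M)"
        using C(1) by (intro mult_left_mono) auto
      moreover have "2 * C * - (B * (\<eta> * H\<^sup>2)) = - (B * \<eta> * (2 * C)) * H\<^sup>2" by simp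
      ultimately show ?thesis by (simp only:)
    qed
    moreover have "(B * \<eta> * (2 * C)) * H\<^sup>2 \<le> 1 * H\<^sup>2" by (intro mult_right_mono \<eta>) simp
    moreover have "2 * C * energy \<Omega> (\<lambda>x. V x + K x) \<Omega> u = 2 * (C * energy \<Omega> V \<Omega> u) + 2 * C * (\<integral>x. K x * (u x)\<^sup>2 \<partial>?M)"
      unfolding energy_def using Bochner_Integration.integral_add[OF integrable_energy_density[OF \<Omega> uH V] Ki]
      by (simp add: distrib_right distrib_left add.assoc)
    moreover have "H\<^sup>2 \<le> C * energy \<Omega> V \<Omega> u" using C(2)[OF u] unfolding H_def .
    ultimately show "(H1_norm \<Omega> u)\<^sup>2 \<le> 2 * C * energy \<Omega> (\<lambda>x. V x + K x) \<Omega> u"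
      unfolding H_def[symmetric] mult_minus_left by linarith
  qed
qed

section \<open>Estimates for one solution\<close>

lemma powr_minus_two_mult_square: "\<bar>t\<bar> powr (p - 2) * (t * t) = \<bar>t :: real\<bar> powr p"
proof (cases "t = 0")
  case False
  have "\<bar>t\<bar> powr (p - 2) * (t * t) = \<bar>t\<bar> powr (p - 2) * \<bar>t\<bar> powr 2" using False by (simp add: power2_eq_square)
  also have "\<dots> = \<bar>t\<bar> powr p" by (simp only: powr_add[symmetric] diff_add_cancel)
  finally show ?thesis .
qed simp

lemma weak_solution_energy_eq:
  assumes "weak_solution \<Omega> p W q u"
  shows "energy \<Omega> W \<Omega> u = (\<integral>x. q x * \<bar>u x\<bar> powr p \<partial>lebesgue_on \<Omega>)"
proof -
  have "energy \<Omega> W \<Omega> u = (\<integral>x. q x * \<bar>u x\<bar> powr (p - 2) * u x * u x \<partial>lebesgue_on \<Omega>)"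
    using assms unfolding weak_solution_def by (auto simp flip: schroedinger_form_self)
  also have "\<dots> = (\<integral>x. q x * \<bar>u x\<bar> powr p \<partial>lebesgue_on \<Omega>)"
    by (simp add: powr_minus_two_mult_square mult.assoc)
  finally show ?thesis .
qed

lemma cutoff_with_annular_gradient:
  fixes \<epsilon> :: real
  assumes \<epsilon>: "0 < \<epsilon>"
  obtains \<zeta> :: "'a::euclidean_space \<Rightarrow> real" and L where "\<And>k. Ck k \<zeta>" "\<And>x. 0 \<le> \<zeta> x" "\<And>x. \<zeta> x \<le> 1"
    "\<And>x. norm x < \<epsilon> / 2 \<Longrightarrow> \<zeta> x = 0" "\<And>x. \<epsilon> \<le> norm x \<Longrightarrow> \<zeta> x = 1"
    "0 \<le> L" "\<And>x. norm (gradient \<zeta> x) \<le> L * indicator (cball 0 \<epsilon> - ball 0 (\<epsilon> / 2)) x"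
proof -
  obtain \<zeta> :: "'a \<Rightarrow> real" where \<zeta>: "\<And>k. Ck k \<zeta>" "\<And>x. 0 \<le> \<zeta> x" "\<And>x. \<zeta> x \<le> 1"
    "\<And>x. norm x \<le> \<epsilon> / 2 \<Longrightarrow> \<zeta> x = 0" "\<And>x. \<epsilon> \<le> norm x \<Longrightarrow> \<zeta> x = 1"
    using smooth_cutoff_exists[OF \<epsilon>] by blast
  have const: "gradient \<zeta> x = 0" if "open S" "x \<in> S" "\<And>y. y \<in> S \<Longrightarrow> c = \<zeta> y" for S x c
  proof -
    have "(\<zeta> has_derivative (\<lambda>h. 0)) (at x)"
      by (rule has_derivative_transform_within_open[where s = S and f = "\<lambda>x. c"]) (use that in auto)
    then have "frechet_derivative \<zeta> (at x) = (\<lambda>h. 0)" using frechet_derivative_at by metis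
    then show ?thesis by (simp add: gradient_def)
  qed
  have cg: "continuous_on UNIV (gradient \<zeta>)" by (rule continuous_gradient[OF \<zeta>(1)])
  have "bounded (gradient \<zeta> ` cball 0 \<epsilon>)"
    by (intro compact_imp_bounded compact_continuous_image continuous_on_subset[OF cg]) auto
  then obtain L0 where L0: "\<And>x. x \<in> cball 0 \<epsilon> \<Longrightarrow> norm (gradient \<zeta> x) \<le> L0" unfolding bounded_iff by blast
  define L where "L = max 0 L0"
  have grad: "norm (gradient \<zeta> x) \<le> L * indicator (cball 0 \<epsilon> - ball 0 (\<epsilon> / 2)) x" for x
  proof -
    consider "norm x < \<epsilon> / 2" | "\<epsilon> < norm x" | "\<epsilon> / 2 \<le> norm x" "norm x \<le> \<epsilon>" by linarith
    then show ?thesis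
    proof cases
      case 1
      have "gradient \<zeta> x = 0" by (rule const[of "ball 0 (\<epsilon> / 2)" x 0]) (use 1 \<zeta>(4) in auto)
      then show ?thesis by (simp add: L_def)
    next
      case 2
      have "gradient \<zeta> x = 0" by (rule const[of "- cball 0 \<epsilon>" x 1]) (use 2 \<zeta>(5) in auto)
      then show ?thesis by (simp add: L_def)
    next
      case 3
      then show ?thesis using L0[of x] by (auto simp: L_def)
    qed
  qed
  show ?thesis by (rule that[of \<zeta> L]) (use \<zeta> grad in \<open>auto simp: L_def\<close>)
qed

text \<open>
  Test the equation with \<open>\<zeta> u\<close>. The form splits into \<open>\<integral> \<zeta> (|\<nabla>u|\<^sup>2 + W u\<^sup>2)\<close> and the cross term
  \<open>\<integral> u \<nabla>u \<bullet> \<nabla>\<zeta>\<close>, and the right-hand side is at most \<open>- \<delta> \<integral> \<zeta> |u|\<^sup>p\<close>, since \<open>\<zeta>\<close> vanishes wherever the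
  signs of \<open>W\<close> and \<open>q\<close> are not known. The cross term is estimated by Young's inequality with a free
  parameter \<open>\<tau>\<close>, which later separates the small \<open>L\<^sup>2\<close> norm on the annulus from the bounded norm of
  the gradient.
\<close>

lemma exterior_energy_estimate:
  fixes u W q \<zeta> :: "'a::euclidean_space \<Rightarrow> real" and \<epsilon> p L B D \<delta> \<tau> :: real
  assumes \<epsilon>: "0 < \<epsilon>" and \<zeta>: "\<And>k. Ck k \<zeta>" "\<And>x. 0 \<le> \<zeta> x" "\<And>x. \<zeta> x \<le> 1"
    "\<And>x. norm x < \<epsilon> / 2 \<Longrightarrow> \<zeta> x = 0" "\<And>x. \<epsilon> \<le> norm x \<Longrightarrow> \<zeta> x = 1"
    and L: "0 \<le> L" and grad: "\<And>x. norm (gradient \<zeta> x) \<le> L * indicator A x" and A: "A \<in> sets borel"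
    and \<Omega>: "open \<Omega>" and sol: "weak_solution \<Omega> p W q u"
    and W: "W \<in> borel_measurable (lebesgue_on \<Omega>)" "AE x in lebesgue_on \<Omega>. \<bar>W x\<bar> \<le> B"
    and q: "q \<in> borel_measurable (lebesgue_on \<Omega>)" "AE x in lebesgue_on \<Omega>. \<bar>q x\<bar> \<le> D"
    and up: "integrable (lebesgue_on \<Omega>) (\<lambda>x. \<bar>u x\<bar> powr p)" and \<delta>: "0 < \<delta>"
    and out: "AE x in lebesgue_on \<Omega>. x \<notin> ball 0 (\<epsilon> / 2) \<longrightarrow> 0 \<le> W x \<and> q x \<le> - \<delta>" and \<tau>: "0 < \<tau>"
  shows "0 \<le> energy \<Omega> W (\<Omega> - ball 0 \<epsilon>) u \<and>
    energy \<Omega> W (\<Omega> - ball 0 \<epsilon>) u + \<delta> * (\<integral>x. \<bar>u x\<bar> powr p \<partial>lebesgue_on (\<Omega> - ball 0 \<epsilon>)) \<le>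
      L * ((\<integral>x. indicator A x * (u x)\<^sup>2 \<partial>lebesgue_on \<Omega>) / \<tau>
           + \<tau> * (\<integral>x. (norm (wgrad \<Omega> u x))\<^sup>2 \<partial>lebesgue_on \<Omega>))"
proof -
  let ?M = "lebesgue_on \<Omega>"
  let ?S = "\<Omega> - ball 0 \<epsilon>"
  have u10: "u \<in> H10 \<Omega>" using sol unfolding weak_solution_def by simp
  have uH: "u \<in> H1 \<Omega>" using u10 unfolding H10_def by simp
  note uD = H1D[OF \<Omega> uH]
  have Lb: "norm (gradient \<zeta> x) \<le> L" for x using grad[of x] L by (cases "x \<in> A") auto
  have \<zeta>1: "\<bar>\<zeta> x\<bar> \<le> 1" for x using \<zeta>(2,3)[of x] by simp
  have \<zeta>m: "\<zeta> \<in> borel_measurable ?M" "gradient \<zeta> \<in> borel_measurable ?M"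
    using \<zeta>(1)[of 0] by (auto intro!: continuous_UNIV_borel_measurable_lebesgue_on continuous_gradient \<zeta>)
  define e where "e x = (norm (wgrad \<Omega> u x))\<^sup>2 + W x * (u x)\<^sup>2" for x
  have ei: "integrable ?M e" unfolding e_def by (rule integrable_energy_density[OF \<Omega> uH W])
  define G where "G x = u x * (wgrad \<Omega> u x \<bullet> gradient \<zeta> x)" for x
  have "Ltwo \<Omega> (\<lambda>x. u x *\<^sub>R gradient \<zeta> x)"
  proof (rule Ltwo_bound(1)[where h = "\<lambda>x. L\<^sup>2 * (u x)\<^sup>2"])
    show "(\<lambda>x. u x *\<^sub>R gradient \<zeta> x) \<in> borel_measurable ?M"
      by (intro borel_measurable_scaleR LtwoD(1)[OF uD(1)] \<zeta>m)
    show "integrable ?M (\<lambda>x. L\<^sup>2 * (u x)\<^sup>2)" using LtwoD(2)[OF uD(1)] by simp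
    show "AE x in ?M. (norm (u x *\<^sub>R gradient \<zeta> x))\<^sup>2 \<le> L\<^sup>2 * (u x)\<^sup>2"
      using Lb by (intro AE_I2) (auto simp: power_mult_distrib mult.commute[of "L\<^sup>2"] intro!: mult_left_mono power_mono)
  qed
  from Ltwo_inner_integrable[OF this uD(3)] have Gi: "integrable ?M G"
    unfolding G_def by (simp add: inner_commute)
  have \<zeta>AE: "AE x in ?M. \<bar>\<zeta> x\<bar> \<le> 1" by (intro AE_I2 \<zeta>1)
  have \<zeta>ei: "integrable ?M (\<lambda>x. \<zeta> x * e x)"
    by (rule integrable_bounded_mult[OF \<zeta>m(1) \<zeta>AE ei])
  have \<zeta>pi: "integrable ?M (\<lambda>x. \<zeta> x * \<bar>u x\<bar> powr p)"
    by (rule integrable_bounded_mult[OF \<zeta>m(1) \<zeta>AE up])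
  have qpi: "integrable ?M (\<lambda>x. q x * (\<zeta> x * \<bar>u x\<bar> powr p))"
    by (rule integrable_bounded_mult[OF q \<zeta>pi])
  have \<zeta>u: "(\<lambda>x. \<zeta> x * u x) \<in> H10 \<Omega>" by (rule H10_smooth_mult[OF \<Omega> u10 \<zeta>(1) \<zeta>1 Lb])
  have "schroedinger_form \<Omega> W u (\<lambda>x. \<zeta> x * u x) = (\<integral>x. \<zeta> x * e x + G x \<partial>?M)"
    unfolding schroedinger_form_def
  proof (rule integral_cong_AE)
    have "(\<lambda>x. \<zeta> x * u x) \<in> H1 \<Omega>" using \<zeta>u unfolding H10_def by simp
    note m = LtwoD(1)[OF H1D(3)[OF \<Omega> this]] LtwoD(1)[OF uD(3)] LtwoD(1)[OF uD(1)]
    show "(\<lambda>x. wgrad \<Omega> u x \<bullet> wgrad \<Omega> (\<lambda>x. \<zeta> x * u x) x + W x * u x * (\<zeta> x * u x)) \<in> borel_measurable ?M"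
      by (intro borel_measurable_add borel_measurable_inner borel_measurable_times m W \<zeta>m)
    show "(\<lambda>x. \<zeta> x * e x + G x) \<in> borel_measurable ?M"
      using \<zeta>ei Gi by simp
    show "AE x in ?M. wgrad \<Omega> u x \<bullet> wgrad \<Omega> (\<lambda>x. \<zeta> x * u x) x + W x * u x * (\<zeta> x * u x) = \<zeta> x * e x + G x"
      using H1_smooth_mult(2)[OF \<Omega> uH \<zeta>(1) \<zeta>1 Lb]
      by eventually_elim (simp add: e_def G_def inner_add_right dot_square_norm power2_eq_square[of "u _"] algebra_simps)
  qed
  also have "\<dots> = (\<integral>x. \<zeta> x * e x \<partial>?M) + (\<integral>x. G x \<partial>?M)"
    by (rule Bochner_Integration.integral_add[OF \<zeta>ei Gi])
  finally have lhs: "schroedinger_form \<Omega> W u (\<lambda>x. \<zeta> x * u x) = \<dots>" .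
  have "schroedinger_form \<Omega> W u (\<lambda>x. \<zeta> x * u x) = (\<integral>x. q x * \<bar>u x\<bar> powr (p - 2) * u x * (\<zeta> x * u x) \<partial>?M)"
    using sol \<zeta>u unfolding weak_solution_def by blast
  also have "\<dots> = (\<integral>x. q x * (\<zeta> x * \<bar>u x\<bar> powr p) \<partial>?M)"
  proof (rule Bochner_Integration.integral_cong[OF refl])
    fix x
    have "q x * \<bar>u x\<bar> powr (p - 2) * u x * (\<zeta> x * u x) = q x * (\<zeta> x * (\<bar>u x\<bar> powr (p - 2) * (u x * u x)))"
      by (simp only: mult_ac)
    then show "q x * \<bar>u x\<bar> powr (p - 2) * u x * (\<zeta> x * u x) = q x * (\<zeta> x * \<bar>u x\<bar> powr p)"
      by (simp only: powr_minus_two_mult_square)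
  qed
  also have "\<dots> \<le> (\<integral>x. - \<delta> * (\<zeta> x * \<bar>u x\<bar> powr p) \<partial>?M)"
  proof (rule integral_mono_AE[OF qpi])
    show "AE x in ?M. q x * (\<zeta> x * \<bar>u x\<bar> powr p) \<le> - \<delta> * (\<zeta> x * \<bar>u x\<bar> powr p)"
      using out
    proof eventually_elim
      fix x assume x: "x \<notin> ball 0 (\<epsilon> / 2) \<longrightarrow> 0 \<le> W x \<and> q x \<le> - \<delta>"
      show "q x * (\<zeta> x * \<bar>u x\<bar> powr p) \<le> - \<delta> * (\<zeta> x * \<bar>u x\<bar> powr p)"
      proof (cases "x \<in> ball 0 (\<epsilon> / 2)")
        case False
        then show ?thesis using x \<zeta>(2)[of x] by (intro mult_right_mono) auto
      qed (simp add: \<zeta>(4))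
    qed
  qed (use \<zeta>pi in simp)
  also have "\<dots> = - \<delta> * (\<integral>x. \<zeta> x * \<bar>u x\<bar> powr p \<partial>?M)" by simp
  finally have main: "(\<integral>x. \<zeta> x * e x \<partial>?M) + \<delta> * (\<integral>x. \<zeta> x * \<bar>u x\<bar> powr p \<partial>?M) \<le> - (\<integral>x. G x \<partial>?M)"
    using lhs by simp
  have Ai: "integrable ?M (\<lambda>x. indicator A x * (u x)\<^sup>2)"
    using integrable_indicator_mult[of A, OF _ LtwoD(2)[OF uD(1)]] by (simp add: A)
  have gi: "integrable ?M (\<lambda>x. (norm (wgrad \<Omega> u x))\<^sup>2)" by (rule LtwoD(2)[OF uD(3)])
  have "- (\<integral>x. G x \<partial>?M) = (\<integral>x. - G x \<partial>?M)" by simp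
  also have "\<dots> \<le> (\<integral>x. L * (indicator A x * (u x)\<^sup>2 / \<tau> + \<tau> * (norm (wgrad \<Omega> u x))\<^sup>2) \<partial>?M)"
  proof (rule integral_mono)
    fix x
    let ?n = "norm (wgrad \<Omega> u x)"
    have "- G x \<le> \<bar>u x\<bar> * \<bar>wgrad \<Omega> u x \<bullet> gradient \<zeta> x\<bar>" unfolding G_def by (simp flip: abs_mult)
    also have "\<dots> \<le> \<bar>u x\<bar> * (?n * (L * indicator A x))"
      by (intro mult_left_mono order_trans[OF Cauchy_Schwarz_ineq2] grad) auto
    also have "\<dots> = L * (indicator A x * (\<bar>u x\<bar> * ?n))" by simp
    also have "\<dots> \<le> L * (indicator A x * (u x)\<^sup>2 / \<tau> + \<tau> * ?n\<^sup>2)"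
    proof (rule mult_left_mono[OF _ L])
      have "0 \<le> (\<bar>u x\<bar> - \<tau> * ?n)\<^sup>2 / \<tau>" using \<tau> by simp
      also have "\<dots> = (u x)\<^sup>2 / \<tau> + \<tau> * ?n\<^sup>2 - 2 * (\<bar>u x\<bar> * ?n)"
        using \<tau> by (simp add: power2_diff field_simps power2_eq_square)
      finally have "2 * (\<bar>u x\<bar> * ?n) \<le> (u x)\<^sup>2 / \<tau> + \<tau> * ?n\<^sup>2" by simp
      moreover have "0 \<le> \<bar>u x\<bar> * ?n" by simp
      ultimately have "\<bar>u x\<bar> * ?n \<le> (u x)\<^sup>2 / \<tau> + \<tau> * ?n\<^sup>2" by linarith
      moreover have "0 \<le> \<tau> * ?n\<^sup>2" using \<tau> by simp
      ultimately show "indicator A x * (\<bar>u x\<bar> * ?n) \<le> indicator A x * (u x)\<^sup>2 / \<tau> + \<tau> * ?n\<^sup>2"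
        by (auto simp: indicator_def)
    qed
    finally show "- G x \<le> L * (indicator A x * (u x)\<^sup>2 / \<tau> + \<tau> * ?n\<^sup>2)" .
  qed (use Gi Ai gi in auto)
  also have "\<dots> = L * ((\<integral>x. indicator A x * (u x)\<^sup>2 \<partial>?M) / \<tau> + \<tau> * (\<integral>x. (norm (wgrad \<Omega> u x))\<^sup>2 \<partial>?M))"
    using Ai gi by simp
  finally have rhs: "- (\<integral>x. G x \<partial>?M) \<le> \<dots>" .
  have Ssets: "?S \<in> sets lebesgue" "\<Omega> \<in> sets lebesgue" "?S \<subseteq> \<Omega>" using \<Omega> by auto
  have Sborel: "?S \<in> sets borel" using \<Omega> by auto
  have on_S: "x \<in> ?S \<Longrightarrow> x \<notin> ball 0 (\<epsilon> / 2) \<and> \<zeta> x = 1" for x using \<epsilon> \<zeta>(5)[of x] by auto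
  have "energy \<Omega> W ?S u = (\<integral>x. indicator ?S x * e x \<partial>?M)"
    unfolding energy_def e_def by (rule integral_lebesgue_on_subset[OF Ssets])
  moreover have "0 \<le> \<dots>"
  proof (rule integral_nonneg_AE)
    show "AE x in ?M. 0 \<le> indicator ?S x * e x"
      using out by eventually_elim (use on_S in \<open>force simp: indicator_def e_def\<close>)
  qed
  moreover have "(\<integral>x. indicator ?S x * e x \<partial>?M) \<le> (\<integral>x. \<zeta> x * e x \<partial>?M)"
  proof (rule integral_mono_AE[OF _ \<zeta>ei])
    show "integrable ?M (\<lambda>x. indicator ?S x * e x)"
      by (rule integrable_indicator_mult[OF Sborel ei])
    show "AE x in ?M. indicator ?S x * e x \<le> \<zeta> x * e x"
      using out
    proof eventually_elim
      fix x assume x: "x \<notin> ball 0 (\<epsilon> / 2) \<longrightarrow> 0 \<le> W x \<and> q x \<le> - \<delta>"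
      show "indicator ?S x * e x \<le> \<zeta> x * e x"
      proof (cases "x \<in> ball 0 (\<epsilon> / 2)")
        case True
        then show ?thesis using on_S[of x] \<zeta>(4)[of x] by (auto simp: indicator_def)
      next
        case False
        then have "0 \<le> e x" using x by (simp add: e_def)
        then show ?thesis using on_S[of x] \<zeta>(2)[of x] by (auto simp: indicator_def)
      qed
    qed
  qed
  moreover have "(\<integral>x. \<bar>u x\<bar> powr p \<partial>lebesgue_on ?S) \<le> (\<integral>x. \<zeta> x * \<bar>u x\<bar> powr p \<partial>?M)"
    unfolding integral_lebesgue_on_subset[OF Ssets]
  proof (rule integral_mono[OF _ \<zeta>pi])
    show "integrable ?M (\<lambda>x. indicator ?S x * \<bar>u x\<bar> powr p)"
      by (rule integrable_indicator_mult[OF Sborel up])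
    show "indicator ?S x * \<bar>u x\<bar> powr p \<le> \<zeta> x * \<bar>u x\<bar> powr p" for x
      using on_S[of x] \<zeta>(2)[of x] by (auto simp: indicator_def)
  qed
  then have "\<delta> * (\<integral>x. \<bar>u x\<bar> powr p \<partial>lebesgue_on ?S) \<le> \<delta> * (\<integral>x. \<zeta> x * \<bar>u x\<bar> powr p \<partial>?M)"
    using \<delta> by (intro mult_left_mono) auto
  ultimately show "0 \<le> energy \<Omega> W ?S u \<and>
    energy \<Omega> W ?S u + \<delta> * (\<integral>x. \<bar>u x\<bar> powr p \<partial>lebesgue_on ?S) \<le>
      L * ((\<integral>x. indicator (A) x * (u x)\<^sup>2 \<partial>?M) / \<tau>
           + \<tau> * (\<integral>x. (norm (wgrad \<Omega> u x))\<^sup>2 \<partial>?M))"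
    using main rhs by linarith
qed

text \<open>
  Pointwise, \<open>u\<^sup>2 \<le> l\<^sup>2\<close> where \<open>|u| \<le> l\<close>, and \<open>u\<^sup>2 = |u| powr (2 - p) * |u| powr p\<close> with a decreasing
  first factor where \<open>|u| > l\<close>. On a set of finite measure this does the work of the Hoelder inequality
  and keeps \<open>l\<close> free.
\<close>

lemma annulus_square_le_powr:
  fixes u :: "'a::euclidean_space \<Rightarrow> real"
  assumes \<Omega>: "open \<Omega>" and u: "Ltwo \<Omega> u" and p: "2 < p" and up: "integrable (lebesgue_on \<Omega>) (\<lambda>x. \<bar>u x\<bar> powr p)"
    and l: "0 < l"
  shows "(\<integral>x. indicator (cball 0 \<epsilon> - ball 0 r) x * (u x)\<^sup>2 \<partial>lebesgue_on \<Omega>) \<le>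
    l\<^sup>2 * (\<integral>x. indicator (cball 0 \<epsilon> - ball 0 r) x \<partial>lebesgue_on \<Omega>) +
    l powr (2 - p) * (\<integral>x. \<bar>u x\<bar> powr p \<partial>lebesgue_on (\<Omega> - ball 0 r))"
proof -
  let ?M = "lebesgue_on \<Omega>" and ?A = "cball (0::'a) \<epsilon> - ball 0 r" and ?S = "\<Omega> - ball 0 r"
  have Ab: "?A \<in> sets borel" "?S \<in> sets borel" using \<Omega> by auto
  have "integrable lborel (indicator ?A :: 'a \<Rightarrow> real)"
    by (rule integrable_real_indicator)
      (auto intro: le_less_trans[OF emeasure_mono emeasure_lborel_cball_finite[of 0 \<epsilon>, unfolded infinity_ennreal_def]])
  then have "integrable (lebesgue_on UNIV) (indicator ?A :: 'a \<Rightarrow> real)"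
    by (simp add: lebesgue_on_UNIV_eq integrable_completion)
  then have Ai: "integrable ?M (indicator ?A :: 'a \<Rightarrow> real)"
    by (rule integrable_lebesgue_on_subset) (use \<Omega> in auto)
  have Si: "integrable ?M (\<lambda>x. indicator ?S x * \<bar>u x\<bar> powr p)"
    by (rule integrable_indicator_mult[OF Ab(2) up])
  have ui: "integrable ?M (\<lambda>x. indicator ?A x * (u x)\<^sup>2)"
    using integrable_indicator_mult[OF Ab(1) LtwoD(2)[OF u]] by simp
  have "(\<integral>x. indicator ?A x * (u x)\<^sup>2 \<partial>?M) \<le>
      (\<integral>x. l\<^sup>2 * indicator ?A x + l powr (2 - p) * (indicator ?S x * \<bar>u x\<bar> powr p) \<partial>?M)"
  proof (rule integral_mono[OF ui])
    fix x assume "x \<in> space ?M"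
    then have x: "x \<in> \<Omega>" by simp
    have "(u x)\<^sup>2 \<le> l\<^sup>2 + l powr (2 - p) * \<bar>u x\<bar> powr p"
    proof (cases "\<bar>u x\<bar> \<le> l")
      case True
      then have "(u x)\<^sup>2 \<le> l\<^sup>2" using l by (intro abs_le_square_iff[THEN iffD1]) auto
      then show ?thesis by (simp add: add_increasing2)
    next
      case False
      then have "(u x)\<^sup>2 = \<bar>u x\<bar> powr ((2 - p) + p)" using l by simp
      also have "\<dots> = \<bar>u x\<bar> powr (2 - p) * \<bar>u x\<bar> powr p" by (rule powr_add)
      also have "\<dots> \<le> l powr (2 - p) * \<bar>u x\<bar> powr p"
        using False l p by (intro mult_right_mono powr_mono2') auto
      finally show ?thesis by (simp add: add_increasing)
    qed
    then show "indicator ?A x * (u x)\<^sup>2 \<le> l\<^sup>2 * indicator ?A x + l powr (2 - p) * (indicator ?S x * \<bar>u x\<bar> powr p)"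
      using x by (cases "x \<in> ?A") (auto simp: indicator_def)
  qed (use Ai Si in simp)
  also have "\<dots> = l\<^sup>2 * (\<integral>x. indicator ?A x \<partial>?M) + l powr (2 - p) * (\<integral>x. indicator ?S x * \<bar>u x\<bar> powr p \<partial>?M)"
    using Ai Si by simp
  also have "(\<integral>x. indicator ?S x * \<bar>u x\<bar> powr p \<partial>?M) = (\<integral>x. \<bar>u x\<bar> powr p \<partial>lebesgue_on ?S)"
    by (rule integral_lebesgue_on_subset[symmetric]) (use \<Omega> in auto)
  finally show ?thesis .
qed

lemma energy_scale:
  assumes \<Omega>: "open \<Omega>" and u: "u \<in> H1 \<Omega>" and W: "W \<in> borel_measurable (lebesgue_on \<Omega>)"
    and S: "S \<in> sets lebesgue" "S \<subseteq> \<Omega>"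
  shows "energy \<Omega> W S (\<lambda>x. c * u x) = c\<^sup>2 * energy \<Omega> W S u"
proof -
  note uD = H1D[OF \<Omega> u]
  have cD: "Ltwo \<Omega> (\<lambda>x. c * u x)" using Ltwo_scaleR[OF uD(1), of c] by simp
  have cg: "Ltwo \<Omega> (\<lambda>x. c *\<^sub>R wgrad \<Omega> u x)" by (rule Ltwo_scaleR[OF uD(3)])
  have cH: "(\<lambda>x. c * u x) \<in> H1 \<Omega>" by (rule H1I[OF cD has_weak_gradient_scale[OF uD(2)] cg])
  have meas: "(\<lambda>x. (norm (wgrad \<Omega> v x))\<^sup>2 + W x * (v x)\<^sup>2) \<in> borel_measurable (lebesgue_on S)" if v: "v \<in> H1 \<Omega>" for v
  proof -
    have "(\<lambda>x. (norm (wgrad \<Omega> v x))\<^sup>2 + W x * (v x)\<^sup>2) \<in> borel_measurable (lebesgue_on \<Omega>)"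
      by (intro borel_measurable_add borel_measurable_times borel_measurable_power W LtwoD(1)[OF H1D(1)[OF \<Omega> v]]
        borel_measurable_integrable[OF LtwoD(2)[OF H1D(3)[OF \<Omega> v]]])
    then show ?thesis using S(2) by (rule measurable_restrict_mono)
  qed
  have "energy \<Omega> W S (\<lambda>x. c * u x) = (\<integral>x. c\<^sup>2 * ((norm (wgrad \<Omega> u x))\<^sup>2 + W x * (u x)\<^sup>2) \<partial>lebesgue_on S)"
    unfolding energy_def
  proof (rule integral_cong_AE[OF meas[OF cH]])
    show "(\<lambda>x. c\<^sup>2 * ((norm (wgrad \<Omega> u x))\<^sup>2 + W x * (u x)\<^sup>2)) \<in> borel_measurable (lebesgue_on S)"
      using meas[OF u] by (intro borel_measurable_times) auto
    have "AE x in lebesgue_on S. wgrad \<Omega> (\<lambda>x. c * u x) x = c *\<^sub>R wgrad \<Omega> u x"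
      using wgrad_scale[OF \<Omega> u, of c] \<Omega> S by (auto simp: AE_restrict_space_iff elim!: eventually_mono)
    then show "AE x in lebesgue_on S. (norm (wgrad \<Omega> (\<lambda>x. c * u x) x))\<^sup>2 + W x * (c * u x)\<^sup>2 = c\<^sup>2 * ((norm (wgrad \<Omega> u x))\<^sup>2 + W x * (u x)\<^sup>2)"
      by eventually_elim (simp add: power_mult_distrib distrib_left)
  qed
  then show ?thesis unfolding energy_def by simp
qed

section \<open>Concentration at the origin\<close>

lemma tendsto_0_of_eventually_le:
  assumes "\<And>\<theta>. 0 < \<theta> \<Longrightarrow> \<forall>\<^sub>F n in sequentially. 0 \<le> f n \<and> f n \<le> (\<theta>::real)"
  shows "f \<longlonglongrightarrow> 0"
proof (rule tendstoI)
  fix e :: real assume "0 < e"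
  then have "\<forall>\<^sub>F n in sequentially. 0 \<le> f n \<and> f n \<le> e / 2" by (intro assms) simp
  then show "\<forall>\<^sub>F n in sequentially. dist (f n) 0 < e"
    by eventually_elim (use \<open>0 < e\<close> in simp)
qed

theorem theorem2p6:
  fixes \<Omega> :: "'a::euclidean_space set"
    and p :: real
    and V :: "'a \<Rightarrow> real"
    and K Vn Q u w :: "nat \<Rightarrow> 'a \<Rightarrow> real"
  assumes domain: "open \<Omega>" "connected \<Omega>" "0 \<in> \<Omega>"
    and p: "2 < p" "ereal p < critical_exponent DIM('a)"
    and Vn: "\<And>n. Vn n = (\<lambda>x. V x + K n x)"
    and A1: "cond_A1 \<Omega> V K"
    and A2: "cond_A2 \<Omega> Q"
    and u: "\<forall>\<^sub>F n in sequentially. weak_solution \<Omega> p (Vn n) (Q n) (u n) \<and> nontrivial_on \<Omega> (u n)"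
    and w: "\<And>n. w n = (\<lambda>x. u n x / energy_norm \<Omega> (Vn n) (u n))"
  shows "\<forall>\<epsilon>>0.
    (\<lambda>n. energy \<Omega> (Vn n) (\<Omega> - ball 0 \<epsilon>) (w n)) \<longlonglongrightarrow> 0 \<and>
    (\<lambda>n. energy_norm \<Omega> (Vn n) (u n) powr (p - 2) *
          (\<integral>x. \<bar>w n x\<bar> powr p \<partial>lebesgue_on (\<Omega> - ball 0 \<epsilon>))) \<longlonglongrightarrow> 0 \<and>
    (\<lambda>n. energy \<Omega> (Vn n) (\<Omega> - ball 0 \<epsilon>) (u n) / energy \<Omega> (Vn n) \<Omega> (u n)) \<longlonglongrightarrow> 0 \<and>
    (\<lambda>n. (\<integral>x. \<bar>u n x\<bar> powr p \<partial>lebesgue_on (\<Omega> - ball 0 \<epsilon>)) /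
          (\<integral>x. \<bar>u n x\<bar> powr p \<partial>lebesgue_on \<Omega>)) \<longlonglongrightarrow> 0"
proof -
  let ?M = "lebesgue_on \<Omega>"
  note \<Omega> = domain(1)
  obtain BV where BV: "Linf_norm \<Omega> V \<le> ereal BV"
    using A1 unfolding cond_A1_def Linf_def by (cases "Linf_norm \<Omega> V") auto
  have V: "V \<in> borel_measurable ?M" "AE x in ?M. \<bar>V x\<bar> \<le> BV" "AE x in ?M. 0 \<le> V x"
    using Linf_bounded[OF _ BV] A1 unfolding cond_A1_def by blast+
  obtain B0 where B0: "\<And>n. Linf_norm \<Omega> (K n) \<le> ereal B0" using A1 unfolding cond_A1_def by blast
  define B where "B = max 0 B0"
  have "Linf_norm \<Omega> (K n) \<le> ereal B" for n
    by (rule order_trans[OF B0]) (simp add: B_def)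
  then have K: "K n \<in> borel_measurable ?M" "AE x in ?M. \<bar>K n x\<bar> \<le> B" for n
    using Linf_bounded[of \<Omega> "K n" B] A1 unfolding cond_A1_def by auto
  have K0: "\<forall>\<^sub>F n in sequentially. AE x in ?M. x \<notin> ball 0 \<epsilon> \<longrightarrow> K n x = 0" if \<epsilon>: "0 < \<epsilon>" for \<epsilon>
  proof -
    obtain N where "\<And>n. n \<ge> N \<Longrightarrow> ess_support \<Omega> (K n) \<subseteq> ball 0 \<epsilon>"
      using A1 \<epsilon> unfolding cond_A1_def by blast
    then show ?thesis
      unfolding eventually_sequentially by (intro exI[of _ N] allI impI AE_eq_0_outside_ess_support) auto
  qed
  have Vnm: "Vn n \<in> borel_measurable ?M" "AE x in ?M. \<bar>Vn n x\<bar> \<le> BV + B" for n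
  proof -
    show "Vn n \<in> borel_measurable ?M" unfolding Vn by (intro borel_measurable_add V K)
    show "AE x in ?M. \<bar>Vn n x\<bar> \<le> BV + B"
      using V(2) K(2)[of n] by eventually_elim (auto simp: Vn)
  qed
  obtain D0 where D0: "\<And>n. Linf_norm \<Omega> (Q n) \<le> ereal D0" using A2 unfolding cond_A2_def by blast
  define D where "D = max 1 D0"
  have D: "1 \<le> D" unfolding D_def by simp
  have "Linf_norm \<Omega> (Q n) \<le> ereal D" for n
    by (rule order_trans[OF D0]) (simp add: D_def)
  then have Q: "Q n \<in> borel_measurable ?M" "AE x in ?M. \<bar>Q n x\<bar> \<le> D" for n
    using Linf_bounded[of \<Omega> "Q n" D] A2 unfolding cond_A2_def by auto
  have Q0: "\<exists>\<delta>>0. \<forall>\<^sub>F n in sequentially. AE x in ?M. x \<notin> ball 0 \<epsilon> \<longrightarrow> Q n x \<le> - \<delta>" if "0 < \<epsilon>" for \<epsilon>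
    using A2 that unfolding cond_A2_def eventually_sequentially by blast

  have "0 \<in> schroedinger_resolvent_set \<Omega> V"
    using A1 unfolding cond_A1_def schroedinger_spectrum_def by auto
  then obtain C0 where C0: "0 < C0" "\<And>v. v \<in> H10 \<Omega> \<Longrightarrow> (H1_norm \<Omega> v)\<^sup>2 \<le> C0 * energy \<Omega> V \<Omega> v"
    using schroedinger_coercive[OF \<Omega> V] by blast
  define C where "C = 2 * C0"
  have C: "0 < C" unfolding C_def using C0 by simp
  have crit2: "ereal 2 < critical_exponent DIM('a)"
    using p(1) by (intro less_trans[OF _ p(2)]) simp
  have B: "0 \<le> B" unfolding B_def by simp
  obtain \<epsilon>0 where \<epsilon>0: "0 < \<epsilon>0" "\<And>K v. \<lbrakk>K \<in> borel_measurable ?M; AE x in ?M. \<bar>K x\<bar> \<le> B;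
      AE x in ?M. x \<notin> ball 0 \<epsilon>0 \<longrightarrow> K x = 0; v \<in> H10 \<Omega>\<rbrakk> \<Longrightarrow>
      (H1_norm \<Omega> v)\<^sup>2 \<le> 2 * C0 * energy \<Omega> (\<lambda>x. V x + K x) \<Omega> v"
  proof (rule perturbed_coercive[OF \<Omega> V(1,2) C0 crit2 B])
    fix \<epsilon> assume "0 < \<epsilon>" "\<And>K v. \<lbrakk>K \<in> borel_measurable ?M; AE x in ?M. \<bar>K x\<bar> \<le> B;
      AE x in ?M. x \<notin> ball 0 \<epsilon> \<longrightarrow> K x = 0; v \<in> H10 \<Omega>\<rbrakk> \<Longrightarrow>
      (H1_norm \<Omega> v)\<^sup>2 \<le> 2 * C0 * energy \<Omega> (\<lambda>x. V x + K x) \<Omega> v"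
    then show thesis by (rule that)
  qed

  define E where "E n = energy \<Omega> (Vn n) \<Omega> (u n)" for n
  define X where "X \<epsilon> n = energy \<Omega> (Vn n) (\<Omega> - ball 0 \<epsilon>) (u n)" for \<epsilon> n
  define P where "P \<epsilon> n = (\<integral>x. \<bar>u n x\<bar> powr p \<partial>lebesgue_on (\<Omega> - ball 0 \<epsilon>))" for \<epsilon> n
  define T where "T n = (\<integral>x. \<bar>u n x\<bar> powr p \<partial>?M)" for n
  have P0: "0 \<le> P \<epsilon> n" for \<epsilon> n unfolding P_def by simp
  \<comment> \<open>The properties of a single solution that hold for all large \<open>n\<close>.\<close>
  define good where "good n \<longleftrightarrow> weak_solution \<Omega> p (Vn n) (Q n) (u n) \<and> u n \<in> H10 \<Omega> \<and> 0 < E n \<and>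
    (H1_norm \<Omega> (u n))\<^sup>2 \<le> C * E n \<and> integrable ?M (\<lambda>x. \<bar>u n x\<bar> powr p)" for n
  have good: "\<forall>\<^sub>F n in sequentially. good n"
    using u K0[OF \<epsilon>0(1)]
  proof eventually_elim
    fix n assume sol: "weak_solution \<Omega> p (Vn n) (Q n) (u n) \<and> nontrivial_on \<Omega> (u n)"
      and Kn: "AE x in ?M. x \<notin> ball 0 \<epsilon>0 \<longrightarrow> K n x = 0"
    have un: "u n \<in> H10 \<Omega>" using sol unfolding weak_solution_def by simp
    then have uH: "u n \<in> H1 \<Omega>" unfolding H10_def by simp
    have co: "(H1_norm \<Omega> (u n))\<^sup>2 \<le> C * E n"
      using \<epsilon>0(2)[OF K Kn un] unfolding C_def E_def Vn .
    have i2: "integrable ?M (\<lambda>x. (u n x)\<^sup>2)" using LtwoD(2)[OF H1D(1)[OF \<Omega> uH]] by simp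
    have "(\<integral>x. (u n x)\<^sup>2 \<partial>?M) \<noteq> 0"
      using sol integral_nonneg_eq_0_iff_AE[OF i2] unfolding nontrivial_on_def by simp
    then have "0 < (\<integral>x. (u n x)\<^sup>2 \<partial>?M)" by (simp add: less_le)
    also have "\<dots> \<le> C * E n" using integral_square_le_H1_norm(1)[of \<Omega> "u n"] co by linarith
    finally have E: "0 < E n" using C by (simp add: zero_less_mult_iff)
    have \<kappa>: "0 < H1_norm \<Omega> (u n) + 1" "H1_norm \<Omega> (u n) \<le> H1_norm \<Omega> (u n) + 1"
      by (auto simp: H1_norm_def add_nonneg_pos)
    obtain C' where "integrable ?M (\<lambda>x. \<bar>u n x\<bar> powr p) \<and> (\<integral>x. \<bar>u n x\<bar> powr p \<partial>?M) \<le> C' * (H1_norm \<Omega> (u n) + 1) powr p"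
      using H10_powr_bound[OF less_imp_le[OF p(1)] p(2)] \<Omega> un \<kappa> by metis
    with sol un E co show "good n" unfolding good_def by simp
  qed
  have E_le_on: "E n \<le> D * (\<integral>x. indicator S x * \<bar>u n x\<bar> powr p \<partial>?M)"
    if g: "good n" and S: "S \<in> sets borel" and neg: "AE x in ?M. x \<notin> S \<longrightarrow> Q n x \<le> 0" for n S
  proof -
    have up: "integrable ?M (\<lambda>x. \<bar>u n x\<bar> powr p)" using g unfolding good_def by simp
    have "E n = (\<integral>x. Q n x * \<bar>u n x\<bar> powr p \<partial>?M)"
      using g weak_solution_energy_eq unfolding good_def E_def by blast
    also have "\<dots> \<le> (\<integral>x. D * (indicator S x * \<bar>u n x\<bar> powr p) \<partial>?M)"
    proof (rule integral_mono_AE[OF integrable_bounded_mult[OF Q up]])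
      show "integrable ?M (\<lambda>x. D * (indicator S x * \<bar>u n x\<bar> powr p))"
        by (intro integrable_mult_right integrable_indicator_mult up S)
      show "AE x in ?M. Q n x * \<bar>u n x\<bar> powr p \<le> D * (indicator S x * \<bar>u n x\<bar> powr p)"
        using Q(2)[of n] neg
        by eventually_elim (auto simp: indicator_def intro!: mult_right_mono mult_nonpos_nonneg)
    qed
    finally show ?thesis by simp
  qed
  have E_le: "E n \<le> D * T n" if "good n" for n
    using E_le_on[OF that, of UNIV] unfolding T_def by simp

  have E_large: "\<forall>\<^sub>F n in sequentially. R \<le> E n" if R: "0 < R" for R
  proof -
    \<comment> \<open>If \<open>E n < R\<close>, the Sobolev bound with this \<open>\<eta>\<close> would give \<open>E n \<le> E n / 2\<close>.\<close>
    define c where "c = D * C powr (p / 2) * R powr (p / 2 - 1)"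
    have c: "0 < c" unfolding c_def using D C R by simp
    define \<eta> where "\<eta> = 1 / (2 * c)"
    have \<eta>: "0 < \<eta>" unfolding \<eta>_def using c by simp
    obtain r where r: "0 < r" "\<And>\<Omega> (v :: 'a \<Rightarrow> real) \<kappa>. \<lbrakk>open \<Omega>; v \<in> H10 \<Omega>; 0 < \<kappa>; H1_norm \<Omega> v \<le> \<kappa>\<rbrakk> \<Longrightarrow>
        (\<integral>x. indicator (ball 0 r) x * \<bar>v x\<bar> powr p \<partial>lebesgue_on \<Omega>) \<le> \<eta> * \<kappa> powr p"
      by (rule H10_powr_small_ball[OF less_imp_le[OF p(1)] p(2) \<eta>]) blast
    obtain \<delta> where \<delta>: "0 < \<delta>" "\<forall>\<^sub>F n in sequentially. AE x in ?M. x \<notin> ball 0 r \<longrightarrow> Q n x \<le> - \<delta>"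
      using Q0[OF r(1)] by blast
    show ?thesis using good \<delta>(2)
    proof eventually_elim
      fix n assume g: "good n" and Qn: "AE x in ?M. x \<notin> ball 0 r \<longrightarrow> Q n x \<le> - \<delta>"
      have E0: "0 < E n" and un: "u n \<in> H10 \<Omega>" and co: "(H1_norm \<Omega> (u n))\<^sup>2 \<le> C * E n"
        using g unfolding good_def by auto
      \<comment> \<open>Coercivity: this scale dominates the \<open>H\<^sup>1\<close> norm of \<open>u n\<close>.\<close>
      define \<kappa> where "\<kappa> = sqrt (C * E n)"
      have \<kappa>: "0 < \<kappa>" "H1_norm \<Omega> (u n) \<le> \<kappa>"
        unfolding \<kappa>_def using C E0 co by (auto intro: real_le_rsqrt)
      have "AE x in ?M. x \<notin> ball 0 r \<longrightarrow> Q n x \<le> 0"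
        using Qn by eventually_elim (use \<delta>(1) in auto)
      then have "E n \<le> D * (\<integral>x. indicator (ball 0 r) x * \<bar>u n x\<bar> powr p \<partial>?M)"
        by (intro E_le_on g) simp
      also have "\<dots> \<le> D * (\<eta> * \<kappa> powr p)"
        using D by (intro mult_left_mono r(2)[OF \<Omega> un \<kappa>]) auto
      also have "\<kappa> powr p = (C * E n) powr (p / 2)"
        unfolding \<kappa>_def using C E0 by (simp add: powr_half_sqrt[symmetric] powr_powr)
      also have "\<dots> = C powr (p / 2) * (E n * E n powr (p / 2 - 1))"
        using C E0 by (simp add: powr_mult powr_diff)
      finally have le: "E n \<le> E n * (\<eta> * (D * C powr (p / 2) * E n powr (p / 2 - 1)))"
        by (simp add: mult_ac)
      show "R \<le> E n"
      proof (rule ccontr)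
        assume "\<not> R \<le> E n"
        then have "E n powr (p / 2 - 1) \<le> R powr (p / 2 - 1)" using E0 p(1) by (intro powr_mono2) auto
        then have "\<eta> * (D * C powr (p / 2) * E n powr (p / 2 - 1)) \<le> \<eta> * c"
          unfolding c_def using \<eta> D by (intro mult_left_mono) auto
        also have "\<dots> = 1 / 2" unfolding \<eta>_def using c by simp
        finally have "E n * (\<eta> * (D * C powr (p / 2) * E n powr (p / 2 - 1))) \<le> E n * (1 / 2)"
          using E0 by (intro mult_left_mono) auto
        with le E0 show False by simp
      qed
    qed
  qed

  define A where "A \<epsilon> = cball 0 \<epsilon> - ball (0::'a) (\<epsilon> / 2)" for \<epsilon>
  define I where "I \<epsilon> n = (\<integral>x. indicator (A \<epsilon>) x * (u n x)\<^sup>2 \<partial>?M)" for \<epsilon> n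
  \<comment> \<open>The exterior estimate with all \<open>\<tau>\<close> at once; \<open>L\<close> and \<open>\<delta>\<close> depend on \<open>\<epsilon>\<close> only.\<close>
  define ext_bound where "ext_bound \<epsilon> L \<delta> n \<longleftrightarrow>
    (\<forall>\<tau>>0. 0 \<le> X \<epsilon> n \<and> X \<epsilon> n + \<delta> * P \<epsilon> n \<le> L * (I \<epsilon> n / \<tau> + \<tau> * (C * E n)))" for \<epsilon> L \<delta> n
  have ext: "\<exists>L\<ge>0. \<exists>\<delta>>0. \<forall>\<^sub>F n in sequentially. ext_bound \<epsilon> L \<delta> n"
    if \<epsilon>: "0 < \<epsilon>" for \<epsilon>
  proof -
    obtain \<zeta> :: "'a \<Rightarrow> real" and L where \<zeta>: "\<And>k. Ck k \<zeta>" "\<And>x. 0 \<le> \<zeta> x" "\<And>x. \<zeta> x \<le> 1"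
      "\<And>x. norm x < \<epsilon> / 2 \<Longrightarrow> \<zeta> x = 0" "\<And>x. \<epsilon> \<le> norm x \<Longrightarrow> \<zeta> x = 1"
      and L: "0 \<le> L" "\<And>x. norm (gradient \<zeta> x) \<le> L * indicator (A \<epsilon>) x"
      using cutoff_with_annular_gradient[OF \<epsilon>] unfolding A_def by metis
    have Ab: "A \<epsilon> \<in> sets borel" unfolding A_def by simp
    have \<epsilon>2: "0 < \<epsilon> / 2" using \<epsilon> by simp
    obtain \<delta> where \<delta>: "0 < \<delta>" "\<forall>\<^sub>F n in sequentially. AE x in ?M. x \<notin> ball 0 (\<epsilon> / 2) \<longrightarrow> Q n x \<le> - \<delta>"
      using Q0[OF \<epsilon>2] by blast
    have "\<forall>\<^sub>F n in sequentially. ext_bound \<epsilon> L \<delta> n"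
      using good \<delta>(2) K0[OF \<epsilon>2]
    proof eventually_elim
      fix n assume g: "good n" and Qn: "AE x in ?M. x \<notin> ball 0 (\<epsilon> / 2) \<longrightarrow> Q n x \<le> - \<delta>"
        and Kn: "AE x in ?M. x \<notin> ball 0 (\<epsilon> / 2) \<longrightarrow> K n x = 0"
      have out: "AE x in ?M. x \<notin> ball 0 (\<epsilon> / 2) \<longrightarrow> 0 \<le> Vn n x \<and> Q n x \<le> - \<delta>"
        using V(3) Qn Kn by eventually_elim (auto simp: Vn)
      have sol: "weak_solution \<Omega> p (Vn n) (Q n) (u n)" and up: "integrable ?M (\<lambda>x. \<bar>u n x\<bar> powr p)"
        and co: "(H1_norm \<Omega> (u n))\<^sup>2 \<le> C * E n" using g unfolding good_def by auto
      have grad: "(\<integral>x. (norm (wgrad \<Omega> (u n) x))\<^sup>2 \<partial>?M) \<le> C * E n"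
        using integral_square_le_H1_norm(2)[of \<Omega> "u n"] co by linarith
      show "ext_bound \<epsilon> L \<delta> n"
        unfolding ext_bound_def
      proof (intro allI impI)
        fix \<tau> :: real assume \<tau>: "0 < \<tau>"
        note est = exterior_energy_estimate[OF \<epsilon> \<zeta> L Ab \<Omega> sol Vnm Q up \<delta>(1) out \<tau>]
        have "L * (I \<epsilon> n / \<tau> + \<tau> * (\<integral>x. (norm (wgrad \<Omega> (u n) x))\<^sup>2 \<partial>?M)) \<le> L * (I \<epsilon> n / \<tau> + \<tau> * (C * E n))"
          using L(1) \<tau> grad by (intro mult_left_mono add_left_mono) auto
        with est show "0 \<le> X \<epsilon> n \<and> X \<epsilon> n + \<delta> * P \<epsilon> n \<le> L * (I \<epsilon> n / \<tau> + \<tau> * (C * E n))"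
          unfolding X_def P_def I_def by linarith
      qed
    qed
    with L(1) \<delta>(1) show ?thesis by blast
  qed

  \<comment> \<open>First, crude use of the exterior estimate, with \<open>\<tau> = 1\<close>.\<close>
  have P_bounded: "\<exists>L1\<ge>0. \<forall>\<^sub>F n in sequentially. P \<epsilon> n \<le> L1 * E n" if \<epsilon>: "0 < \<epsilon>" for \<epsilon>
  proof -
    obtain L \<delta> where L: "0 \<le> L" "0 < \<delta>" and ev: "\<forall>\<^sub>F n in sequentially. ext_bound \<epsilon> L \<delta> n"
      using ext[OF \<epsilon>] by blast
    have "\<forall>\<^sub>F n in sequentially. P \<epsilon> n \<le> (2 * L * C / \<delta>) * E n"
      using good ev
    proof eventually_elim
      fix n assume g: "good n" and e: "ext_bound \<epsilon> L \<delta> n"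
      have uH: "u n \<in> H1 \<Omega>" and co: "(H1_norm \<Omega> (u n))\<^sup>2 \<le> C * E n"
        using g unfolding good_def H10_def by auto
      have i2: "integrable ?M (\<lambda>x. (u n x)\<^sup>2)" using LtwoD(2)[OF H1D(1)[OF \<Omega> uH]] by simp
      have "I \<epsilon> n \<le> (\<integral>x. (u n x)\<^sup>2 \<partial>?M)"
        unfolding I_def A_def by (intro integral_mono integrable_indicator_mult i2) (auto simp: indicator_def)
      also have "\<dots> \<le> C * E n" using integral_square_le_H1_norm(1)[of \<Omega> "u n"] co by linarith
      finally have "L * (I \<epsilon> n / 1 + 1 * (C * E n)) \<le> L * (2 * (C * E n))"
        using L(1) by (intro mult_left_mono) auto
      moreover have "0 \<le> X \<epsilon> n \<and> X \<epsilon> n + \<delta> * P \<epsilon> n \<le> L * (I \<epsilon> n / 1 + 1 * (C * E n))"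
        using e[unfolded ext_bound_def, rule_format, of 1] by simp
      ultimately have "\<delta> * P \<epsilon> n \<le> L * (2 * (C * E n))" by linarith
      then show "P \<epsilon> n \<le> (2 * L * C / \<delta>) * E n" using L(2) by (simp add: field_simps)
    qed
    moreover have "0 \<le> 2 * L * C / \<delta>" using L C by simp
    ultimately show ?thesis by blast
  qed

  have small: "\<forall>\<^sub>F n in sequentially. 0 \<le> X \<epsilon> n \<and> X \<epsilon> n \<le> \<theta> * E n \<and> P \<epsilon> n \<le> \<theta> * E n"
    if \<epsilon>: "0 < \<epsilon>" and \<theta>: "0 < \<theta>" for \<epsilon> \<theta>
  proof -
    obtain L \<delta> where L: "0 \<le> L" "0 < \<delta>" and ev: "\<forall>\<^sub>F n in sequentially. ext_bound \<epsilon> L \<delta> n"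
      using ext[OF \<epsilon>] by blast
    obtain L1 where L1: "0 \<le> L1" "\<forall>\<^sub>F n in sequentially. P (\<epsilon> / 2) n \<le> L1 * E n"
      using P_bounded[of "\<epsilon> / 2"] \<epsilon> by auto
    define \<theta>' where "\<theta>' = \<theta> * min 1 \<delta>"
    have \<theta>': "0 < \<theta>'" "\<theta>' \<le> \<theta>" "\<theta>' \<le> \<theta> * \<delta>" unfolding \<theta>'_def using \<theta> L by (auto simp: mult_left_le)
    \<comment> \<open>The parameters are chosen in this order: \<open>\<tau>\<close> handles the gradient term, \<open>\<rho>\<close> is the admissible share of the annulus term, the level \<open>l\<close> halves it, and \<open>R\<close> makes \<open>l\<^sup>2 vol\<close> the other half.\<close>
    define \<tau> where "\<tau> = \<theta>' / (2 * (L * C + 1))"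
    have LC: "0 < L * C + 1" using L C by (intro add_nonneg_pos) auto
    have \<tau>: "0 < \<tau>" unfolding \<tau>_def using \<theta>' LC by simp
    have "\<tau> * (2 * (L * C + 1)) = \<theta>'" unfolding \<tau>_def using LC by simp
    then have \<tau>LC: "L * \<tau> * C \<le> \<theta>' / 2" using \<tau> by (simp add: algebra_simps)
    define \<rho> where "\<rho> = \<theta>' * \<tau> / (2 * (L + 1))"
    have \<rho>: "0 < \<rho>" unfolding \<rho>_def using \<theta>' \<tau> L by simp
    have "\<rho> / \<tau> = \<theta>' / (2 * (L + 1))" unfolding \<rho>_def using \<tau> by simp
    moreover have "2 * (L + 1) \<noteq> 0" using L by simp
    ultimately have "\<rho> / \<tau> * (2 * (L + 1)) = \<theta>'" by (metis nonzero_eq_divide_eq)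
    moreover have "0 < \<rho> / \<tau>" using \<rho> \<tau> by simp
    moreover have "t * (2 * (L + 1)) = 2 * (L * t) + 2 * t" for t by (simp add: algebra_simps)
    ultimately have L\<rho>: "L * (\<rho> / \<tau>) \<le> \<theta>' / 2" by (simp only:)
    define b where "b = (\<rho> / 2) / (L1 + 1)"
    have b: "0 < b" "b * L1 \<le> \<rho> / 2" unfolding b_def using \<rho> L1 by (auto simp: field_simps)
    define l where "l = b powr (1 / (2 - p))"
    have l: "0 < l" "l powr (2 - p) = b" unfolding l_def using b p by (auto simp: powr_powr)
    define vol where "vol = (\<integral>x. indicator (A \<epsilon>) x \<partial>?M :: real)"
    define R where "R = l\<^sup>2 * vol * 2 / \<rho> + 1"
    have vol: "0 \<le> vol" unfolding vol_def by (intro integral_nonneg_AE AE_I2) auto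
    have R: "0 < R" unfolding R_def using vol \<rho> by (intro add_nonneg_pos) auto
    show ?thesis using good ev L1(2) E_large[OF R]
    proof eventually_elim
      fix n assume g: "good n" and e: "ext_bound \<epsilon> L \<delta> n"
        and P1: "P (\<epsilon> / 2) n \<le> L1 * E n" and RE: "R \<le> E n"
      have uH: "u n \<in> H1 \<Omega>" and up: "integrable ?M (\<lambda>x. \<bar>u n x\<bar> powr p)" and E0: "0 < E n"
        using g unfolding good_def H10_def by auto
      have "I \<epsilon> n \<le> l\<^sup>2 * vol + b * P (\<epsilon> / 2) n"
        using annulus_square_le_powr[OF \<Omega> H1D(1)[OF \<Omega> uH] p(1) up l(1), of \<epsilon> "\<epsilon> / 2"]
        unfolding vol_def P_def I_def A_def l(2) .
      also have "l\<^sup>2 * vol \<le> \<rho> / 2 * E n"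
      proof -
        have "l\<^sup>2 * vol = \<rho> / 2 * (R - 1)" unfolding R_def using \<rho> by simp
        also have "\<dots> \<le> \<rho> / 2 * E n" using RE \<rho> by (intro mult_left_mono) auto
        finally show ?thesis .
      qed
      also have "b * P (\<epsilon> / 2) n \<le> b * (L1 * E n)" using b P1 by (intro mult_left_mono) auto
      also have "\<dots> = (b * L1) * E n" by simp
      also have "\<dots> \<le> \<rho> / 2 * E n" using b E0 by (intro mult_right_mono) auto
      finally have I: "I \<epsilon> n \<le> \<rho> * E n" by simp
      have "L * (I \<epsilon> n / \<tau> + \<tau> * (C * E n)) \<le> L * (\<rho> * E n / \<tau> + \<tau> * (C * E n))"
        using L(1) I \<tau> by (intro mult_left_mono add_right_mono divide_right_mono) auto
      also have "\<dots> = (L * (\<rho> / \<tau>) + L * \<tau> * C) * E n" by (simp add: algebra_simps)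
      also have "\<dots> \<le> (\<theta>' / 2 + \<theta>' / 2) * E n"
        using \<tau>LC L\<rho> E0 by (intro mult_right_mono add_mono) auto
      finally have tot: "0 \<le> X \<epsilon> n" "X \<epsilon> n + \<delta> * P \<epsilon> n \<le> \<theta>' * E n"
        using e \<tau> unfolding ext_bound_def by (auto intro: order_trans)
      have dP: "0 \<le> \<delta> * P \<epsilon> n" using L(2) P0 by simp
      have "X \<epsilon> n \<le> \<theta>' * E n" using tot dP by linarith
      also have "\<dots> \<le> \<theta> * E n" using \<theta>' E0 by (intro mult_right_mono) auto
      finally have Xle: "X \<epsilon> n \<le> \<theta> * E n" .
      have "\<delta> * P \<epsilon> n \<le> \<theta>' * E n" using tot by linarith
      also have "\<dots> \<le> \<theta> * \<delta> * E n" using \<theta>' E0 by (intro mult_right_mono) auto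
      finally have "\<delta> * P \<epsilon> n \<le> \<delta> * (\<theta> * E n)" by (simp add: mult_ac)
      then have "P \<epsilon> n \<le> \<theta> * E n" using L(2) by simp
      with tot Xle show "0 \<le> X \<epsilon> n \<and> X \<epsilon> n \<le> \<theta> * E n \<and> P \<epsilon> n \<le> \<theta> * E n" by simp
    qed
  qed

  have XE: "(\<lambda>n. X \<epsilon> n / E n) \<longlonglongrightarrow> 0" if \<epsilon>: "0 < \<epsilon>" for \<epsilon>
  proof (rule tendsto_0_of_eventually_le)
    fix \<theta> :: real assume "0 < \<theta>"
    from small[OF \<epsilon> this] good show "\<forall>\<^sub>F n in sequentially. 0 \<le> X \<epsilon> n / E n \<and> X \<epsilon> n / E n \<le> \<theta>"
      by eventually_elim (auto simp: good_def field_simps)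
  qed
  have PE: "(\<lambda>n. P \<epsilon> n / E n) \<longlonglongrightarrow> 0" if \<epsilon>: "0 < \<epsilon>" for \<epsilon>
  proof (rule tendsto_0_of_eventually_le)
    fix \<theta> :: real assume "0 < \<theta>"
    from small[OF \<epsilon> this] good show "\<forall>\<^sub>F n in sequentially. 0 \<le> P \<epsilon> n / E n \<and> P \<epsilon> n / E n \<le> \<theta>"
      by eventually_elim (auto simp: good_def field_simps P0)
  qed
  show ?thesis
  proof (intro allI impI conjI)
    fix \<epsilon> :: real assume \<epsilon>: "0 < \<epsilon>"
    let ?S = "\<Omega> - ball 0 \<epsilon>"
    have S: "?S \<in> sets lebesgue" "?S \<subseteq> \<Omega>" using \<Omega> by auto
    show "(\<lambda>n. energy \<Omega> (Vn n) ?S (u n) / energy \<Omega> (Vn n) \<Omega> (u n)) \<longlonglongrightarrow> 0"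
      using XE[OF \<epsilon>] unfolding X_def E_def .
    show "(\<lambda>n. energy \<Omega> (Vn n) ?S (w n)) \<longlonglongrightarrow> 0"
    proof (rule Lim_transform_eventually[OF XE[OF \<epsilon>]])
      show "\<forall>\<^sub>F n in sequentially. X \<epsilon> n / E n = energy \<Omega> (Vn n) ?S (w n)"
        using good
      proof eventually_elim
        fix n assume g: "good n"
        have uH: "u n \<in> H1 \<Omega>" and E0: "0 < E n" using g unfolding good_def H10_def by auto
        have "w n = (\<lambda>x. (1 / sqrt (E n)) * u n x)" unfolding w energy_norm_def E_def by simp
        then show "X \<epsilon> n / E n = energy \<Omega> (Vn n) ?S (w n)"
          using energy_scale[OF \<Omega> uH Vnm(1) S, of n "1 / sqrt (E n)"] E0
          by (simp add: X_def power_divide)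
      qed
    qed
    show "(\<lambda>n. energy_norm \<Omega> (Vn n) (u n) powr (p - 2) * (\<integral>x. \<bar>w n x\<bar> powr p \<partial>lebesgue_on ?S)) \<longlonglongrightarrow> 0"
    proof (rule Lim_transform_eventually[OF PE[OF \<epsilon>]])
      show "\<forall>\<^sub>F n in sequentially. P \<epsilon> n / E n =
          energy_norm \<Omega> (Vn n) (u n) powr (p - 2) * (\<integral>x. \<bar>w n x\<bar> powr p \<partial>lebesgue_on ?S)"
        using good
      proof eventually_elim
        fix n assume g: "good n"
        define s where "s = energy_norm \<Omega> (Vn n) (u n)"
        have E0: "0 < E n" using g unfolding good_def by auto
        have s: "0 < s" "s\<^sup>2 = E n" using E0 unfolding s_def energy_norm_def E_def by auto
        have "(\<integral>x. \<bar>w n x\<bar> powr p \<partial>lebesgue_on ?S) = (\<integral>x. \<bar>u n x\<bar> powr p / s powr p \<partial>lebesgue_on ?S)"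
          unfolding w s_def[symmetric] using s(1) by (simp add: powr_divide)
        also have "\<dots> = P \<epsilon> n / s powr p" unfolding P_def by simp
        finally have "s powr (p - 2) * (\<integral>x. \<bar>w n x\<bar> powr p \<partial>lebesgue_on ?S) = P \<epsilon> n * (s powr (p - 2) / s powr p)"
          by simp
        also have "s powr (p - 2) / s powr p = 1 / E n"
          using s by (simp add: powr_diff)
        finally show "P \<epsilon> n / E n = energy_norm \<Omega> (Vn n) (u n) powr (p - 2) * (\<integral>x. \<bar>w n x\<bar> powr p \<partial>lebesgue_on ?S)"
          unfolding s_def by simp
      qed
    qed
    have "(\<lambda>n. P \<epsilon> n / T n) \<longlonglongrightarrow> 0"
    proof (rule tendsto_0_of_eventually_le)
      fix \<theta> :: real assume \<theta>: "0 < \<theta>"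
      have "0 < \<theta> / D" using \<theta> D by simp
      from small[OF \<epsilon> this] good show "\<forall>\<^sub>F n in sequentially. 0 \<le> P \<epsilon> n / T n \<and> P \<epsilon> n / T n \<le> \<theta>"
      proof eventually_elim
        fix n assume s: "0 \<le> X \<epsilon> n \<and> X \<epsilon> n \<le> \<theta> / D * E n \<and> P \<epsilon> n \<le> \<theta> / D * E n" and g: "good n"
        have "0 < E n" using g unfolding good_def by auto
        then have "0 < D * T n" using E_le[OF g] by linarith
        then have T: "0 < T n" using D by (simp add: zero_less_mult_iff)
        have "\<theta> / D * E n \<le> \<theta> / D * (D * T n)" using E_le[OF g] \<theta> D by (intro mult_left_mono) auto
        then have "P \<epsilon> n \<le> \<theta> * T n" using s D by simp
        then show "0 \<le> P \<epsilon> n / T n \<and> P \<epsilon> n / T n \<le> \<theta>" using T P0 by (simp add: field_simps)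
      qed
    qed
    then show "(\<lambda>n. (\<integral>x. \<bar>u n x\<bar> powr p \<partial>lebesgue_on ?S) / (\<integral>x. \<bar>u n x\<bar> powr p \<partial>?M)) \<longlonglongrightarrow> 0"
      unfolding P_def T_def .
  qed
qed

end
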